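(* Let $\mathbb{D}=\{z\in\mathbb{C}:|z|<1\}$ and $\mathbb{D}^*=\{z\in\mathbb{C}:0<|z|<1\}$. Let $1\le p<\infty$ and let $f=f_1\,d\bar z_1+f_2\,d\bar z_2$ be a $(0,1)$-form that is $\bar\partial$-closed in the weak sense on $\mathbb{D}\times\mathbb{D}^*$. Assume that $f\in \mathcal{B}$, i.e. $f_1,f_2,\mathscr{D}f\in L^p(\mathbb{D}\times\mathbb{D}^* )$. Then $Tf$ defined by $$ \begin{aligned} T(f)(z_1,z_2) &=\frac{-1}{2 \pi i}\int_{\mathbb{D}^*}\frac{f_2(z_1,\zeta_2)}{\zeta_2-z_2}\,d\bar \zeta_2\wedge d\zeta_2+\frac{-1}{2 \pi i}\int_{\mathbb{D}}\frac{f_1(\zeta_1,z_2)}{\zeta_1-z_1}\,d\bar \zeta_1\wedge d\zeta_1\\ &\quad+\frac{-1}{(2 \pi i)^2}\int_{\mathbb{D}\times\mathbb{D}^*}\frac{(\mathscr{D}f)(\zeta_1,\zeta_2)}{(\zeta_1-z_1)(\zeta_2-z_2)}\,d\bar \zeta_1\wedge d\zeta_1\wedge d\bar \zeta_2\wedge d\zeta_2 \end{aligned} $$ is well-defined, weakly solves $\bar\partial(Tf)=f$ on $\mathbb{D}\times\mathbb{D}^*$, and satisfies the estimate $$ \|T(f)\|_{L^p(\mathbb{D}\times \mathbb{D}^* )}\le C \|f\|_{\mathcal{B}} $$ for a constant $C>0$ independent of $f$.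
   Context: For a $(0,1)$-form $f=f_1\,d\bar z_1+f_2\,d\bar z_2$, set $\mathscr{D} f= \frac 12\left( \frac{\partial f_1}{\partial\bar z_2} + \frac{\partial f_2}{\partial\bar z_1}\right)$, derivatives in the distributional sense. For $1\le p<\infty$, $\mathcal{B}$ is the Banach space of $(0,1)$-forms on $\mathbb{D}\times\mathbb{D}^*$ with $f_1,f_2,\mathscr{D}f\in L^p(\mathbb{D}\times\mathbb{D}^* )$, normed by $\|f\|_{\mathcal{B}}=\|f_1\|_{L^p}+\|f_2\|_{L^p}+\|\mathscr{D}f\|_{L^p}$ (norms over $\mathbb{D}\times\mathbb{D}^*$). Weakly $\bar\partial$-closed means $\frac{\partial f_1}{\partial\bar z_2}=\frac{\partial f_2}{\partial\bar z_1}$ as distributions; a weak solution of $\bar\partial u=f$ satisfies $\frac{\partial u}{\partial\bar z_j}=f_j$ as distributions, $j=1,2$. In one complex variable $d\bar\zeta\wedge d\zeta = 2i\,dA(\zeta)$, with $dA$ Lebesgue measure on $\mathbb{C}$. *)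

theory Defs
  imports "HOL-Analysis.Analysis"
begin

definition unit_disc :: "complex set" where
  "unit_disc = {z. cmod z < 1}"

definition punctured_disc :: "complex set" where
  "punctured_disc = {z. 0 < cmod z \<and> cmod z < 1}"

definition Omega :: "(complex \<times> complex) set" where
  "Omega = unit_disc \<times> punctured_disc"

definition Lp :: "real \<Rightarrow> (complex \<times> complex \<Rightarrow> complex) set" where
  "Lp p = {g. g \<in> borel_measurable (lebesgue_on Omega) \<and>
              integrable (lebesgue_on Omega) (\<lambda>z. cmod (g z) powr p)}"

definition Lp_norm :: "real \<Rightarrow> (complex \<times> complex \<Rightarrow> complex) \<Rightarrow> real" where
  "Lp_norm p g = (LINT z|lebesgue_on Omega. cmod (g z) powr p) powr (1 / p)"

definition loc_integrable :: "(complex \<times> complex \<Rightarrow> complex) \<Rightarrow> bool" where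
  "loc_integrable g \<longleftrightarrow> (\<forall>K. compact K \<and> K \<subseteq> Omega \<longrightarrow> integrable (lebesgue_on K) g)"

text \<open>\<open>Ck k g\<close>: all iterated directional (real) derivatives of \<open>g\<close> of order at most \<open>k\<close> exist
  and are continuous, so that \<open>\<forall>k. Ck k g\<close> says that \<open>g\<close> is smooth.\<close>

primrec Ck :: "nat \<Rightarrow> ('a::real_normed_vector \<Rightarrow> 'b::real_normed_vector) \<Rightarrow> bool" where
  "Ck 0 g \<longleftrightarrow> continuous_on UNIV g"
| "Ck (Suc k) g \<longleftrightarrow> (\<forall>x. g differentiable (at x)) \<and>
                    (\<forall>v. Ck k (\<lambda>x. frechet_derivative g (at x) v))"

definition test_functions :: "(complex \<times> complex \<Rightarrow> complex) set" where
  "test_functions = {\<phi>. (\<forall>k. Ck k \<phi>) \<and>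
     compact (closure {z. \<phi> z \<noteq> 0}) \<and> closure {z. \<phi> z \<noteq> 0} \<subseteq> Omega}"

text \<open>The Wirtinger derivatives \<open>\<partial>/\<partial>\<bar>z\<^sub>j = (\<partial>/\<partial>x\<^sub>j + i \<partial>/\<partial>y\<^sub>j) / 2\<close>.\<close>

definition dbar1 :: "(complex \<times> complex \<Rightarrow> complex) \<Rightarrow> complex \<times> complex \<Rightarrow> complex" where
  "dbar1 \<phi> z = (frechet_derivative \<phi> (at z) (1, 0) + \<i> * frechet_derivative \<phi> (at z) (\<i>, 0)) / 2"

definition dbar2 :: "(complex \<times> complex \<Rightarrow> complex) \<Rightarrow> complex \<times> complex \<Rightarrow> complex" where
  "dbar2 \<phi> z = (frechet_derivative \<phi> (at z) (0, 1) + \<i> * frechet_derivative \<phi> (at z) (0, \<i>)) / 2"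

text \<open>Distributions on \<open>Omega\<close> are functionals that are only relevant on \<open>test_functions\<close>; hence they
  are compared with \<open>distr_eq\<close>. Functions act by the bilinear pairing (no conjugation).\<close>

type_synonym distr = "(complex \<times> complex \<Rightarrow> complex) \<Rightarrow> complex"

definition distr_eq :: "distr \<Rightarrow> distr \<Rightarrow> bool" where
  "distr_eq S T \<longleftrightarrow> (\<forall>\<phi>\<in>test_functions. S \<phi> = T \<phi>)"

definition distr_of :: "(complex \<times> complex \<Rightarrow> complex) \<Rightarrow> distr" where
  "distr_of g \<phi> = (LINT z|lebesgue_on Omega. g z * \<phi> z)"

definition distr_dbar1 :: "distr \<Rightarrow> distr" where
  "distr_dbar1 S \<phi> = - S (dbar1 \<phi>)"

definition distr_dbar2 :: "distr \<Rightarrow> distr" where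
  "distr_dbar2 S \<phi> = - S (dbar2 \<phi>)"

text \<open>A \<open>(0,1)\<close>-form is given by its two coefficient functions \<open>f1\<close>, \<open>f2\<close>.\<close>

definition weakly_dbar_closed ::
  "(complex \<times> complex \<Rightarrow> complex) \<Rightarrow> (complex \<times> complex \<Rightarrow> complex) \<Rightarrow> bool" where
  "weakly_dbar_closed f1 f2 \<longleftrightarrow> loc_integrable f1 \<and> loc_integrable f2 \<and>
     distr_eq (distr_dbar2 (distr_of f1)) (distr_dbar1 (distr_of f2))"

definition weak_dbar_solution ::
  "(complex \<times> complex \<Rightarrow> complex) \<Rightarrow> (complex \<times> complex \<Rightarrow> complex) \<Rightarrow>
   (complex \<times> complex \<Rightarrow> complex) \<Rightarrow> bool" where
  "weak_dbar_solution u f1 f2 \<longleftrightarrow> loc_integrable u \<and>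
     distr_eq (distr_dbar1 (distr_of u)) (distr_of f1) \<and>
     distr_eq (distr_dbar2 (distr_of u)) (distr_of f2)"

definition scrD_distr ::
  "(complex \<times> complex \<Rightarrow> complex) \<Rightarrow> (complex \<times> complex \<Rightarrow> complex) \<Rightarrow> distr" where
  "scrD_distr f1 f2 \<phi> = 1 / 2 * (distr_dbar2 (distr_of f1) \<phi> + distr_dbar1 (distr_of f2) \<phi>)"

definition represents_scrD ::
  "(complex \<times> complex \<Rightarrow> complex) \<Rightarrow> (complex \<times> complex \<Rightarrow> complex) \<Rightarrow>
   (complex \<times> complex \<Rightarrow> complex) \<Rightarrow> bool" where
  "represents_scrD f1 f2 g \<longleftrightarrow> loc_integrable g \<and> distr_eq (scrD_distr f1 f2) (distr_of g)"

text \<open>A locally integrable function representing a distribution is unique up to null sets, so the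
  choice below only fixes a representative; it is meaningful only if one exists at all.\<close>

definition scrD ::
  "(complex \<times> complex \<Rightarrow> complex) \<Rightarrow> (complex \<times> complex \<Rightarrow> complex) \<Rightarrow>
   complex \<times> complex \<Rightarrow> complex" where
  "scrD f1 f2 = (SOME g. represents_scrD f1 f2 g)"

definition in_B ::
  "real \<Rightarrow> (complex \<times> complex \<Rightarrow> complex) \<Rightarrow> (complex \<times> complex \<Rightarrow> complex) \<Rightarrow> bool" where
  "in_B p f1 f2 \<longleftrightarrow> f1 \<in> Lp p \<and> f2 \<in> Lp p \<and>
     (\<exists>g. represents_scrD f1 f2 g) \<and> scrD f1 f2 \<in> Lp p"

definition B_norm ::
  "real \<Rightarrow> (complex \<times> complex \<Rightarrow> complex) \<Rightarrow> (complex \<times> complex \<Rightarrow> complex) \<Rightarrow> real" where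
  "B_norm p f1 f2 = Lp_norm p f1 + Lp_norm p f2 + Lp_norm p (scrD f1 f2)"

text \<open>The factors \<open>2 i\<close> and \<open>(2 i)\<^sup>2\<close> come from \<open>d\<bar>\<zeta> \<and> d\<zeta> = 2 i dA(\<zeta>)\<close>.\<close>

definition T_op ::
  "(complex \<times> complex \<Rightarrow> complex) \<Rightarrow> (complex \<times> complex \<Rightarrow> complex) \<Rightarrow>
   complex \<times> complex \<Rightarrow> complex" where
  "T_op f1 f2 = (\<lambda>(z1, z2).
       (- 1) / (2 * pi * \<i>) *
         (2 * \<i> * (LINT \<zeta>2|lebesgue_on punctured_disc. f2 (z1, \<zeta>2) / (\<zeta>2 - z2)))
     + (- 1) / (2 * pi * \<i>) *
         (2 * \<i> * (LINT \<zeta>1|lebesgue_on unit_disc. f1 (\<zeta>1, z2) / (\<zeta>1 - z1)))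
     + (- 1) / (2 * pi * \<i>)\<^sup>2 *
         ((2 * \<i>)\<^sup>2 * (LINT (\<zeta>1, \<zeta>2)|lebesgue_on Omega.
            scrD f1 f2 (\<zeta>1, \<zeta>2) / ((\<zeta>1 - z1) * (\<zeta>2 - z2)))))"

text \<open>\<open>T f\<close> is well-defined on \<open>Omega\<close>: at almost every point the three defining integrals converge
  absolutely (Bochner integrals would otherwise silently be \<open>0\<close>), and, coefficients being classes of
  functions modulo null sets, changing them on a null set changes \<open>T f\<close> only on a null set.\<close>

definition T_well_defined ::
  "(complex \<times> complex \<Rightarrow> complex) \<Rightarrow> (complex \<times> complex \<Rightarrow> complex) \<Rightarrow> bool" where
  "T_well_defined f1 f2 \<longleftrightarrow>
     (AE (z1, z2) in lebesgue_on Omega.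
        integrable (lebesgue_on punctured_disc) (\<lambda>\<zeta>2. f2 (z1, \<zeta>2) / (\<zeta>2 - z2)) \<and>
        integrable (lebesgue_on unit_disc) (\<lambda>\<zeta>1. f1 (\<zeta>1, z2) / (\<zeta>1 - z1)) \<and>
        integrable (lebesgue_on Omega)
          (\<lambda>(\<zeta>1, \<zeta>2). scrD f1 f2 (\<zeta>1, \<zeta>2) / ((\<zeta>1 - z1) * (\<zeta>2 - z2)))) \<and>
     (\<forall>f1' f2'. (AE z in lebesgue_on Omega. f1' z = f1 z \<and> f2' z = f2 z) \<longrightarrow>
        (AE z in lebesgue_on Omega. T_op f1' f2' z = T_op f1 f2 z))"

end

theory Submission
  imports Defs "HOL-Real_Asymp.Real_Asymp"
begin

text \<open>
  Let \<open>T\<^sub>j\<close> be the solid Cauchy transform in the variable \<open>z\<^sub>j\<close>, so that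
  \<open>T f = T\<^sub>2 f\<^sub>2 + T\<^sub>1 f\<^sub>1 - T\<^sub>1 T\<^sub>2 g\<close> with \<open>g = \<D> f = \<partial>f\<^sub>1/\<partial>\<bar>z\<^sub>2 = \<partial>f\<^sub>2/\<partial>\<bar>z\<^sub>1\<close>.
  The kernel \<open>1/(w - z)\<close> has uniformly bounded mass on the disc, so by Jensen's inequality each
  \<open>T\<^sub>j\<close> is bounded on \<open>L\<^sup>p\<close>, and Tonelli's theorem gives absolute convergence almost everywhere.

  By the Cauchy-Pompeiu formula \<open>T\<^sub>j\<close> inverts \<open>\<partial>/\<partial>\<bar>z\<^sub>j\<close>. It remains to see that
  \<open>\<partial>/\<partial>\<bar>z\<^sub>1 T\<^sub>2 f\<^sub>2 = T\<^sub>2 g\<close>, and symmetrically \<open>\<partial>/\<partial>\<bar>z\<^sub>2 T\<^sub>1 f\<^sub>1 = T\<^sub>1 g\<close>. The equation for \<open>f\<^sub>2\<close>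
  differentiates in \<open>z\<^sub>1\<close> only, so it may be tested against \<open>a(z\<^sub>1) b(z\<^sub>2)\<close> where \<open>b\<close> is a product of
  cutoffs exhausting the punctured disc and regularised kernels; dominated convergence then replaces
  \<open>b\<close> by the Cauchy kernel itself. In particular the puncture contributes nothing.
\<close>

section \<open>Smooth functions and cutoffs\<close>

text \<open>The weak equation for \<open>f2\<close> contains no derivative in \<open>z2\<close>, so
  the factor \<open>b\<close> of a product test function is never differentiated. Cutoffs therefore
  only have to be bounded by 1 and converge pointwise to 1; their gradients may blow up at the
  circle and at the puncture. In the first equation the three terms give
  \<open>T2 g + f1 - T2 g\<close>. In the second the double transform is needed in the order
  \<open>T2 T1 g\<close>; Fubini's theorem makes the two orders agree almost everywhere. Lebesgue
  measure restricted to a set is complete and so is not a product measure. Hence the computations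
  use Borel representatives, extended by zero to the whole of C^2, and a kernel truncated to the
  disc. Statements about one variable are carried to the other by swapping coordinates; as the
  domain is not symmetric, the lemmas involved keep the planar sets as parameters.\<close>

lemma Ck_SucI:
  assumes "\<And>x. (g has_derivative D x) (at x)" and "\<And>v. Ck k (\<lambda>x. D x v)"
  shows "Ck (Suc k) g"
proof -
  have "frechet_derivative g (at x) = D x" for x
    using frechet_derivative_at[OF assms(1)] by metis
  then show ?thesis
    using assms by (auto simp: differentiable_def)
qed

lemma Ck_Suc_has_derivative:
  "Ck (Suc k) g \<Longrightarrow> (g has_derivative frechet_derivative g (at x)) (at x)"
  by (simp add: frechet_derivative_works)

lemma Ck_Suc_imp_Ck: "Ck (Suc k) g \<Longrightarrow> Ck k g"
proof (induction k arbitrary: g)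
  case 0
  then show ?case
    by (auto intro!: continuous_at_imp_continuous_on differentiable_imp_continuous_within)
next
  case (Suc k)
  then show ?case
    by (metis Ck.simps(2))
qed

lemma Ck_const: "Ck k (\<lambda>x. c)"
proof (induction k arbitrary: c)
  case (Suc k)
  show ?case
    by (rule Ck_SucI[where D="\<lambda>x v. 0"]) (auto intro: Suc)
qed simp

lemma Ck_add: "Ck k f \<Longrightarrow> Ck k g \<Longrightarrow> Ck k (\<lambda>x. f x + g x)"
proof (induction k arbitrary: f g)
  case 0
  then show ?case by (simp add: continuous_on_add)
next
  case (Suc k)
  show ?case
    by (rule Ck_SucI[where D="\<lambda>x v. frechet_derivative f (at x) v + frechet_derivative g (at x) v"])
      (use Suc in \<open>auto intro!: has_derivative_add simp: frechet_derivative_works\<close>)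
qed

lemma Ck_linear_comp:
  assumes "bounded_linear L"
  shows "Ck k g \<Longrightarrow> Ck k (\<lambda>x. L (g x))"
proof (induction k arbitrary: g)
  case 0
  then show ?case using assms by (auto intro: bounded_linear.continuous_on)
next
  case (Suc k)
  show ?case
    by (rule Ck_SucI[where D="\<lambda>x v. L (frechet_derivative g (at x) v)"])
      (use Suc assms in \<open>auto intro!: bounded_linear.has_derivative[OF assms] simp: frechet_derivative_works\<close>)
qed

text \<open>Affine substitutions cover both the projections in a tensor product and the embeddings
  that define slices of a test function.\<close>

lemma Ck_affine_comp:
  assumes L: "bounded_linear L"
  shows "Ck k g \<Longrightarrow> Ck k (\<lambda>x. g (c + L x))"
proof (induction k arbitrary: g)
  case 0
  then show ?case
    using continuous_on_compose2[of UNIV g UNIV "\<lambda>x. c + L x"] L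
    by (simp add: continuous_on_add linear_continuous_on)
next
  case (Suc k)
  have "((\<lambda>x. g (c + L x)) has_derivative (\<lambda>v. frechet_derivative g (at (c + L x)) (L v))) (at x)" for x
  proof -
    have "((\<lambda>x. c + L x) has_derivative L) (at x)"
      using L by (auto intro!: derivative_eq_intros bounded_linear_imp_has_derivative)
    from diff_chain_at[OF this Ck_Suc_has_derivative[OF Suc.prems]]
    show ?thesis by (simp add: o_def)
  qed
  then show ?case
    by (rule Ck_SucI) (use Suc in auto)
qed

lemma Ck_bounded_linear: "bounded_linear L \<Longrightarrow> Ck k L"
proof (induction k)
  case 0
  then show ?case by (simp add: linear_continuous_on)
next
  case (Suc k)
  show ?case
    by (rule Ck_SucI[where D="\<lambda>x. L"]) (intro bounded_linear_imp_has_derivative Suc.prems Ck_const)+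
qed

lemma Ck_mult:
  fixes f g :: "'a::real_normed_vector \<Rightarrow> 'b::real_normed_algebra"
  shows "Ck k f \<Longrightarrow> Ck k g \<Longrightarrow> Ck k (\<lambda>x. f x * g x)"
proof (induction k arbitrary: f g)
  case 0
  then show ?case by (simp add: continuous_on_mult)
next
  case (Suc k)
  show ?case
  proof (rule Ck_SucI)
    show "((\<lambda>x. f x * g x) has_derivative
      (\<lambda>v. f x * frechet_derivative g (at x) v + frechet_derivative f (at x) v * g x)) (at x)" for x
      using Suc.prems by (intro has_derivative_mult Ck_Suc_has_derivative)
    show "Ck k (\<lambda>x. f x * frechet_derivative g (at x) v + frechet_derivative f (at x) v * g x)" for v
      using Suc Ck_Suc_imp_Ck[of k f] Ck_Suc_imp_Ck[of k g] by (intro Ck_add Suc.IH) auto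
  qed
qed

text \<open>The derivative is again a product of inverses of \<open>g\<close> and one derivative of
  \<open>g\<close>, so the induction on the order closes up.\<close>

lemma Ck_inverse:
  fixes g :: "'a::real_normed_vector \<Rightarrow> 'b::real_normed_field"
  assumes "\<And>x. g x \<noteq> 0"
  shows "Ck k g \<Longrightarrow> Ck k (\<lambda>x. inverse (g x))"
proof (induction k)
  case 0
  then show ?case using assms by (auto intro!: continuous_intros)
next
  case (Suc k)
  show ?case
  proof (rule Ck_SucI)
    show "((\<lambda>x. inverse (g x)) has_derivative
        (\<lambda>v. - (inverse (g x) * frechet_derivative g (at x) v * inverse (g x)))) (at x)" for x
      using assms Suc.prems by (intro Deriv.has_derivative_inverse Ck_Suc_has_derivative)
    have "Ck k (\<lambda>x. (-1) * (inverse (g x) * frechet_derivative g (at x) v * inverse (g x)))" for v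
      using Suc Ck_Suc_imp_Ck[OF Suc.prems] by (intro Ck_mult Ck_const Suc.IH) auto
    then show "Ck k (\<lambda>x. - (inverse (g x) * frechet_derivative g (at x) v * inverse (g x)))" for v
      by simp
  qed
qed

section \<open>The function exp(-1/x), flat at 0\<close>

definition flat_exp :: "nat \<Rightarrow> real \<Rightarrow> real" where
  "flat_exp m x = (if x > 0 then exp (- (1 / x)) / x ^ m else 0)"

lemma flat_exp_nonneg: "0 \<le> flat_exp m x"
  by (simp add: flat_exp_def)

lemma flat_exp_le_1: "flat_exp 0 x \<le> 1"
  by (simp add: flat_exp_def)

text \<open>On the right, y = 1/x turns the quotient into y^m / exp y; on the left the function
  vanishes identically.\<close>

lemma flat_exp_tendsto_0: "(flat_exp m \<longlongrightarrow> 0) (at 0)"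
proof -
  have "((\<lambda>x::real. exp (- (1 / x)) / x ^ m) \<longlongrightarrow> 0) (at_right 0)"
  proof -
    have "((\<lambda>y. y ^ m / exp y) \<longlongrightarrow> (0::real)) at_top"
      by (rule tendsto_power_div_exp_0)
    from filterlim_compose[OF this filterlim_inverse_at_top_right]
    show ?thesis
      by (simp add: field_simps exp_minus)
  qed
  moreover have "\<forall>\<^sub>F x in at_right 0. exp (- (1 / x)) / x ^ m = flat_exp m x"
    by (auto simp: eventually_at_filter flat_exp_def)
  ultimately have "(flat_exp m \<longlongrightarrow> 0) (at_right 0)"
    by (rule Lim_transform_eventually)
  moreover have "(flat_exp m \<longlongrightarrow> 0) (at_left 0)"
    by (rule Lim_transform_eventually[OF tendsto_const]) (auto simp: eventually_at_filter flat_exp_def)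
  ultimately show ?thesis
    by (simp add: filterlim_at_split)
qed

text \<open>The powers of x in \<open>flat_exp\<close> are there for this formula: they make the
  family closed under differentiation.\<close>

lemma DERIV_flat_exp: "(flat_exp m has_real_derivative flat_exp (m + 2) x - m * flat_exp (m + 1) x) (at x)"
proof (cases x "0::real" rule: linorder_cases)
  case less
  have "((\<lambda>x. 0) has_real_derivative 0) (at x)" by simp
  then have "(flat_exp m has_real_derivative 0) (at x)"
    by (rule has_field_derivative_transform_within_open[where S="{..<0}"])
      (use less in \<open>auto simp: flat_exp_def\<close>)
  then show ?thesis using less by (simp add: flat_exp_def)
next
  case equal
  \<comment> \<open>The difference quotient at 0 is \<open>flat_exp (Suc m)\<close>, whose limit is
    already known.\<close>
  have "((\<lambda>h. (flat_exp m (0 + h) - flat_exp m 0) / h) \<longlongrightarrow> 0) (at 0)"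
    by (rule Lim_transform_eventually[OF flat_exp_tendsto_0[of "Suc m"]])
      (auto simp: eventually_at_filter flat_exp_def)
  then show ?thesis using equal by (simp add: DERIV_def flat_exp_def)
next
  case greater
  have "((\<lambda>x. exp (- inverse x) * inverse x ^ m) has_real_derivative
      exp (- inverse x) * inverse x ^ 2 * inverse x ^ m
        + exp (- inverse x) * (m * inverse x ^ (m - 1) * - (inverse x ^ 2))) (at x)"
    using greater by (auto intro!: derivative_eq_intros simp: power2_eq_square)
  also have "exp (- inverse x) * inverse x ^ 2 * inverse x ^ m
      + exp (- inverse x) * (m * inverse x ^ (m - 1) * - (inverse x ^ 2))
      = flat_exp (m + 2) x - m * flat_exp (m + 1) x"
    using greater by (cases m) (simp_all add: flat_exp_def divide_inverse power_inverse algebra_simps power2_eq_square)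
  finally show ?thesis
    by (rule has_field_derivative_transform_within_open[where S="{0<..}"])
      (use greater in \<open>auto simp: flat_exp_def divide_inverse power_inverse\<close>)
qed

text \<open>The induction has to vary \<open>m\<close>, since each derivative raises it by 1 and by
  2.\<close>

lemma Ck_flat_exp_comp:
  assumes "\<And>k. Ck k q"
  shows "Ck k (\<lambda>x. flat_exp m (q x))"
proof (induction k arbitrary: m)
  case 0
  have "continuous_on UNIV (flat_exp m)"
    by (meson DERIV_flat_exp DERIV_isCont continuous_at_imp_continuous_on)
  moreover have "continuous_on UNIV q" using assms[of 0] by simp
  ultimately show ?case
    by (auto intro: continuous_on_compose2)
next
  case (Suc k)
  show ?case
  proof (rule Ck_SucI)
    show "((\<lambda>x. flat_exp m (q x)) has_derivative
       (\<lambda>v. frechet_derivative q (at x) v * (flat_exp (m + 2) (q x) - m * flat_exp (m + 1) (q x)))) (at x)" for x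
      using diff_chain_at[OF Ck_Suc_has_derivative[OF assms] DERIV_flat_exp[unfolded has_field_derivative_def]]
      by (simp add: o_def mult.commute)
    have "Ck k (\<lambda>x. frechet_derivative q (at x) v * (flat_exp (m + 2) (q x) + (- real m) * flat_exp (m + 1) (q x)))" for v
      using assms[of "Suc k"] by (intro Ck_add Ck_mult Ck_const Suc.IH) simp
    then show "Ck k (\<lambda>x. frechet_derivative q (at x) v * (flat_exp (m + 2) (q x) - m * flat_exp (m + 1) (q x)))" for v
      by simp
  qed
qed

section \<open>Planar test functions, tensor products and slices\<close>

definition test_on :: "complex set \<Rightarrow> (complex \<Rightarrow> complex) set" where
  "test_on U = {a. (\<forall>k. Ck k a) \<and> compact (closure {z. a z \<noteq> 0}) \<and> closure {z. a z \<noteq> 0} \<subseteq> U}"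

lemma test_on_mult:
  assumes "a \<in> test_on U" "\<And>k. Ck k b"
  shows "(\<lambda>z. a z * b z) \<in> test_on U"
proof -
  have "closure {z. a z * b z \<noteq> 0} \<subseteq> closure {z. a z \<noteq> 0}"
    by (rule closure_mono) auto
  moreover from this have "compact (closure {z. a z * b z \<noteq> 0})"
    using assms(1) by (metis (mono_tags, lifting) closed_Int_compact closed_closure inf.orderE mem_Collect_eq test_on_def)
  ultimately show ?thesis
    using assms by (auto simp: test_on_def intro: Ck_mult)
qed

text \<open>These products are the only test functions to which the weak equations for the
  coefficients get applied.\<close>

lemma test_on_tensor:
  assumes a: "a \<in> test_on unit_disc" and b: "b \<in> test_on punctured_disc"
  shows "(\<lambda>(x, y). a x * b y) \<in> test_functions"
proof -
  let ?f = "\<lambda>(x, y). a x * b y"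
  let ?A = "closure {z. a z \<noteq> 0}" and ?B = "closure {z. b z \<noteq> 0}"
  have "Ck k ?f" for k
  proof -
    have "Ck k (\<lambda>z. a (0 + fst z) * b (0 + snd z))"
      using a b by (intro Ck_mult Ck_affine_comp bounded_linear_fst bounded_linear_snd) (auto simp: test_on_def)
    then show ?thesis by (simp add: case_prod_beta')
  qed
  moreover have sub: "closure {z. ?f z \<noteq> 0} \<subseteq> ?A \<times> ?B"
  proof (rule closure_minimal)
    show "{z. ?f z \<noteq> 0} \<subseteq> ?A \<times> ?B"
      using closure_subset[of "{z. a z \<noteq> 0}"] closure_subset[of "{z. b z \<noteq> 0}"] by auto
  qed (simp add: closed_Times)
  moreover have "compact (closure {z. ?f z \<noteq> 0})"
  proof -
    have "compact (?A \<times> ?B)" using a b by (auto simp: test_on_def compact_Times)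
    from closed_Int_compact[OF closed_closure this, of "{z. ?f z \<noteq> 0}"] sub
    show ?thesis by (simp add: inf_absorb1)
  qed
  moreover have "?A \<times> ?B \<subseteq> Omega"
    using a b by (auto simp: test_on_def Omega_def)
  ultimately show ?thesis by (auto simp: test_functions_def)
qed

text \<open>The support of a slice lies in the projection of the support of \<phi>, which is compact
  and contained in the corresponding factor of \<open>Omega\<close>.\<close>

lemma test_functions_slice1:
  assumes "\<phi> \<in> test_functions"
  shows "(\<lambda>x. \<phi> (x, y)) \<in> test_on unit_disc"
proof -
  let ?K = "closure {z. \<phi> z \<noteq> 0}"
  have K: "compact ?K" "?K \<subseteq> Omega" and s: "\<And>k. Ck k \<phi>"
    using assms by (auto simp: test_functions_def)
  have "Ck k (\<lambda>x. \<phi> ((0, y) + (x, 0)))" for k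
    by (rule Ck_affine_comp[OF _ s]) (intro bounded_linear_Pair bounded_linear_ident bounded_linear_zero)
  moreover have sub: "closure {x. \<phi> (x, y) \<noteq> 0} \<subseteq> fst ` ?K"
  proof (rule closure_minimal)
    show "{x. \<phi> (x, y) \<noteq> 0} \<subseteq> fst ` ?K"
      using closure_subset[of "{z. \<phi> z \<noteq> 0}"] by force
    show "closed (fst ` ?K)"
      by (intro compact_imp_closed compact_continuous_image K continuous_intros)
  qed
  moreover have "compact (closure {x. \<phi> (x, y) \<noteq> 0})"
  proof -
    have "compact (fst ` ?K)" by (intro compact_continuous_image K continuous_intros)
    from closed_Int_compact[OF closed_closure this, of "{x. \<phi> (x, y) \<noteq> 0}"] sub
    show ?thesis by (simp add: inf_absorb1)
  qed
  moreover have "fst ` ?K \<subseteq> unit_disc"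
    using K by (force simp: Omega_def)
  ultimately show ?thesis by (auto simp: test_on_def)
qed

lemma test_functions_slice2:
  assumes "\<phi> \<in> test_functions"
  shows "(\<lambda>y. \<phi> (x, y)) \<in> test_on punctured_disc"
proof -
  let ?K = "closure {z. \<phi> z \<noteq> 0}"
  have K: "compact ?K" "?K \<subseteq> Omega" and s: "\<And>k. Ck k \<phi>"
    using assms by (auto simp: test_functions_def)
  have "Ck k (\<lambda>y. \<phi> ((x, 0) + (0, y)))" for k
    by (rule Ck_affine_comp[OF _ s]) (intro bounded_linear_Pair bounded_linear_ident bounded_linear_zero)
  moreover have sub: "closure {y. \<phi> (x, y) \<noteq> 0} \<subseteq> snd ` ?K"
  proof (rule closure_minimal)
    show "{y. \<phi> (x, y) \<noteq> 0} \<subseteq> snd ` ?K"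
      using closure_subset[of "{z. \<phi> z \<noteq> 0}"] by force
    show "closed (snd ` ?K)"
      by (intro compact_imp_closed compact_continuous_image K continuous_intros)
  qed
  moreover have "compact (closure {y. \<phi> (x, y) \<noteq> 0})"
  proof -
    have "compact (snd ` ?K)" by (intro compact_continuous_image K continuous_intros)
    from closed_Int_compact[OF closed_closure this, of "{y. \<phi> (x, y) \<noteq> 0}"] sub
    show ?thesis by (simp add: inf_absorb1)
  qed
  moreover have "snd ` ?K \<subseteq> punctured_disc"
    using K by (force simp: Omega_def)
  ultimately show ?thesis by (auto simp: test_on_def)
qed

section \<open>Cutoffs exhausting a planar domain\<close>

lemma Ck_cmod_square: "Ck k (\<lambda>z::complex. (cmod z)\<^sup>2)"
proof -
  have "Ck k (\<lambda>z. Re (z * cnj z))"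
    by (intro Ck_linear_comp[OF bounded_linear_Re] Ck_mult Ck_bounded_linear bounded_linear_cnj bounded_linear_ident)
  moreover have "(\<lambda>z. Re (z * cnj z)) = (\<lambda>z::complex. (cmod z)\<^sup>2)"
    by (auto simp: cmod_def power2_eq_square)
  ultimately show ?thesis by simp
qed

text \<open>A bound and pointwise convergence are what dominated convergence asks of factors that
  are never differentiated.\<close>

definition has_cutoffs :: "complex set \<Rightarrow> bool" where
  "has_cutoffs U \<longleftrightarrow> (\<exists>c. \<forall>n. c n \<in> test_on U \<and> (\<forall>z. cmod (c n z) \<le> 1) \<and>
     (\<forall>z\<in>U. (\<lambda>n. c n z) \<longlonglongrightarrow> 1))"

text \<open>Here \<rho> is a smooth defining function of \<open>U\<close>. The cutoff exp(-1/(n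
  \<rho> - 1)) lives where n \<rho> > 1, so its support stays away from the boundary; at each point
  of \<open>U\<close> the exponent tends to 0.\<close>

lemma has_cutoffs_sublevel:
  fixes \<rho> :: "complex \<Rightarrow> real"
  assumes \<rho>: "\<And>k. Ck k \<rho>" and U: "U = {z. \<rho> z > 0}" "bounded U"
  shows "has_cutoffs U"
proof -
  define c where "c n z = complex_of_real (flat_exp 0 (real n * \<rho> z - 1))" for n z
  have "c n \<in> test_on U" for n
  proof -
    have "Ck k (\<lambda>z. real n * \<rho> z + (-1))" for k
      by (intro Ck_add Ck_mult Ck_const \<rho>)
    then have "Ck k (c n)" for k
      unfolding c_def by (intro Ck_linear_comp[OF bounded_linear_of_real] Ck_flat_exp_comp) simp
    moreover have sub: "closure {z. c n z \<noteq> 0} \<subseteq> {z. real n * \<rho> z \<ge> 1}"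
    proof (rule closure_minimal)
      show "closed {z. real n * \<rho> z \<ge> 1}"
        using \<rho>[of 0] by (intro closed_Collect_le continuous_intros) auto
    qed (auto simp: c_def flat_exp_def split: if_splits)
    \<comment> \<open>For n = 0 the set is empty, in keeping with \<open>c 0\<close> being
      identically 0.\<close>
    moreover have "{z. real n * \<rho> z \<ge> 1} \<subseteq> U"
      unfolding U by (smt (verit) Collect_mono mult_nonneg_nonpos of_nat_0_le_iff)
    moreover have "compact (closure {z. c n z \<noteq> 0})"
      using calculation(2,3) U(2) by (metis bounded_subset closed_closure compact_eq_bounded_closed)
    ultimately show ?thesis by (auto simp: test_on_def)
  qed
  moreover have "cmod (c n z) \<le> 1" for n z
    using flat_exp_nonneg flat_exp_le_1 by (simp add: c_def)
  moreover have "(\<lambda>n. c n z) \<longlonglongrightarrow> 1" if "z \<in> U" for z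
  proof -
    have pos: "\<rho> z > 0" using that U by simp
    have 1: "filterlim (\<lambda>n. real n * \<rho> z - 1) at_top sequentially"
      using filterlim_at_top_mult_tendsto_pos[OF tendsto_const pos filterlim_real_sequentially]
        filterlim_tendsto_add_at_top[OF tendsto_const, of _ _ "-1"] by fastforce
    have "((\<lambda>y::real. exp (- inverse y)) \<longlongrightarrow> exp (- 0)) at_top"
      by (intro tendsto_intros tendsto_inverse_0_at_top filterlim_ident)
    moreover have "\<forall>\<^sub>F y in at_top. exp (- inverse y) = flat_exp 0 y"
      using eventually_gt_at_top[of 0] by eventually_elim (simp add: flat_exp_def divide_inverse)
    ultimately have "(flat_exp 0 \<longlongrightarrow> 1) at_top"
      by (auto dest: Lim_transform_eventually)
    from tendsto_of_real[OF filterlim_compose[OF this 1]]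
    show ?thesis unfolding c_def by fastforce
  qed
  ultimately show ?thesis unfolding has_cutoffs_def by blast
qed

lemma has_cutoffs_unit_disc: "has_cutoffs unit_disc"
proof (rule has_cutoffs_sublevel)
  show "Ck k (\<lambda>z::complex. 1 + (-1) * (cmod z)\<^sup>2)" for k
    by (intro Ck_add Ck_mult Ck_const Ck_cmod_square)
  show "unit_disc = {z. 1 + (-1) * (cmod z)\<^sup>2 > 0}"
    by (auto simp: unit_disc_def abs_square_less_1)
  show "bounded unit_disc"
    unfolding unit_disc_def by (rule boundedI[where B=1]) auto
qed

text \<open>The factor |z|^2 makes the defining function vanish at the puncture just as it does on
  the circle.\<close>

lemma has_cutoffs_punctured_disc: "has_cutoffs punctured_disc"
proof (rule has_cutoffs_sublevel)
  show "Ck k (\<lambda>z::complex. (cmod z)\<^sup>2 * (1 + (-1) * (cmod z)\<^sup>2))" for k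
    by (intro Ck_add Ck_mult Ck_const Ck_cmod_square)
  show "punctured_disc = {z. (cmod z)\<^sup>2 * (1 + (-1) * (cmod z)\<^sup>2) > 0}"
    by (auto simp: punctured_disc_def abs_square_less_1 zero_less_mult_iff)
  show "bounded punctured_disc"
    unfolding punctured_disc_def by (rule boundedI[where B=1]) auto
qed

section \<open>Integrals over the complex plane\<close>

text \<open>Both measures give a box the product of its side lengths, which characterises Lebesgue
  measure. Integrals over the plane thereby become iterated real integrals.\<close>

lemma lborel_complex_eq_distr: "lborel = distr (lborel :: (real \<times> real) measure) borel (\<lambda>(x, y). Complex x y)"
proof (rule lborel_eqI)
  have m[measurable]: "(\<lambda>(x, y). Complex x y) \<in> borel_measurable (lborel :: (real \<times> real) measure)"
    by (simp add: case_prod_beta') (intro borel_measurable_continuous_onI continuous_intros)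
  fix l u :: complex
  assume le: "\<And>b. b \<in> Basis \<Longrightarrow> l \<bullet> b \<le> u \<bullet> b"
  have le': "Re l \<le> Re u" "Im l \<le> Im u" using le[of 1] le[of \<i>] by (auto simp: Basis_complex_def)
  have "(\<lambda>(x, y). Complex x y) -` box l u = box (Re l, Im l) (Re u, Im u)"
    by (auto simp: box_def Basis_complex_def Basis_prod_def)
  then show "emeasure (distr (lborel :: (real \<times> real) measure) borel (\<lambda>(x, y). Complex x y)) (box l u)
      = (\<Prod>b\<in>Basis. (u - l) \<bullet> b)"
    using le'
    by (simp add: emeasure_distr emeasure_lborel_box_eq Basis_complex_def Basis_prod_def)
qed simp

lemma nn_integral_lborel_complex:
  assumes f[measurable]: "f \<in> borel_measurable borel"
  shows "(\<integral>\<^sup>+ z. f z \<partial>lborel) = (\<integral>\<^sup>+ x. \<integral>\<^sup>+ y. f (Complex x y) \<partial>lborel \<partial>lborel)"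
proof -
  have m[measurable]: "(\<lambda>z. Complex (fst z) (snd z)) \<in> borel_measurable (lborel :: (real \<times> real) measure)"
    by simp (intro borel_measurable_continuous_onI continuous_intros)
  have "(\<integral>\<^sup>+ z. f z \<partial>lborel) = (\<integral>\<^sup>+ z. f (Complex (fst z) (snd z)) \<partial>lborel)"
    by (subst lborel_complex_eq_distr) (simp add: nn_integral_distr case_prod_beta')
  also have "\<dots> = (\<integral>\<^sup>+ x. \<integral>\<^sup>+ y. f (Complex x y) \<partial>lborel \<partial>lborel)"
    by (subst lborel_prod[symmetric], subst lborel.nn_integral_fst[symmetric])
      (simp_all add: lborel_prod)
  finally show ?thesis .
qed

text \<open>For a nonnegative integrand, finite limits of the antiderivative already force
  integrability.\<close>

lemma nn_integral_FTC_real_line: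
  fixes f F :: "real \<Rightarrow> real"
  assumes F: "\<And>x. (F has_real_derivative f x) (at x)" and f: "continuous_on UNIV f" "\<And>x. 0 \<le> f x"
    and lim: "(F \<longlongrightarrow> a) at_bot" "(F \<longlongrightarrow> b) at_top"
  shows "(\<integral>\<^sup>+ x. ennreal (f x) \<partial>lborel) = ennreal (b - a)"
proof -
  have "set_integrable lborel (einterval (-\<infinity>) \<infinity>) f" "(LBINT x=-\<infinity>..\<infinity>. f x) = b - a"
    using assms
    by (intro interval_integral_FTC_nonneg[where F=F];
        auto simp: ereal_tendsto_simps continuous_on_eq_continuous_at)+
  then have "integrable lborel f" "(LINT x|lborel. f x) = b - a"
    by (auto simp: set_integrable_def interval_lebesgue_integral_def set_lebesgue_integral_def)
  then show ?thesis
    using f by (simp add: nn_integral_eq_integral)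
qed

text \<open>The integrand is the \<open>dbar\<close> of the regularised Cauchy kernel with pole 0
  and parameter 1; its mass is the constant of the Cauchy-Pompeiu formula. In Cartesian coordinates
  both iterated integrals have elementary antiderivatives.\<close>

lemma nn_integral_inverse_square:
  "(\<integral>\<^sup>+ z. ennreal (1 / (1 + (cmod z)\<^sup>2)\<^sup>2) \<partial>lborel) = ennreal pi"
proof -
  have inner: "(\<integral>\<^sup>+ y. ennreal (1 / (1 + x\<^sup>2 + y\<^sup>2)\<^sup>2) \<partial>lborel) = ennreal (pi / 2 * (1 / sqrt (1 + x\<^sup>2) ^ 3))" for x :: real
  proof -
    define s where "s = sqrt (1 + x\<^sup>2)"
    have s: "s > 0" "1 + x\<^sup>2 = s\<^sup>2" by (auto simp: s_def add_pos_nonneg)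
    have nz: "s\<^sup>2 + y\<^sup>2 \<noteq> 0" for y using s(1) by (metis power2_eq_square sum_squares_eq_zero_iff less_irrefl)
    \<comment> \<open>The standard antiderivative of 1 / (s^2 + y^2)^2; at infinity only the
      arctangent term survives.\<close>
    let ?F = "\<lambda>y. 1 / (2 * s\<^sup>2) * (y / (s\<^sup>2 + y\<^sup>2)) + 1 / (2 * s ^ 3) * arctan (y / s)"
    have "(\<integral>\<^sup>+ y. ennreal (1 / (s\<^sup>2 + y\<^sup>2)\<^sup>2) \<partial>lborel) = ennreal (1 / (2 * s ^ 3) * (pi / 2) - 1 / (2 * s ^ 3) * - (pi / 2))"
    proof (rule nn_integral_FTC_real_line[where F="?F"])
      fix y
      define d where "d = s\<^sup>2 + y\<^sup>2"
      have d: "d \<noteq> 0" "d - y * (2 * y) + d = 2 * s\<^sup>2"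
        using nz by (simp_all add: d_def power2_eq_square)
      have 1: "((\<lambda>y. y / (s\<^sup>2 + y\<^sup>2)) has_real_derivative (1 * d - y * (2 * y)) / (d * d)) (at y)"
        using d(1) unfolding d_def by (intro DERIV_divide) (auto intro!: derivative_eq_intros)
      have "((\<lambda>y. arctan (y / s)) has_real_derivative inverse (1 + (y / s)\<^sup>2) * (1 / s)) (at y)"
        using s(1) by (auto intro!: derivative_eq_intros)
      also have "1 + (y / s)\<^sup>2 = d / s\<^sup>2"
        using s(1) by (simp add: d_def add_divide_distrib power_divide)
      finally have 2: "((\<lambda>y. arctan (y / s)) has_real_derivative s / d) (at y)"
        using s(1) by (simp add: power2_eq_square)
      have "(?F has_real_derivative
         1 / (2 * s\<^sup>2) * ((1 * d - y * (2 * y)) / (d * d)) + 1 / (2 * s ^ 3) * (s / d)) (at y)"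
        by (intro DERIV_add DERIV_cmult 1 2)
      also have "1 / (2 * s ^ 3) * (s / d) = 1 / (2 * s\<^sup>2) * (d / (d * d))"
        using s(1) d(1) by (simp add: power2_eq_square power3_eq_cube)
      also have "1 / (2 * s\<^sup>2) * ((1 * d - y * (2 * y)) / (d * d)) + \<dots>
          = 1 / (2 * s\<^sup>2) * ((d - y * (2 * y) + d) / (d * d))"
        by (simp only: distrib_left[symmetric] add_divide_distrib[symmetric] mult_1)
      also have "\<dots> = 1 / (s\<^sup>2 + y\<^sup>2)\<^sup>2"
        unfolding d(2) using s(1) by (simp add: d_def power2_eq_square)
      finally show "(?F has_real_derivative 1 / (s\<^sup>2 + y\<^sup>2)\<^sup>2) (at y)" .
    next
      show "continuous_on UNIV (\<lambda>y. 1 / (s\<^sup>2 + y\<^sup>2)\<^sup>2)"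
        using nz by (intro continuous_intros) auto
      have 1: "((\<lambda>y. y / (s\<^sup>2 + y\<^sup>2)) \<longlongrightarrow> 0) at_top" "((\<lambda>y. y / (s\<^sup>2 + y\<^sup>2)) \<longlongrightarrow> 0) at_bot"
        using s(1) by real_asymp+
      have 2: "((\<lambda>y. arctan (y / s)) \<longlongrightarrow> pi / 2) at_top" "((\<lambda>y. arctan (y / s)) \<longlongrightarrow> - (pi / 2)) at_bot"
        using s(1) by real_asymp+
      have "(?F \<longlongrightarrow> 1 / (2 * s\<^sup>2) * 0 + 1 / (2 * s ^ 3) * - (pi / 2)) at_bot"
        by (rule tendsto_add[OF tendsto_mult_left[OF 1(2)] tendsto_mult_left[OF 2(2)]])
      then show "(?F \<longlongrightarrow> 1 / (2 * s ^ 3) * - (pi / 2)) at_bot"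
        unfolding mult_zero_right add_0 .
      have "(?F \<longlongrightarrow> 1 / (2 * s\<^sup>2) * 0 + 1 / (2 * s ^ 3) * (pi / 2)) at_top"
        by (rule tendsto_add[OF tendsto_mult_left[OF 1(1)] tendsto_mult_left[OF 2(1)]])
      then show "(?F \<longlongrightarrow> 1 / (2 * s ^ 3) * (pi / 2)) at_top"
        unfolding mult_zero_right add_0 .
    qed auto
    also have "1 / (2 * s ^ 3) * (pi / 2) - 1 / (2 * s ^ 3) * - (pi / 2) = pi / 2 * (1 / s ^ 3)"
      by simp
    finally show ?thesis unfolding s(2)[symmetric] unfolding s_def .
  qed
  have "(\<integral>\<^sup>+ z. ennreal (1 / (1 + (cmod z)\<^sup>2)\<^sup>2) \<partial>lborel)
    = (\<integral>\<^sup>+ x. \<integral>\<^sup>+ y. ennreal (1 / (1 + x\<^sup>2 + y\<^sup>2)\<^sup>2) \<partial>lborel \<partial>lborel)"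
    by (subst nn_integral_lborel_complex) (auto simp: cmod_def add.assoc)
  also have "\<dots> = (\<integral>\<^sup>+ x. ennreal (pi / 2 * (1 / sqrt (1 + x\<^sup>2) ^ 3)) \<partial>lborel)"
    by (simp add: inner)
  also have "\<dots> = ennreal (pi / 2 - - (pi / 2))"
  proof (rule nn_integral_FTC_real_line[where F="\<lambda>x. pi / 2 * (x / sqrt (1 + x\<^sup>2))"])
    fix x :: real
    have nz: "1 + x\<^sup>2 > 0" by (simp add: add_pos_nonneg)
    define d where "d = sqrt (1 + x\<^sup>2)"
    have d: "d > 0" "d * d = 1 + x * x" using nz by (simp_all add: d_def power2_eq_square)
    have "((\<lambda>x. sqrt (1 + x\<^sup>2)) has_real_derivative x / d) (at x)"
      using nz by (auto intro!: derivative_eq_intros simp: d_def field_simps)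
    then have "((\<lambda>x. pi / 2 * (x / sqrt (1 + x\<^sup>2))) has_real_derivative
       pi / 2 * ((1 * d - x * (x / d)) / (d * d))) (at x)"
      using d unfolding d_def by (intro DERIV_cmult DERIV_divide DERIV_ident) auto
    also have "1 * d - x * (x / d) = 1 / d"
      using d by (simp add: field_simps)
    also have "1 / d / (d * d) = 1 / sqrt (1 + x\<^sup>2) ^ 3"
      by (simp add: d_def power3_eq_cube)
    finally show "((\<lambda>x. pi / 2 * (x / sqrt (1 + x\<^sup>2))) has_real_derivative
       pi / 2 * (1 / sqrt (1 + x\<^sup>2) ^ 3)) (at x)" .
  next
    have nz: "sqrt (1 + x\<^sup>2) \<noteq> 0" for x :: real by (simp add: add_pos_nonneg less_imp_neq[symmetric])
    then show "continuous_on UNIV (\<lambda>x::real. pi / 2 * (1 / sqrt (1 + x\<^sup>2) ^ 3))"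
      by (intro continuous_intros) auto
    show "((\<lambda>x. pi / 2 * (x / sqrt (1 + x\<^sup>2))) \<longlongrightarrow> - (pi / 2)) at_bot"
      by real_asymp
    show "((\<lambda>x. pi / 2 * (x / sqrt (1 + x\<^sup>2))) \<longlongrightarrow> pi / 2) at_top"
      by real_asymp
  qed auto
  finally show ?thesis by simp
qed

text \<open>The antiderivative is 2 sqrt x on either side of 0. The interval is (-2, 2) because real
  and imaginary parts of a difference of two points of the unit disc lie there.\<close>

lemma nn_integral_inverse_sqrt_finite:
  "(\<integral>\<^sup>+ x. ennreal (1 / sqrt \<bar>x\<bar>) * indicator {-2<..<2} x \<partial>lborel) < \<infinity>"
proof -
  let ?I = "\<integral>\<^sup>+ x. ennreal (1 / sqrt x) * indicator {0<..<2} x \<partial>lborel"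
  have "set_integrable lborel (einterval 0 2) (\<lambda>x. 1 / sqrt x)"
  proof (rule interval_integral_FTC_nonneg[where F="\<lambda>x. 2 * sqrt x" and A=0 and B="2 * sqrt 2"])
    show "DERIV (\<lambda>x. 2 * sqrt x) x :> 1 / sqrt x" if "0 < ereal x" "ereal x < 2" for x
      using that by (auto intro!: derivative_eq_intros simp: field_simps)
    show "(((\<lambda>x. 2 * sqrt x) \<circ> real_of_ereal) \<longlongrightarrow> 0) (at_right 0)"
      unfolding zero_ereal_def ereal_tendsto_simps by (auto intro!: tendsto_eq_intros)
    show "(((\<lambda>x. 2 * sqrt x) \<circ> real_of_ereal) \<longlongrightarrow> 2 * sqrt 2) (at_left 2)"
      unfolding numeral_eq_ereal ereal_tendsto_simps by (auto intro!: tendsto_eq_intros)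
  qed (auto intro!: continuous_intros)
  moreover have "einterval 0 2 = {0<..<2::real}"
    by (auto simp: einterval_def)
  ultimately have *: "integrable lborel (\<lambda>x. indicator {0<..<2} x * (1 / sqrt x))"
    by (simp add: set_integrable_def)
  have I: "?I < \<infinity>"
  proof -
    have "?I = (\<integral>\<^sup>+ x. ennreal (norm (indicator {0<..<2} x * (1 / sqrt x))) \<partial>lborel)"
      by (intro nn_integral_cong) (auto simp: indicator_def)
    with * show ?thesis by (simp add: integrable_iff_bounded)
  qed
  have "(\<integral>\<^sup>+ x. ennreal (1 / sqrt \<bar>x\<bar>) * indicator {-2<..<2} x \<partial>lborel)
    \<le> (\<integral>\<^sup>+ x. ennreal (1 / sqrt x) * indicator {0<..<2} x + ennreal (1 / sqrt (- x)) * indicator {0<..<2} (- x) \<partial>lborel)"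
    by (rule nn_integral_mono) (auto simp: indicator_def)
  also have "\<dots> = ?I + (\<integral>\<^sup>+ x. ennreal (1 / sqrt (- x)) * indicator {0<..<2} (- x) \<partial>lborel)"
    by (rule nn_integral_add) auto
  also have "(\<integral>\<^sup>+ x. ennreal (1 / sqrt (- x)) * indicator {0<..<2} (- x) \<partial>lborel) = ?I"
    using nn_integral_real_affine[of "\<lambda>x. ennreal (1 / sqrt x) * indicator {0<..<2} x" "-1" 0] by simp
  also have "?I + ?I < \<infinity>" using I by simp
  finally show ?thesis .
qed

text \<open>Since |Re v| |Im v| \<le> |v|^2, the kernel 1/|v| is at most 1 / (sqrt |Re v| sqrt |Im
  v|). This majorant separates the coordinates, so the bound is the square of a one-dimensional
  integral and does not depend on z.\<close>

lemma Cauchy_kernel_bound: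
  "\<exists>A>0. \<forall>z\<in>unit_disc. (\<integral>\<^sup>+ w. ennreal (1 / cmod (w - z)) * indicator unit_disc w \<partial>lborel) \<le> ennreal A"
proof -
  \<comment> \<open>The value at \<open>0\<close> keeps the product estimate below valid on the coordinate axes.\<close>
  define g where "g x = (if x = 0 then \<infinity> else ennreal (1 / sqrt \<bar>x\<bar>)) * indicator {-2<..<2::real} x" for x
  have [measurable]: "g \<in> borel_measurable borel" unfolding g_def by measurable
  let ?I = "\<integral>\<^sup>+ x. g x \<partial>lborel"
  have fin: "?I < \<infinity>"
  proof -
    have "?I = (\<integral>\<^sup>+ x. ennreal (1 / sqrt \<bar>x\<bar>) * indicator {-2<..<2} x \<partial>lborel)"
      unfolding g_def by (intro nn_integral_cong_AE eventually_mono[OF AE_lborel_singleton[of 0]]) auto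
    then show ?thesis using nn_integral_inverse_sqrt_finite by simp
  qed
  have D[measurable]: "unit_disc \<in> sets borel" 
    unfolding unit_disc_def by (auto intro!: borel_open open_Collect_less continuous_intros)
  have "(\<integral>\<^sup>+ w. ennreal (1 / cmod (w - z)) * indicator unit_disc w \<partial>lborel) \<le> ?I * ?I" if z: "z \<in> unit_disc" for z
  proof -
    have le: "ennreal (1 / cmod v) * indicator unit_disc (z + v) \<le> g (Re v) * g (Im v)" for v
    proof (cases "z + v \<in> unit_disc")
      case True
      then have "cmod v < 2"
        using z norm_triangle_ineq4[of "z + v" z] by (simp add: unit_disc_def)
      then have bd: "\<bar>Re v\<bar> < 2" "\<bar>Im v\<bar> < 2"
        using abs_Re_le_cmod[of v] abs_Im_le_cmod[of v] by linarith+
      show ?thesis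
      proof (cases "Re v = 0 \<or> Im v = 0")
        case True
        then have "g (Re v) * g (Im v) = \<infinity>"
          using bd by (auto simp: g_def ennreal_mult_top ennreal_top_mult abs_less_iff)
        then show ?thesis by simp
      next
        case False
        then have ind: "g (Re v) * g (Im v) = ennreal (1 / (sqrt \<bar>Re v\<bar> * sqrt \<bar>Im v\<bar>))"
          using bd by (auto simp: g_def indicator_def ennreal_mult'[symmetric] abs_less_iff)
        have "sqrt \<bar>Re v\<bar> * sqrt \<bar>Im v\<bar> \<le> sqrt ((cmod v)\<^sup>2)"
        proof -
          have "\<bar>Re v\<bar> * \<bar>Im v\<bar> \<le> (cmod v)\<^sup>2"
            using mult_mono[OF abs_Re_le_cmod[of v] abs_Im_le_cmod[of v]] by (simp add: power2_eq_square)
          then show ?thesis unfolding real_sqrt_mult[symmetric] by (rule real_sqrt_le_mono)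
        qed
        then have "1 / cmod v \<le> 1 / (sqrt \<bar>Re v\<bar> * sqrt \<bar>Im v\<bar>)"
          using False by (intro divide_left_mono mult_pos_pos) auto
        then show ?thesis unfolding ind by (auto simp: indicator_def ennreal_leI)
      qed
    qed simp
    have "(\<integral>\<^sup>+ w. ennreal (1 / cmod (w - z)) * indicator unit_disc w \<partial>lborel)
        = (\<integral>\<^sup>+ v. ennreal (1 / cmod v) * indicator unit_disc (z + v) \<partial>lborel)"
      by (subst lborel_distr_plus[of z, symmetric], subst nn_integral_distr) auto
    also have "\<dots> \<le> (\<integral>\<^sup>+ v. g (Re v) * g (Im v) \<partial>lborel)"
      by (intro nn_integral_mono le)
    also have "\<dots> = (\<integral>\<^sup>+ x. \<integral>\<^sup>+ y. g x * g y \<partial>lborel \<partial>lborel)"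
      by (subst nn_integral_lborel_complex) auto
    also have "\<dots> = ?I * ?I"
      by (simp add: nn_integral_cmult nn_integral_multc)
    finally show ?thesis .
  qed
  \<comment> \<open>Adding 1 makes the bound strictly positive.\<close>
  moreover have "?I * ?I \<le> ennreal (enn2real (?I * ?I) + 1)"
    using fin by (auto simp: ennreal_plus ennreal_mult_less_top)
  ultimately show ?thesis
    by (intro exI[of _ "enn2real (?I * ?I) + 1"]) (auto intro: order.trans add_nonneg_pos)
qed

section \<open>The Cauchy-Pompeiu formula\<close>

definition dbar :: "(complex \<Rightarrow> complex) \<Rightarrow> complex \<Rightarrow> complex" where
  "dbar a z = (frechet_derivative a (at z) 1 + \<i> * frechet_derivative a (at z) \<i>) / 2"

lemma integrable_continuous_support:
  fixes g :: "'a::euclidean_space \<Rightarrow> 'b::{banach, second_countable_topology}"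
  assumes "continuous_on UNIV g" "compact K" "\<And>x. x \<notin> K \<Longrightarrow> g x = 0"
  shows "integrable lborel g"
proof -
  have "integrable lborel (\<lambda>x. indicator K x *\<^sub>R g x)"
    using assms by (intro borel_integrable_compact continuous_on_subset[OF assms(1)]) auto
  moreover have "(\<lambda>x. indicator K x *\<^sub>R g x) = g"
    using assms(3) by (auto simp: indicator_def)
  ultimately show ?thesis by simp
qed

lemma continuous_support_bounded:
  fixes g :: "'a::metric_space \<Rightarrow> 'b::real_normed_vector"
  assumes "continuous_on UNIV g" "compact K" "\<And>x. x \<notin> K \<Longrightarrow> g x = 0"
  shows "\<exists>B\<ge>0. \<forall>x. norm (g x) \<le> B"
proof -
  have "bounded (g ` K)"
    using assms by (intro compact_imp_bounded compact_continuous_image continuous_on_subset[OF assms(1)]) auto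
  then obtain B where "B > 0" "\<And>x. x \<in> K \<Longrightarrow> norm (g x) \<le> B"
    by (auto simp: bounded_pos)
  then show ?thesis using assms(3) by (intro exI[of _ B]) (metis less_imp_le norm_zero)
qed

lemma frechet_derivative_support:
  assumes "\<And>x. x \<notin> K \<Longrightarrow> g x = 0" "closed K" "x \<notin> K"
  shows "frechet_derivative g (at x) v = 0"
proof -
  have "((\<lambda>x. 0) has_derivative (\<lambda>v. 0)) (at x)" by simp
  then have "(g has_derivative (\<lambda>v. 0)) (at x)"
    by (rule has_derivative_transform_within_open[where s="- K"]) (use assms in auto)
  from frechet_derivative_at[OF this] show ?thesis by metis
qed

text \<open>Differentiate the translation invariant integral \<open>\<integral>g(x + t v) dx\<close> at \<open>t = 0\<close>.\<close>

lemma integral_directional_derivative_eq_0: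
  fixes g :: "'a::euclidean_space \<Rightarrow> complex"
  assumes g: "Ck 1 g" and K: "compact K" "\<And>x. x \<notin> K \<Longrightarrow> g x = 0"
  shows "(LINT x|lborel. frechet_derivative g (at x) v) = 0"
proof -
  let ?D = "\<lambda>x. frechet_derivative g (at x) v"
  have cont: "continuous_on UNIV g" using Ck_Suc_imp_Ck[of 0 g] g by simp
  have contD: "continuous_on UNIV ?D" using g by simp
  have D: "(g has_derivative frechet_derivative g (at x)) (at x)" for x
    using g by (simp add: frechet_derivative_works)
  have "\<exists>B\<ge>0. \<forall>x. cmod (?D x) \<le> B"
    by (rule continuous_support_bounded[OF contD K(1)])
      (rule frechet_derivative_support[OF K(2) compact_imp_closed[OF K(1)]])
  then obtain B where B: "B \<ge> 0" "\<And>x. cmod (?D x) \<le> B"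
    by auto
  define t where "t n = 1 / real (Suc n)" for n
  have t: "t n > 0" "t n \<le> 1" for n by (auto simp: t_def)
  have t0: "t \<longlonglongrightarrow> 0" unfolding t_def by real_asymp
  define q where "q n x = (g (t n *\<^sub>R v + x) - g x) /\<^sub>R t n" for n x
  \<comment> \<open>\<open>K'\<close> collects the points x for which the segment from x to x + v
    meets \<open>K\<close>. As \<open>t n\<close> is at most 1, every quotient \<open>q n\<close>
    vanishes outside it.\<close>
  define K' where "K' = (\<lambda>(s, x). x - s *\<^sub>R v) ` ({0..1} \<times> K)"
  have K': "compact K'"
    unfolding K'_def case_prod_beta'
    by (intro compact_continuous_image compact_Times K compact_Icc continuous_intros)
  have line: "((\<lambda>s. g (s *\<^sub>R v + x)) has_vector_derivative ?D (s *\<^sub>R v + x)) (at s)" for s x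
  proof -
    have "((\<lambda>s. s *\<^sub>R v + x) has_derivative (\<lambda>h. h *\<^sub>R v)) (at s)"
      by (auto intro!: derivative_eq_intros)
    from diff_chain_at[OF this D] show ?thesis
      using linear_frechet_derivative[of g "at (s *\<^sub>R v + x)"] g
      by (simp add: has_vector_derivative_def o_def linear_scale)
  qed
  \<comment> \<open>On \<open>K'\<close> the mean value inequality along the line through x in
    direction v gives \<open>B\<close>; outside, both values of \<open>g\<close> are 0.\<close>
  have bound: "cmod (q n x) \<le> B * indicator K' x" for n x
  proof (cases "x \<in> K'")
    case True
    have "norm (g (t n *\<^sub>R v + x) - g (0 *\<^sub>R v + x)) \<le> B * norm (t n - 0)"
    proof (rule differentiable_bound[where S="{0..t n}" and f'="\<lambda>s h. h *\<^sub>R ?D (s *\<^sub>R v + x)" and f="\<lambda>s. g (s *\<^sub>R v + x)"])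
      show "onorm (\<lambda>h. h *\<^sub>R ?D (s *\<^sub>R v + x)) \<le> B" for s
        by (rule onorm_bound) (use B in \<open>auto simp: mult.commute[of B] intro!: mult_left_mono\<close>)
    qed (use t[of n] line in \<open>auto simp: has_vector_derivative_def intro: has_derivative_at_withinI\<close>)
    moreover have "norm (q n x) = norm (g (t n *\<^sub>R v + x) - g x) / t n"
      using t[of n] by (simp add: q_def divide_inverse mult.commute)
    ultimately show ?thesis using t[of n] True by (simp add: pos_divide_le_eq)
  next
    case False
    have "x \<notin> K"
    proof
      assume "x \<in> K"
      then have "(\<lambda>(s, x). x - s *\<^sub>R v) (0, x) \<in> K'"
        unfolding K'_def by (intro imageI) auto
      with False show False by simp
    qed
    moreover have "t n *\<^sub>R v + x \<notin> K" 
    proof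
      assume "t n *\<^sub>R v + x \<in> K"
      then have "(\<lambda>(s, x). x - s *\<^sub>R v) (t n, t n *\<^sub>R v + x) \<in> K'"
        unfolding K'_def using t[of n] by (intro imageI) auto
      with False show False by simp
    qed
    ultimately show ?thesis using K(2) False by (simp add: q_def)
  qed
  have gm[measurable]: "g \<in> borel_measurable borel" "?D \<in> borel_measurable borel"
    using cont contD by (auto intro: borel_measurable_continuous_onI)
  have gi: "integrable lborel g" by (rule integrable_continuous_support[OF cont K])
  have gi': "integrable lborel (\<lambda>x. g (c + x))" and ge: "(LINT x|lborel. g (c + x)) = (LINT x|lborel. g x)" for c
  proof -
    show "integrable lborel (\<lambda>x. g (c + x))"
      using gi by (subst (asm) lborel_distr_plus[of c, symmetric]) (simp add: integrable_distr_eq)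
    show "(LINT x|lborel. g (c + x)) = (LINT x|lborel. g x)"
      by (subst (2) lborel_distr_plus[of c, symmetric]) (simp add: integral_distr)
  qed
  have "(\<lambda>n. LINT x|lborel. q n x) \<longlonglongrightarrow> (LINT x|lborel. ?D x)"
  proof (rule integral_dominated_convergence[where w="\<lambda>x. B * indicator K' x"])
    show "integrable lborel (\<lambda>x. B * indicator K' x)"
      using K' emeasure_compact_finite[OF K'] by (intro integrable_mult_right integrable_real_indicator)
        (auto simp: compact_imp_closed borel_closed)
    show "AE x in lborel. (\<lambda>n. q n x) \<longlonglongrightarrow> ?D x"
    proof (rule AE_I2)
      fix x
      have "(\<lambda>s. norm (g (s *\<^sub>R v + x) - g x - s *\<^sub>R ?D x) / norm s) \<midarrow>0\<rightarrow> 0"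
        using line[of x 0] unfolding has_vector_derivative_def has_derivative_at by simp
      moreover have "filterlim t (at 0) sequentially"
        using t0 t(1) by (simp add: filterlim_at less_imp_neq[THEN not_sym])
      ultimately have *: "(\<lambda>n. norm (g (t n *\<^sub>R v + x) - g x - t n *\<^sub>R ?D x) / norm (t n)) \<longlonglongrightarrow> 0"
        by (rule filterlim_compose)
      have "norm (g (t n *\<^sub>R v + x) - g x - t n *\<^sub>R ?D x) / norm (t n) = norm (q n x - ?D x)" for n
      proof -
        have "q n x - ?D x = (g (t n *\<^sub>R v + x) - g x - t n *\<^sub>R ?D x) /\<^sub>R t n"
          using t(1)[of n] by (simp add: q_def scaleR_diff_right)
        then show ?thesis using t(1)[of n] by (simp add: divide_inverse mult.commute)
      qed
      with * show "(\<lambda>n. q n x) \<longlonglongrightarrow> ?D x"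
        by (simp add: tendsto_norm_zero_iff LIM_zero_iff)
    qed
    show "AE x in lborel. cmod (q n x) \<le> B * indicator K' x" for n
      using bound by simp
  qed (auto simp: q_def)
  moreover have "(LINT x|lborel. q n x) = 0" for n
    unfolding q_def using gi gi' ge by simp
  ultimately show ?thesis by (simp add: LIMSEQ_const_iff)
qed

lemma dbar_mult:
  assumes "a differentiable at z" "b differentiable at z"
  shows "dbar (\<lambda>z. a z * b z) z = a z * dbar b z + dbar a z * b z"
proof -
  have "((\<lambda>z. a z * b z) has_derivative
      (\<lambda>v. a z * frechet_derivative b (at z) v + frechet_derivative a (at z) v * b z)) (at z)"
    using assms by (intro has_derivative_mult) (simp_all add: frechet_derivative_works)
  from frechet_derivative_at[OF this, symmetric] show ?thesis
    by (simp add: dbar_def field_simps)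
qed

section \<open>The regularised Cauchy kernel\<close>

definition reg_kernel :: "real \<Rightarrow> complex \<Rightarrow> complex \<Rightarrow> complex" where
  "reg_kernel e w z = cnj (z - w) / of_real ((cmod (z - w))\<^sup>2 + e)"

text \<open>Since 1/(z - w) = cnj (z - w) / |z - w|^2, adding e > 0 to the denominator smooths the
  Cauchy kernel. In this form it is built from bounded linear maps and constants by sums, products
  and an inverse, ready for the rules of smoothness and differentiation.\<close>

lemma reg_kernel_eq: "reg_kernel e w z = cnj (z - w) * inverse ((z - w) * cnj (z - w) + of_real e)"
  by (simp add: reg_kernel_def complex_norm_square divide_inverse del: of_real_power)

lemma reg_kernel_denominator: "e > 0 \<Longrightarrow> (z - w) * cnj (z - w) + of_real e \<noteq> 0"
  by (metis complex_norm_square add_pos_nonneg add.commute less_irrefl of_real_add of_real_eq_0_iff zero_le_power2)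

lemma Ck_reg_kernel:
  assumes "e > 0"
  shows "Ck k (reg_kernel e w)"
proof -
  have [intro]: "Ck k (\<lambda>z. z - w)" using Ck_add[OF Ck_bounded_linear[OF bounded_linear_ident] Ck_const[of _ "- w"], of k] by simp
  then show ?thesis unfolding reg_kernel_eq[abs_def]
    by (intro Ck_mult Ck_inverse Ck_add Ck_const Ck_linear_comp[OF bounded_linear_cnj] reg_kernel_denominator assms)
qed

text \<open>The Cauchy kernel dominates all its regularisations at once. At z = w the claim reads 0
  \<le> 0, division by zero being 0.\<close>

lemma norm_reg_kernel_le:
  assumes "e > 0"
  shows "cmod (reg_kernel e w z) \<le> 1 / cmod (z - w)"
proof (cases "z = w")
  case False
  then have "cmod (z - w) / ((cmod (z - w))\<^sup>2 + e) \<le> cmod (z - w) / (cmod (z - w))\<^sup>2"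
    using assms by (intro divide_left_mono) (auto intro!: mult_pos_pos add_pos_pos)
  moreover have "cmod (reg_kernel e w z) = cmod (z - w) / ((cmod (z - w))\<^sup>2 + e)"
    using assms by (simp add: reg_kernel_def norm_divide del: of_real_add of_real_power complex_cnj_diff)
  ultimately show ?thesis using False by (simp add: power2_eq_square)
qed (simp add: reg_kernel_def)

text \<open>At the pole both sides are 0, so the convergence holds everywhere and not just almost
  everywhere.\<close>

lemma reg_kernel_tendsto:
  assumes "(\<lambda>n. e n) \<longlonglongrightarrow> 0"
  shows "(\<lambda>n. reg_kernel (e n) w z) \<longlonglongrightarrow> 1 / (z - w)"
proof (cases "z = w")
  case False
  then have "(\<lambda>n. reg_kernel (e n) w z) \<longlonglongrightarrow> cnj (z - w) * inverse ((z - w) * cnj (z - w) + of_real 0)"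
    unfolding reg_kernel_eq by (intro tendsto_intros assms) auto
  moreover have "cnj u * inverse (u * cnj u + of_real 0) = 1 / u" if "u \<noteq> 0" for u
    using that by (simp add: divide_inverse)
  ultimately show ?thesis using False by (metis right_minus_eq)
qed (simp add: reg_kernel_def)

text \<open>With u = z - w and d = |u|^2 + e the derivative is 1/d - |u|^2/d^2 = e/d^2: a bump of
  mass pi that concentrates at w as e tends to 0.\<close>

lemma dbar_reg_kernel:
  assumes "e > 0"
  shows "dbar (reg_kernel e w) z = of_real (e / ((cmod (z - w))\<^sup>2 + e)\<^sup>2)"
proof -
  let ?d = "(z - w) * cnj (z - w) + of_real e"
  let ?D = "\<lambda>v. cnj (z - w) * - (inverse ?d * ((z - w) * cnj v + v * cnj (z - w)) * inverse ?d) + cnj v * inverse ?d"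
  have nz: "?d \<noteq> 0" by (rule reg_kernel_denominator[OF assms])
  have "(reg_kernel e w has_derivative ?D) (at z)"
    unfolding reg_kernel_eq[abs_def] using nz
    by (auto intro!: derivative_eq_intros bounded_linear.has_derivative[OF bounded_linear_cnj])
  from frechet_derivative_at[OF this, symmetric]
  have "dbar (reg_kernel e w) z = (?D 1 + \<i> * ?D \<i>) / 2" by (simp add: dbar_def)
  also have "\<dots> = inverse ?d - (z - w) * cnj (z - w) * inverse ?d * inverse ?d"
  proof -
    \<comment> \<open>Combining the directions 1 and \<i> in this way cancels the terms in
      \<open>v\<close> and keeps those in \<open>cnj v\<close>.\<close>
    have "(c * - (j * (u * 1 + 1 * c) * j) + 1 * j + \<i> * (c * - (j * (u * (- \<i>) + \<i> * c) * j) + (- \<i>) * j)) / 2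
      = j - u * c * j * j" for c j u :: complex
      by (simp add: algebra_simps diff_divide_distrib)
    then show ?thesis by (simp only: complex_cnj_one complex_cnj_i)
  qed
  also have "\<dots> = of_real e * inverse ?d * inverse ?d"
  proof -
    have "inverse ?d = ?d * inverse ?d * inverse ?d" using nz by simp
    then show ?thesis by (simp add: algebra_simps)
  qed
  also have "\<dots> = of_real (e / ((cmod (z - w))\<^sup>2 + e)\<^sup>2)"
  proof -
    have "?d = of_real ((cmod (z - w))\<^sup>2 + e)"
      by (simp only: of_real_add complex_norm_square)
    then show ?thesis
      by (simp only: divide_inverse power2_eq_square of_real_mult of_real_inverse inverse_mult_distrib mult.assoc)
  qed
  finally show ?thesis .
qed

text \<open>The integral of \<open>dbar\<close> of a times the smoothed kernel is 0. The product
  rule splits it into the wanted integral with a smoothed kernel and the integral of a against the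
  bump, which tends to pi times \<open>a w\<close>. The assumed integrability supplies the majorant
  for removing the smoothing.\<close>

lemma Cauchy_Pompeiu:
  fixes a :: "complex \<Rightarrow> complex"
  assumes a: "Ck 1 a" and K: "compact K" "\<And>z. z \<notin> K \<Longrightarrow> a z = 0"
    and int: "integrable lborel (\<lambda>z. dbar a z / (z - w))"
  shows "(LINT z|lborel. dbar a z / (z - w)) = - (pi * a w)"
proof -
  have cont: "continuous_on UNIV a" using Ck_Suc_imp_Ck[of 0 a] a by simp
  have dcont: "continuous_on UNIV (dbar a)" using a unfolding dbar_def[abs_def] by (auto intro!: continuous_intros)
  have am[measurable]: "a \<in> borel_measurable borel" "dbar a \<in> borel_measurable borel"
    using cont dcont by (auto intro: borel_measurable_continuous_onI)
  obtain B where B: "B \<ge> 0" "\<And>x. cmod (a x) \<le> B"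
    using continuous_support_bounded[OF cont K] by blast
  have dK: "dbar a z = 0" if "z \<notin> K" for z
    using frechet_derivative_support[OF K(2) compact_imp_closed[OF K(1)] that] by (simp add: dbar_def)
  define t where "t n = 1 / real (Suc n)" for n
  have t: "t n > 0" for n by (auto simp: t_def)
  have t0: "t \<longlonglongrightarrow> 0" unfolding t_def by real_asymp
  have t20: "(\<lambda>n. (t n)\<^sup>2) \<longlonglongrightarrow> 0" using tendsto_power[OF t0, of 2] by simp
  \<comment> \<open>The parameter is the square of \<open>t n\<close>, so that dilating by
    \<open>t n\<close> turns the bump into \<open>?P\<close>.\<close>
  let ?\<kappa> = "\<lambda>n. reg_kernel ((t n)\<^sup>2) w"
  have rc: "continuous_on UNIV (?\<kappa> n)" for n using Ck_reg_kernel[of "(t n)\<^sup>2" 0] t[of n] by simp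
  have rm[measurable]: "?\<kappa> n \<in> borel_measurable borel" for n
    using rc by (auto intro: borel_measurable_continuous_onI)
  let ?P = "\<lambda>v. 1 / (1 + (cmod v)\<^sup>2)\<^sup>2"
  have P: "integrable lborel ?P" "(LINT v|lborel. ?P v) = pi"
    using nn_integral_inverse_square by (auto simp: integrable_iff_bounded integral_eq_nn_integral)
  have parts: "(LINT z|lborel. dbar a z * ?\<kappa> n z) = - (LINT v|lborel. a (w + t n *\<^sub>R v) * ?P v)" for n
  proof -
    let ?g = "\<lambda>z. a z * ?\<kappa> n z"
    have e: "(t n)\<^sup>2 > 0" using t[of n] by simp
    have g1: "Ck 1 ?g" by (intro Ck_mult a Ck_reg_kernel e)
    have gK: "?g z = 0" if "z \<notin> K" for z using K(2)[OF that] by simp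
    have cD: "continuous_on UNIV (\<lambda>z. frechet_derivative ?g (at z) v)" for v
      using g1 by simp
    have iD: "integrable lborel (\<lambda>z. frechet_derivative ?g (at z) v)" for v
      by (rule integrable_continuous_support[OF cD K(1)])
        (rule frechet_derivative_support[OF gK compact_imp_closed[OF K(1)]])
    have *: "(LINT z|lborel. dbar ?g z) = 0"
      unfolding dbar_def using iD integral_directional_derivative_eq_0[OF g1 K(1) gK]
      by (simp add: add_divide_distrib)
    have d: "dbar ?g z = a z * of_real ((t n)\<^sup>2 / ((cmod (z - w))\<^sup>2 + (t n)\<^sup>2)\<^sup>2) + dbar a z * ?\<kappa> n z" for z
      using a Ck_reg_kernel[OF e, of "Suc 0" w] by (simp add: dbar_mult dbar_reg_kernel[OF e] del: of_real_divide)
    have "0 = (LINT z|lborel. a z * of_real ((t n)\<^sup>2 / ((cmod (z - w))\<^sup>2 + (t n)\<^sup>2)\<^sup>2) + dbar a z * ?\<kappa> n z)"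
      unfolding *[symmetric] by (intro Bochner_Integration.integral_cong refl d)
    also have "(LINT z|lborel. a z * of_real ((t n)\<^sup>2 / ((cmod (z - w))\<^sup>2 + (t n)\<^sup>2)\<^sup>2) + dbar a z * ?\<kappa> n z)
      = (LINT z|lborel. a z * of_real ((t n)\<^sup>2 / ((cmod (z - w))\<^sup>2 + (t n)\<^sup>2)\<^sup>2)) + (LINT z|lborel. dbar a z * ?\<kappa> n z)"
    proof (rule Bochner_Integration.integral_add)
      show "integrable lborel (\<lambda>z. a z * of_real ((t n)\<^sup>2 / ((cmod (z - w))\<^sup>2 + (t n)\<^sup>2)\<^sup>2))"
        using K(2) e by (intro integrable_continuous_support[OF _ K(1)] continuous_intros cont) (auto simp: add_nonneg_eq_0_iff)
      show "integrable lborel (\<lambda>z. dbar a z * ?\<kappa> n z)"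
        using dK by (intro integrable_continuous_support[OF _ K(1)] continuous_intros dcont rc) auto
    qed
    finally have "(LINT z|lborel. dbar a z * ?\<kappa> n z) = - (LINT z|lborel. a z * of_real ((t n)\<^sup>2 / ((cmod (z - w))\<^sup>2 + (t n)\<^sup>2)\<^sup>2))"
      by (simp add: eq_neg_iff_add_eq_0 add.commute)
    \<comment> \<open>The substitution z = w + t v has Jacobian t^2, the plane having real dimension
      2; this cancels the scaling of the bump.\<close>
    also have "(LINT z|lborel. a z * of_real ((t n)\<^sup>2 / ((cmod (z - w))\<^sup>2 + (t n)\<^sup>2)\<^sup>2))
      = (LINT v|lborel. (t n)\<^sup>2 *\<^sub>R (a (w + t n *\<^sub>R v) * of_real ((t n)\<^sup>2 / ((cmod (t n *\<^sub>R v))\<^sup>2 + (t n)\<^sup>2)\<^sup>2)))"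
      using t[of n] by (subst lborel_affine[of "t n" w]) (simp_all add: integral_density integral_distr)
    also have "\<dots> = (LINT v|lborel. a (w + t n *\<^sub>R v) * ?P v)"
    proof (rule Bochner_Integration.integral_cong)
      fix v
      have "(t n)\<^sup>2 * ((t n)\<^sup>2 / ((cmod (t n *\<^sub>R v))\<^sup>2 + (t n)\<^sup>2)\<^sup>2) = ?P v"
      proof -
        have "(cmod (t n *\<^sub>R v))\<^sup>2 + (t n)\<^sup>2 = (t n)\<^sup>2 * (1 + (cmod v)\<^sup>2)"
          by (simp add: power_mult_distrib algebra_simps)
        then show ?thesis using t[of n] by (simp add: power_mult_distrib power2_eq_square)
      qed
      moreover have "r *\<^sub>R (x * complex_of_real r') = x * complex_of_real (r * r')" for r r' x
        by (simp add: scaleR_conv_of_real)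
      ultimately show "(t n)\<^sup>2 *\<^sub>R (a (w + t n *\<^sub>R v) * of_real ((t n)\<^sup>2 / ((cmod (t n *\<^sub>R v))\<^sup>2 + (t n)\<^sup>2)\<^sup>2)) = a (w + t n *\<^sub>R v) * ?P v"
        by presburger
    qed simp
    finally show ?thesis .
  qed
  have *: "(\<lambda>n. LINT z|lborel. dbar a z * ?\<kappa> n z) \<longlonglongrightarrow> (LINT z|lborel. dbar a z / (z - w))"
  proof (rule integral_dominated_convergence[where w="\<lambda>z. cmod (dbar a z / (z - w))"])
    show "integrable lborel (\<lambda>z. cmod (dbar a z / (z - w)))" using int by simp
    show "AE z in lborel. (\<lambda>n. dbar a z * ?\<kappa> n z) \<longlonglongrightarrow> dbar a z / (z - w)"
      using tendsto_mult_left[OF reg_kernel_tendsto[OF t20, of w]] by (simp add: AE_I2)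
    show "AE z in lborel. cmod (dbar a z * ?\<kappa> n z) \<le> cmod (dbar a z / (z - w))" for n
      using mult_left_mono[OF norm_reg_kernel_le[of "(t n)\<^sup>2" w] norm_ge_zero[of "dbar a _"]] t[of n]
      by (intro AE_I2) (simp add: norm_mult norm_divide)
  qed auto
  have "(\<lambda>n. LINT v|lborel. a (w + t n *\<^sub>R v) * ?P v) \<longlonglongrightarrow> (LINT v|lborel. a w * ?P v)"
  proof (rule integral_dominated_convergence[where w="\<lambda>v. B * ?P v"])
    show "integrable lborel (\<lambda>v. B * ?P v)" using P(1) by (rule integrable_mult_right)
    show "AE v in lborel. cmod (a (w + t n *\<^sub>R v) * ?P v) \<le> B * ?P v" for n
      using B(2) by (intro AE_I2) (simp add: norm_mult norm_divide divide_right_mono del: of_real_add of_real_power)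
    show "AE v in lborel. (\<lambda>n. a (w + t n *\<^sub>R v) * ?P v) \<longlonglongrightarrow> a w * ?P v"
    proof (rule AE_I2)
      fix v
      have "(\<lambda>n. w + t n *\<^sub>R v) \<longlonglongrightarrow> w + 0 *\<^sub>R v" by (intro tendsto_intros t0)
      then have "(\<lambda>n. a (w + t n *\<^sub>R v)) \<longlonglongrightarrow> a w"
        using continuous_on_tendsto_compose[OF cont] by simp
      then show "(\<lambda>n. a (w + t n *\<^sub>R v) * ?P v) \<longlonglongrightarrow> a w * ?P v" by (intro tendsto_intros)
    qed
  qed auto
  moreover have "(LINT v|lborel. a w * ?P v) = pi * a w"
    using P by (simp add: mult.commute del: of_real_divide)
  ultimately have **: "(\<lambda>n. - (LINT z|lborel. dbar a z * ?\<kappa> n z)) \<longlonglongrightarrow> pi * a w"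
    unfolding parts by simp
  have "- (LINT z|lborel. dbar a z / (z - w)) = pi * a w"
    by (rule LIMSEQ_unique[OF tendsto_minus[OF *] **])
  then show ?thesis by (simp add: minus_equation_iff)
qed

section \<open>The Cauchy transform on the unit disc\<close>

text \<open>By convexity the graph of x^p lies above its tangent at m; this is the rearranged
  inequality. Young's inequality with the exponents p and p/(p - 1) gives it for p > 1.\<close>

lemma Youngs_tangent:
  fixes p x m :: real
  assumes "p \<ge> 1" "x \<ge> 0" "m \<ge> 0"
  shows "p * m powr (p - 1) * x \<le> x powr p + (p - 1) * m powr p"
proof (cases "p = 1")
  case True
  \<comment> \<open>Here \<open>m powr 0\<close> is 1 for positive m, but 0 for m = 0.\<close>
  then show ?thesis using assms by (cases "m = 0") auto
next
  case False
  with assms have p: "p > 1" by simp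
  define q where "q = p / (p - 1)"
  have q: "q > 1" "1 / p + 1 / q = 1" using p by (auto simp: q_def field_simps)
  have "x * m powr (p - 1) \<le> x powr p / p + (m powr (p - 1)) powr q / q"
    using p q assms by (intro Youngs_inequality) auto
  also have "(m powr (p - 1)) powr q = m powr p"
    using p by (simp add: powr_powr q_def)
  also have "x powr p / p + m powr p / q = (x powr p + (p - 1) * m powr p) / p"
    using p by (simp add: q_def field_simps)
  finally show ?thesis
    using p by (simp add: field_simps)
qed

text \<open>Jensen's inequality for a kernel of mass at most \<open>A\<close>, obtained by
  integrating the tangent inequality against |k|. If an integral diverges, either the left side is 0
  or the right side is infinite.\<close>

lemma norm_integral_powr_le:
  fixes h k :: "'a \<Rightarrow> complex"
  assumes [measurable]: "h \<in> borel_measurable M" "k \<in> borel_measurable M"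
    and k: "(\<integral>\<^sup>+ w. norm (k w) \<partial>M) \<le> ennreal A" and A: "A > 0" and p: "p \<ge> 1"
  shows "ennreal (cmod (LINT w|M. h w * k w) powr p)
    \<le> ennreal (A powr (p - 1)) * (\<integral>\<^sup>+ w. ennreal (cmod (h w) powr p * cmod (k w)) \<partial>M)"
proof (cases "integrable M (\<lambda>w. h w * k w) \<and> (\<integral>\<^sup>+ w. ennreal (cmod (h w) powr p * cmod (k w)) \<partial>M) < \<infinity>")
  case True
  \<comment> \<open>The point of tangency is the mean of |h| with respect to |k|, with
    \<open>A\<close> in place of the actual mass.\<close>
  define m where "m = (LINT w|M. cmod (h w * k w)) / A"
  have m: "m \<ge> 0" "(LINT w|M. cmod (h w) * cmod (k w)) = A * m"
    using A by (auto simp: m_def norm_mult)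
  have ik: "integrable M (\<lambda>w. cmod (k w))" and ik': "(LINT w|M. cmod (k w)) \<le> A"
  proof -
    show "integrable M (\<lambda>w. cmod (k w))"
      using le_less_trans[OF k] by (simp add: integrable_iff_bounded)
    from nn_integral_eq_integral[OF this] k A show "(LINT w|M. cmod (k w)) \<le> A" by simp
  qed
  have ip: "integrable M (\<lambda>w. cmod (h w) powr p * cmod (k w))"
    using True by (simp add: integrable_iff_bounded)
  have ihk: "integrable M (\<lambda>w. cmod (h w) * cmod (k w))"
    using True integrable_norm[of M "\<lambda>w. h w * k w"] by (simp add: norm_mult)
  define J where "J = (LINT w|M. cmod (h w) powr p * cmod (k w))"
  have "(LINT w|M. p * m powr (p - 1) * (cmod (h w) * cmod (k w)))
    \<le> (LINT w|M. cmod (h w) powr p * cmod (k w) + (p - 1) * m powr p * cmod (k w))"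
  proof (rule integral_mono)
    show "p * m powr (p - 1) * (cmod (h w) * cmod (k w)) \<le> cmod (h w) powr p * cmod (k w) + (p - 1) * m powr p * cmod (k w)" for w
      using mult_right_mono[OF Youngs_tangent[OF p norm_ge_zero[of "h w"] m(1)] norm_ge_zero[of "k w"]]
      by (simp add: algebra_simps)
  qed (use ik ip ihk in auto)
  also have "\<dots> = J + (p - 1) * m powr p * (LINT w|M. cmod (k w))"
    using ik ip by (simp add: J_def)
  \<comment> \<open>An upper bound for the mass is enough, because its coefficient is
    nonnegative.\<close>
  also have "\<dots> \<le> J + (p - 1) * m powr p * A"
    using p ik' by (intro add_left_mono mult_left_mono) auto
  also have "(LINT w|M. p * m powr (p - 1) * (cmod (h w) * cmod (k w))) = p * A * (m powr (p - 1) * m)"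
    by (simp add: m(2))
  also have "m powr (p - 1) * m = m powr p"
    using m(1) p by (cases "m = 0") (auto simp: powr_diff)
  finally have "A * m powr p \<le> J" by (simp add: algebra_simps)
  then have "A powr (p - 1) * (A * m powr p) \<le> A powr (p - 1) * J" by (rule mult_left_mono) simp
  also have "A powr (p - 1) * (A * m powr p) = (A * m) powr p"
    using A m by (simp add: powr_mult powr_diff)
  finally have "(A * m) powr p \<le> A powr (p - 1) * J" .
  moreover have "cmod (LINT w|M. h w * k w) powr p \<le> (A * m) powr p"
    unfolding m(2)[symmetric] using integral_norm_bound[of M "\<lambda>w. h w * k w"] p
    by (intro powr_mono2) (auto simp: norm_mult)
  ultimately have "ennreal (cmod (LINT w|M. h w * k w) powr p) \<le> ennreal (A powr (p - 1) * J)"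
    by (intro ennreal_leI) simp
  also have "\<dots> = ennreal (A powr (p - 1)) * (\<integral>\<^sup>+ w. ennreal (cmod (h w) powr p * cmod (k w)) \<partial>M)"
    using nn_integral_eq_integral[OF ip] by (simp add: ennreal_mult' J_def)
  finally show ?thesis .
next
  case False
  then have "\<not> integrable M (\<lambda>w. h w * k w) \<or> \<not> (\<integral>\<^sup>+ w. ennreal (cmod (h w) powr p * cmod (k w)) \<partial>M) < \<infinity>"
    by blast
  then show ?thesis
  proof
    assume "\<not> integrable M (\<lambda>w. h w * k w)"
    \<comment> \<open>A Bochner integral that does not exist has the value 0.\<close>
    then show ?thesis by (simp add: not_integrable_integral_eq)
  next
    assume "\<not> (\<integral>\<^sup>+ w. ennreal (cmod (h w) powr p * cmod (k w)) \<partial>M) < \<infinity>"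
    then have "(\<integral>\<^sup>+ w. ennreal (cmod (h w) powr p * cmod (k w)) \<partial>M) = \<infinity>" by (simp add: less_top[symmetric])
    then show ?thesis using A by (simp add: ennreal_mult_top)
  qed
qed

section \<open>The truncated Cauchy kernel and its mass\<close>

lemma unit_disc_borel [measurable]: "unit_disc \<in> sets borel"
  unfolding unit_disc_def by (auto intro!: borel_open open_Collect_less continuous_intros)

lemma punctured_disc_borel [measurable]: "punctured_disc \<in> sets borel"
  unfolding punctured_disc_def
  by (auto intro!: borel_open open_Collect_conj open_Collect_less continuous_intros)

text \<open>The constant is -1/(2 pi i) times the factor 2i of the area form. Truncation in both
  variables preserves antisymmetry and bounds the mass for every z in the plane. The full disc also
  serves the punctured variable, since the functions to be transformed vanish off
  \<open>Omega\<close>.\<close>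

definition cauchy_kernel :: "complex \<Rightarrow> complex \<Rightarrow> complex" where
  "cauchy_kernel z w = (if z \<in> unit_disc \<and> w \<in> unit_disc then - 1 / (of_real pi * (w - z)) else 0)"

lemma cauchy_kernel_swap: "cauchy_kernel w z = - cauchy_kernel z w"
proof -
  have "of_real pi * (w - z) = - (of_real pi * (z - w))" for w z :: complex by (simp add: algebra_simps)
  then have "- 1 / (of_real pi * (z - w)) = - (- 1 / (of_real pi * (w - z)))" for w z :: complex
    by (metis divide_minus_right)
  then show ?thesis unfolding cauchy_kernel_def by auto
qed

lemma norm_cauchy_kernel_swap: "cmod (cauchy_kernel w z) = cmod (cauchy_kernel z w)"
  by (metis cauchy_kernel_swap norm_minus_cancel)

lemma dbar_support:
  assumes "\<And>x. x \<notin> K \<Longrightarrow> a x = 0" "closed K" "x \<notin> K"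
  shows "dbar a x = 0"
  using frechet_derivative_support[of K a x, OF assms] by (simp add: dbar_def)

lemma cauchy_kernel_measurable [measurable]:
  assumes [measurable]: "f \<in> borel_measurable M" "g \<in> borel_measurable M"
  shows "(\<lambda>x. cauchy_kernel (f x) (g x)) \<in> borel_measurable M"
  unfolding cauchy_kernel_def by measurable

definition kernel_mass :: real where
  "kernel_mass = (SOME A. A > 0 \<and> (\<forall>z. (\<integral>\<^sup>+ w. ennreal (cmod (cauchy_kernel z w)) \<partial>lborel) \<le> ennreal A))"

lemma kernel_mass:
  "kernel_mass > 0" "(\<integral>\<^sup>+ w. ennreal (cmod (cauchy_kernel z w)) \<partial>lborel) \<le> ennreal kernel_mass"
proof -
  obtain A where A: "A > 0"
    "\<And>z. z \<in> unit_disc \<Longrightarrow> (\<integral>\<^sup>+ w. ennreal (1 / cmod (w - z)) * indicator unit_disc w \<partial>lborel) \<le> ennreal A"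
    using Cauchy_kernel_bound by blast
  have "(\<integral>\<^sup>+ w. ennreal (cmod (cauchy_kernel z w)) \<partial>lborel) \<le> ennreal A" for z
  proof (cases "z \<in> unit_disc")
    case True
    have le: "1 / (pi * r) \<le> 1 / r" if "r \<ge> 0" for r :: real
    proof (cases "r = 0")
      case False
      have "1 * r \<le> pi * r" using that pi_ge_two by (intro mult_right_mono) auto
      then show ?thesis using that False pi_gt_zero by (intro divide_left_mono mult_pos_pos) auto
    qed simp
    have "(\<integral>\<^sup>+ w. ennreal (cmod (cauchy_kernel z w)) \<partial>lborel) \<le> (\<integral>\<^sup>+ w. ennreal (1 / cmod (w - z)) * indicator unit_disc w \<partial>lborel)"
      by (intro nn_integral_mono) (auto simp: cauchy_kernel_def norm_divide norm_mult indicator_def intro!: ennreal_leI le)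
    with A(2)[OF True] show ?thesis by simp
  next
    case False
    then show ?thesis by (simp add: cauchy_kernel_def)
  qed
  with A(1) have "\<exists>A>0. \<forall>z. (\<integral>\<^sup>+ w. ennreal (cmod (cauchy_kernel z w)) \<partial>lborel) \<le> ennreal A" by blast
  from someI_ex[OF this, folded kernel_mass_def]
  show "kernel_mass > 0" "(\<integral>\<^sup>+ w. ennreal (cmod (cauchy_kernel z w)) \<partial>lborel) \<le> ennreal kernel_mass"
    by auto
qed

text \<open>A Schur-type bound: by antisymmetry the mass is bounded in whichever variable is
  integrated.\<close>

lemma nn_integral_mult_cauchy_kernel:
  assumes [measurable]: "F \<in> borel_measurable (borel :: complex measure)"
  shows "(\<integral>\<^sup>+ z. \<integral>\<^sup>+ w. F w * ennreal (cmod (cauchy_kernel z w)) \<partial>lborel \<partial>lborel) \<le> ennreal kernel_mass * (\<integral>\<^sup>+ w. F w \<partial>lborel)"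
proof -
  have "(\<integral>\<^sup>+ z. \<integral>\<^sup>+ w. F w * ennreal (cmod (cauchy_kernel z w)) \<partial>lborel \<partial>lborel)
    = (\<integral>\<^sup>+ w. \<integral>\<^sup>+ z. F w * ennreal (cmod (cauchy_kernel z w)) \<partial>lborel \<partial>lborel)"
    by (rule lborel_pair.Fubini') measurable
  also have "\<dots> = (\<integral>\<^sup>+ w. F w * (\<integral>\<^sup>+ z. ennreal (cmod (cauchy_kernel z w)) \<partial>lborel) \<partial>lborel)"
    by (simp add: nn_integral_cmult)
  also have "\<dots> \<le> (\<integral>\<^sup>+ w. F w * ennreal kernel_mass \<partial>lborel)"
  proof (intro nn_integral_mono mult_left_mono)
    show "(\<integral>\<^sup>+ z. ennreal (cmod (cauchy_kernel z w)) \<partial>lborel) \<le> ennreal kernel_mass" for w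
      using kernel_mass(2)[of w] by (simp add: norm_cauchy_kernel_swap[of _ w])
  qed simp
  also have "\<dots> = ennreal kernel_mass * (\<integral>\<^sup>+ w. F w \<partial>lborel)"
    unfolding mult.commute[of _ "ennreal kernel_mass"] by (rule nn_integral_cmult) measurable
  finally show ?thesis .
qed

section \<open>The Cauchy transform in one variable\<close>

definition cauchy :: "(complex \<Rightarrow> complex) \<Rightarrow> complex \<Rightarrow> complex" where
  "cauchy h z = (LINT w|lborel. h w * cauchy_kernel z w)"

text \<open>Jensen's inequality contributes \<open>kernel_mass powr (p - 1)\<close>, the exchange of
  integrals one further factor \<open>kernel_mass\<close>.\<close>

lemma nn_integral_cauchy_powr:
  assumes [measurable]: "h \<in> borel_measurable borel" and p: "p \<ge> 1"
  shows "(\<integral>\<^sup>+ z. ennreal (cmod (cauchy h z) powr p) \<partial>lborel)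
    \<le> ennreal (kernel_mass powr p) * (\<integral>\<^sup>+ w. ennreal (cmod (h w) powr p) \<partial>lborel)"
proof -
  have "(\<integral>\<^sup>+ z. ennreal (cmod (cauchy h z) powr p) \<partial>lborel)
     \<le> (\<integral>\<^sup>+ z. ennreal (kernel_mass powr (p - 1)) * (\<integral>\<^sup>+ w. ennreal (cmod (h w) powr p) * ennreal (cmod (cauchy_kernel z w)) \<partial>lborel) \<partial>lborel)"
    unfolding cauchy_def
    by (intro nn_integral_mono order.trans[OF norm_integral_powr_le[OF _ _ kernel_mass(2,1) p]])
      (auto simp: ennreal_mult')
  also have "\<dots> = ennreal (kernel_mass powr (p - 1)) * (\<integral>\<^sup>+ z. \<integral>\<^sup>+ w. ennreal (cmod (h w) powr p) * ennreal (cmod (cauchy_kernel z w)) \<partial>lborel \<partial>lborel)"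
    by (rule nn_integral_cmult) measurable
  also have "\<dots> \<le> ennreal (kernel_mass powr (p - 1)) * (ennreal kernel_mass * (\<integral>\<^sup>+ w. ennreal (cmod (h w) powr p) \<partial>lborel))"
    by (intro mult_left_mono nn_integral_mult_cauchy_kernel) auto
  also have "\<dots> = ennreal (kernel_mass powr p) * (\<integral>\<^sup>+ w. ennreal (cmod (h w) powr p) \<partial>lborel)"
    using kernel_mass(1) by (simp add: mult.assoc[symmetric] ennreal_mult'[symmetric] powr_diff)
  finally show ?thesis .
qed

lemma cauchy_measurable [measurable]:
  assumes [measurable]: "h \<in> borel_measurable borel"
  shows "cauchy h \<in> borel_measurable borel"
  unfolding cauchy_def[abs_def] by measurable

lemma integrable_cauchy_pair:
  assumes h: "integrable lborel h"
  shows "integrable (lborel \<Otimes>\<^sub>M lborel) (\<lambda>(z, w). h w * cauchy_kernel z w)"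
proof -
  have [measurable]: "h \<in> borel_measurable borel" using h by auto
  have "(\<integral>\<^sup>+ x. ennreal (norm ((\<lambda>(z, w). h w * cauchy_kernel z w) x)) \<partial>(lborel \<Otimes>\<^sub>M lborel))
    = (\<integral>\<^sup>+ z. \<integral>\<^sup>+ w. ennreal (cmod (h w)) * ennreal (cmod (cauchy_kernel z w)) \<partial>lborel \<partial>lborel)"
    by (subst lborel.nn_integral_fst[symmetric]) (auto simp: norm_mult ennreal_mult')
  also have "\<dots> \<le> ennreal kernel_mass * (\<integral>\<^sup>+ w. ennreal (cmod (h w)) \<partial>lborel)"
    by (rule nn_integral_mult_cauchy_kernel) measurable
  also have "\<dots> < \<infinity>"
    using h by (auto simp: integrable_iff_bounded ennreal_mult_less_top)
  finally show ?thesis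
    by (intro integrableI_bounded) auto
qed

lemma test_on_props:
  assumes "a \<in> test_on U" "U \<subseteq> unit_disc"
  shows "Ck k a" "compact (closure {z. a z \<noteq> 0})" "z \<notin> closure {z. a z \<noteq> 0} \<Longrightarrow> a z = 0"
    "z \<notin> unit_disc \<Longrightarrow> a z = 0" "z \<notin> unit_disc \<Longrightarrow> dbar a z = 0"
proof -
  let ?K = "closure {z. a z \<noteq> 0}"
  have K: "compact ?K" "?K \<subseteq> unit_disc" and s: "\<And>k. Ck k a" using assms by (auto simp: test_on_def)
  show "Ck k a" by (rule s)
  show "compact ?K" by (rule K)
  have z: "a z = 0" if "z \<notin> ?K" for z using that closure_subset[of "{z. a z \<noteq> 0}"] by auto
  show "z \<notin> ?K \<Longrightarrow> a z = 0" by (rule z)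
  show "z \<notin> unit_disc \<Longrightarrow> a z = 0" using K(2) z by blast
  show "z \<notin> unit_disc \<Longrightarrow> dbar a z = 0"
    using dbar_support[of ?K a z] z compact_imp_closed[OF K(1)] K(2) by blast
qed

text \<open>Truncation is harmless in the Cauchy-Pompeiu formula because \<open>dbar a\<close>
  vanishes off the disc; its integrability condition holds because \<open>dbar a\<close> is bounded
  and the kernel has finite mass.\<close>

lemma cauchy_dbar:
  assumes a: "a \<in> test_on U" "U \<subseteq> unit_disc" and w: "w \<in> unit_disc"
  shows "cauchy (dbar a) w = a w"
proof -
  note t = test_on_props[OF a]
  let ?K = "closure {z. a z \<noteq> 0}"
  have c: "continuous_on UNIV (dbar a)"
    using t(1)[of 1] unfolding dbar_def[abs_def] by (auto intro!: continuous_intros)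
  then have [measurable]: "dbar a \<in> borel_measurable borel" by (rule borel_measurable_continuous_onI)
  have eq: "dbar a z * cauchy_kernel w z = - 1 / pi * (dbar a z / (z - w))" for z
    using w t(5)[of z] by (auto simp: cauchy_kernel_def)
  have dK: "dbar a z = 0" if "z \<notin> ?K" for z
    by (rule dbar_support[OF t(3) compact_imp_closed[OF t(2)] that])
  obtain B where B: "B \<ge> 0" "\<And>z. cmod (dbar a z) \<le> B"
    using continuous_support_bounded[OF c t(2) dK] by auto
  have "(\<integral>\<^sup>+ z. ennreal (cmod (dbar a z * cauchy_kernel w z)) \<partial>lborel) \<le> (\<integral>\<^sup>+ z. ennreal B * ennreal (cmod (cauchy_kernel w z)) \<partial>lborel)"
    using B by (intro nn_integral_mono) (auto simp: norm_mult ennreal_mult'[symmetric] intro!: ennreal_leI mult_right_mono)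
  also have "\<dots> = ennreal B * (\<integral>\<^sup>+ z. ennreal (cmod (cauchy_kernel w z)) \<partial>lborel)"
    by (rule nn_integral_cmult) measurable
  also have "\<dots> < \<infinity>" using le_less_trans[OF kernel_mass(2)[of w]] by (auto simp: ennreal_mult_less_top)
  finally have "integrable lborel (\<lambda>z. dbar a z * cauchy_kernel w z)"
    by (intro integrableI_bounded) auto
  then have "integrable lborel (\<lambda>z. - pi * (dbar a z * cauchy_kernel w z))" by (rule integrable_mult_right)
  then have int: "integrable lborel (\<lambda>z. dbar a z / (z - w))" unfolding eq by simp
  have "cauchy (dbar a) w = - 1 / pi * (LINT z|lborel. dbar a z / (z - w))"
    unfolding cauchy_def eq by (rule integral_mult_right_zero)
  also have "\<dots> = a w"
    using Cauchy_Pompeiu[OF t(1)[of 1] t(2,3) int] by simp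
  finally show ?thesis .
qed

text \<open>Antisymmetry of the kernel makes the transpose of the transform its negative.
  Boundedness of \<open>b\<close> makes the double integral absolutely convergent, as Fubini's
  theorem requires.\<close>

lemma integral_cauchy_mult:
  assumes h: "integrable lborel h" and [measurable]: "b \<in> borel_measurable borel" and b: "\<And>z. cmod (b z) \<le> B"
  shows "(LINT z|lborel. cauchy h z * b z) = - (LINT w|lborel. h w * cauchy b w)"
proof -
  have [measurable]: "h \<in> borel_measurable borel" using h by auto
  have int: "integrable (lborel \<Otimes>\<^sub>M lborel) (\<lambda>(z, w). h w * cauchy_kernel z w * b z)"
  proof (rule Bochner_Integration.integrable_bound)
    show "integrable (lborel \<Otimes>\<^sub>M lborel) (\<lambda>x. B *\<^sub>R (\<lambda>(z, w). h w * cauchy_kernel z w) x)"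
      by (intro integrable_scaleR_right integrable_cauchy_pair h)
    have "\<bar>B\<bar> \<ge> cmod (b z)" for z using b[of z] by linarith
    then show "AE x in lborel \<Otimes>\<^sub>M lborel. norm ((\<lambda>(z, w). h w * cauchy_kernel z w * b z) x) \<le> norm (B *\<^sub>R (\<lambda>(z, w). h w * cauchy_kernel z w) x)"
      by (intro AE_I2) (auto simp: norm_mult mult.commute[of "\<bar>B\<bar>"] intro!: mult_left_mono)
  qed measurable
  have "(LINT z|lborel. cauchy h z * b z) = (LINT z|lborel. LINT w|lborel. h w * cauchy_kernel z w * b z)"
    by (simp add: cauchy_def)
  also have "\<dots> = (LINT w|lborel. LINT z|lborel. h w * cauchy_kernel z w * b z)"
    using lborel_pair.Fubini_integral[of "\<lambda>z w. h w * cauchy_kernel z w * b z"] int by simp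
  also have "\<dots> = (LINT w|lborel. h w * - cauchy b w)"
  proof (rule Bochner_Integration.integral_cong)
    fix w
    have "h w * cauchy_kernel z w * b z = h w * - (b z * cauchy_kernel w z)" for z by (simp add: cauchy_kernel_swap[of z w])
    then show "(LINT z|lborel. h w * cauchy_kernel z w * b z) = h w * - cauchy b w"
      unfolding cauchy_def by (simp only: integral_mult_right_zero integral_minus)
  qed simp
  finally show ?thesis by simp
qed

section \<open>Partial Cauchy transforms on the bidisc\<close>

text \<open>Swapping coordinates transports statements about the first variable to the
  second.\<close>

definition swap_args :: "(complex \<times> complex \<Rightarrow> 'a) \<Rightarrow> complex \<times> complex \<Rightarrow> 'a" where
  "swap_args f = (\<lambda>(x, y). f (y, x))"

definition cauchy1 :: "(complex \<times> complex \<Rightarrow> complex) \<Rightarrow> complex \<times> complex \<Rightarrow> complex" where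
  "cauchy1 f = (\<lambda>(x, y). cauchy (\<lambda>w. f (w, y)) x)"

definition cauchy2 :: "(complex \<times> complex \<Rightarrow> complex) \<Rightarrow> complex \<times> complex \<Rightarrow> complex" where
  "cauchy2 f = (\<lambda>(x, y). cauchy (\<lambda>w. f (x, w)) y)"

lemma swap_args_swap_args [simp]: "swap_args (swap_args f) = f"
  by (simp add: swap_args_def)

lemma swap_args_apply [simp]: "swap_args f (x, y) = f (y, x)"
  by (simp add: swap_args_def)

lemma cauchy2_eq_swap_args: "cauchy2 f = swap_args (cauchy1 (swap_args f))"
  by (simp add: cauchy1_def cauchy2_def swap_args_def)

lemma borel_measurable_fst_snd [measurable (raw)]:
  fixes f :: "'a \<Rightarrow> complex \<times> complex"
  assumes "f \<in> borel_measurable M"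
  shows "(\<lambda>x. fst (f x)) \<in> borel_measurable M" "(\<lambda>x. snd (f x)) \<in> borel_measurable M"
  by (rule measurable_compose[OF assms], intro borel_measurable_continuous_onI continuous_intros)+

lemma swap_args_measurable [measurable]:
  assumes [measurable]: "f \<in> borel_measurable borel"
  shows "swap_args f \<in> borel_measurable borel"
  unfolding swap_args_def case_prod_beta' by measurable

lemma cauchy1_measurable [measurable]:
  assumes [measurable]: "f \<in> borel_measurable borel"
  shows "cauchy1 f \<in> borel_measurable borel"
  unfolding cauchy1_def cauchy_def case_prod_beta' by measurable

lemma cauchy2_measurable [measurable]:
  "f \<in> borel_measurable borel \<Longrightarrow> cauchy2 f \<in> borel_measurable borel"
  unfolding cauchy2_eq_swap_args by measurable

lemma nn_integral_pair:
  assumes "f \<in> borel_measurable (borel :: (complex \<times> complex) measure)"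
  shows "(\<integral>\<^sup>+ z. f z \<partial>lborel) = (\<integral>\<^sup>+ x. \<integral>\<^sup>+ y. f (x, y) \<partial>lborel \<partial>lborel)"
    "(\<integral>\<^sup>+ z. f z \<partial>lborel) = (\<integral>\<^sup>+ y. \<integral>\<^sup>+ x. f (x, y) \<partial>lborel \<partial>lborel)"
  using lborel.nn_integral_fst[of f lborel] lborel_pair.nn_integral_snd[of f] assms
  by (simp_all add: lborel_prod)

lemma nn_integral_swap_args:
  "f \<in> borel_measurable borel \<Longrightarrow> (\<integral>\<^sup>+ z. swap_args f z \<partial>lborel) = (\<integral>\<^sup>+ z. f z \<partial>lborel)"
  by (subst nn_integral_pair(1)) (simp_all add: nn_integral_pair(2))

lemma integral_pair:
  fixes f :: "complex \<times> complex \<Rightarrow> complex"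
  assumes "integrable lborel f"
  shows "(LINT z|lborel. f z) = (LINT x|lborel. LINT y|lborel. f (x, y))"
    "(LINT z|lborel. f z) = (LINT y|lborel. LINT x|lborel. f (x, y))"
    "AE x in lborel. integrable lborel (\<lambda>y. f (x, y))"
    "AE y in lborel. integrable lborel (\<lambda>x. f (x, y))"
  using lborel_pair.integral_fst[of "\<lambda>x y. f (x, y)"] lborel_pair.integral_snd[of "\<lambda>x y. f (x, y)"]
    lborel_pair.AE_integrable_fst[of "\<lambda>x y. f (x, y)"] lborel_pair.AE_integrable_snd[of "\<lambda>x y. f (x, y)"] assms
  by (simp_all add: lborel_prod)

lemma integrable_swap_args:
  "integrable lborel f \<Longrightarrow> integrable lborel (swap_args f)" for f :: "complex \<times> complex \<Rightarrow> complex"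
  using lborel_pair.integrable_product_swap[of f] by (simp add: lborel_prod swap_args_def)

lemma integral_swap_args:
  "f \<in> borel_measurable borel \<Longrightarrow> (LINT z|lborel. swap_args f z) = (LINT z|lborel. f z)"
  for f :: "complex \<times> complex \<Rightarrow> complex"
  using lborel_pair.integral_product_swap[of f] by (simp add: lborel_prod swap_args_def)

text \<open>The image of a null set is null because its indicator has the same integral.\<close>

lemma AE_swap_args: "AE z in lborel. P z \<Longrightarrow> AE z in lborel. swap_args P z"
proof -
  assume "AE z in lborel. P z"
  then obtain N where "N \<in> null_sets lborel" "{z \<in> space lborel. \<not> P z} \<subseteq> N"
    unfolding eventually_ae_filter by blast
  then have N: "N \<in> sets lborel" "emeasure lborel N = 0" "\<And>z. z \<notin> N \<Longrightarrow> P z"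
    by auto
  let ?M = "{z. swap_args (\<lambda>z. z \<in> N) z}"
  have eq: "indicator ?M = swap_args (indicator N :: _ \<Rightarrow> ennreal)"
    by (auto simp: swap_args_def indicator_def fun_eq_iff)
  have [measurable]: "N \<in> sets borel" using N by simp
  have M: "?M \<in> sets borel"
  proof -
    have "swap_args (indicator N :: _ \<Rightarrow> ennreal) \<in> borel_measurable borel" by measurable
    then show ?thesis unfolding eq[symmetric] by (simp add: borel_measurable_indicator_iff)
  qed
  moreover have "emeasure lborel ?M = 0"
  proof -
    have "emeasure lborel ?M = (\<integral>\<^sup>+ z. indicator ?M z \<partial>lborel)" using M by simp
    also have "\<dots> = (\<integral>\<^sup>+ z. indicator N z \<partial>lborel)" unfolding eq by (rule nn_integral_swap_args) measurable
    finally show ?thesis using N by simp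
  qed
  ultimately show ?thesis
    using N(3) by (intro AE_I'[of ?M]) (auto simp: null_sets_def swap_args_def)
qed

lemma nn_integral_cauchy1_powr:
  assumes [measurable]: "f \<in> borel_measurable borel" and p: "p \<ge> 1"
  shows "(\<integral>\<^sup>+ z. ennreal (cmod (cauchy1 f z) powr p) \<partial>lborel)
    \<le> ennreal (kernel_mass powr p) * (\<integral>\<^sup>+ z. ennreal (cmod (f z) powr p) \<partial>lborel)"
proof -
  have m: "(\<lambda>z. ennreal (cmod (cauchy1 f z) powr p)) \<in> borel_measurable borel" by measurable
  have "(\<integral>\<^sup>+ z. ennreal (cmod (cauchy1 f z) powr p) \<partial>lborel)
    = (\<integral>\<^sup>+ y. \<integral>\<^sup>+ x. ennreal (cmod (cauchy (\<lambda>w. f (w, y)) x) powr p) \<partial>lborel \<partial>lborel)"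
    unfolding nn_integral_pair(2)[OF m] by (simp add: cauchy1_def)
  also have "\<dots> \<le> (\<integral>\<^sup>+ y. ennreal (kernel_mass powr p) * (\<integral>\<^sup>+ x. ennreal (cmod (f (x, y)) powr p) \<partial>lborel) \<partial>lborel)"
    by (intro nn_integral_mono nn_integral_cauchy_powr p) measurable
  also have "\<dots> = ennreal (kernel_mass powr p) * (\<integral>\<^sup>+ z. ennreal (cmod (f z) powr p) \<partial>lborel)"
    by (subst nn_integral_cmult) (simp_all add: nn_integral_pair(2))
  finally show ?thesis .
qed

lemma nn_integral_cauchy2_powr:
  assumes [measurable]: "f \<in> borel_measurable borel" and p: "p \<ge> 1"
  shows "(\<integral>\<^sup>+ z. ennreal (cmod (cauchy2 f z) powr p) \<partial>lborel)
    \<le> ennreal (kernel_mass powr p) * (\<integral>\<^sup>+ z. ennreal (cmod (f z) powr p) \<partial>lborel)"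
proof -
  have eq: "(\<integral>\<^sup>+ z. ennreal (cmod (swap_args h z) powr p) \<partial>lborel) = (\<integral>\<^sup>+ z. ennreal (cmod (h z) powr p) \<partial>lborel)"
    if [measurable]: "h \<in> borel_measurable borel" for h
    using nn_integral_swap_args[of "\<lambda>z. ennreal (cmod (h z) powr p)"] by (simp add: swap_args_def case_prod_beta')
  show ?thesis
    unfolding cauchy2_eq_swap_args using nn_integral_cauchy1_powr[of "swap_args f" p] p by (simp add: eq)
qed

lemma integrable_cauchy1:
  assumes "integrable lborel f"
  shows "integrable lborel (cauchy1 f)"
proof -
  have [measurable]: "f \<in> borel_measurable borel" using assms by auto
  have "(\<integral>\<^sup>+ z. ennreal (cmod (cauchy1 f z)) \<partial>lborel) \<le> ennreal kernel_mass * (\<integral>\<^sup>+ z. ennreal (cmod (f z)) \<partial>lborel)"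
    using nn_integral_cauchy1_powr[of f 1] kernel_mass(1) by simp
  also have "\<dots> < \<infinity>" using assms by (auto simp: integrable_iff_bounded ennreal_mult_less_top)
  finally show ?thesis by (intro integrableI_bounded) auto
qed

lemma integrable_cauchy2: "integrable lborel f \<Longrightarrow> integrable lborel (cauchy2 f)"
  unfolding cauchy2_eq_swap_args by (intro integrable_swap_args integrable_cauchy1)

text \<open>Absolute values stand inside the transform here. Finiteness then proves convergence
  almost everywhere, which a norm bound for \<open>cauchy1\<close> could not show, a divergent
  integral counting as 0.\<close>

lemma nn_integral_kernel1:
  assumes [measurable]: "F \<in> borel_measurable (borel :: (complex \<times> complex) measure)"
  shows "(\<integral>\<^sup>+ z. \<integral>\<^sup>+ w. F (w, snd z) * ennreal (cmod (cauchy_kernel (fst z) w)) \<partial>lborel \<partial>lborel)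
    \<le> ennreal kernel_mass * (\<integral>\<^sup>+ z. F z \<partial>lborel)"
proof -
  have m: "(\<lambda>z. \<integral>\<^sup>+ w. F (w, snd z) * ennreal (cmod (cauchy_kernel (fst z) w)) \<partial>lborel) \<in> borel_measurable borel"
    by measurable
  have "(\<integral>\<^sup>+ z. \<integral>\<^sup>+ w. F (w, snd z) * ennreal (cmod (cauchy_kernel (fst z) w)) \<partial>lborel \<partial>lborel)
    = (\<integral>\<^sup>+ y. \<integral>\<^sup>+ x. \<integral>\<^sup>+ w. F (w, y) * ennreal (cmod (cauchy_kernel x w)) \<partial>lborel \<partial>lborel \<partial>lborel)"
    by (subst nn_integral_pair(2)[OF m]) simp
  also have "\<dots> \<le> (\<integral>\<^sup>+ y. ennreal kernel_mass * (\<integral>\<^sup>+ x. F (x, y) \<partial>lborel) \<partial>lborel)"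
    by (intro nn_integral_mono nn_integral_mult_cauchy_kernel) measurable
  also have "\<dots> = ennreal kernel_mass * (\<integral>\<^sup>+ z. F z \<partial>lborel)"
    by (subst nn_integral_cmult) (simp_all add: nn_integral_pair(2))
  finally show ?thesis .
qed

lemma nn_integral_kernel2:
  assumes [measurable]: "F \<in> borel_measurable (borel :: (complex \<times> complex) measure)"
  shows "(\<integral>\<^sup>+ z. \<integral>\<^sup>+ w. F (fst z, w) * ennreal (cmod (cauchy_kernel (snd z) w)) \<partial>lborel \<partial>lborel)
    \<le> ennreal kernel_mass * (\<integral>\<^sup>+ z. F z \<partial>lborel)"
proof -
  have m: "(\<lambda>z. \<integral>\<^sup>+ w. F (fst z, w) * ennreal (cmod (cauchy_kernel (snd z) w)) \<partial>lborel) \<in> borel_measurable borel"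
    by measurable
  have "(\<integral>\<^sup>+ z. \<integral>\<^sup>+ w. F (fst z, w) * ennreal (cmod (cauchy_kernel (snd z) w)) \<partial>lborel \<partial>lborel)
    = (\<integral>\<^sup>+ z. \<integral>\<^sup>+ w. swap_args F (w, snd z) * ennreal (cmod (cauchy_kernel (fst z) w)) \<partial>lborel \<partial>lborel)"
    by (subst nn_integral_swap_args[OF m, symmetric]) (simp add: swap_args_def case_prod_beta')
  also have "\<dots> \<le> ennreal kernel_mass * (\<integral>\<^sup>+ z. swap_args F z \<partial>lborel)"
    by (rule nn_integral_kernel1) measurable
  finally show ?thesis by (simp add: nn_integral_swap_args)
qed

lemma AE_integrable_kernel1:
  fixes f :: "complex \<times> complex \<Rightarrow> complex"
  assumes f: "integrable lborel f"
  shows "AE z in lborel. integrable lborel (\<lambda>w. f (w, snd z) * cauchy_kernel (fst z) w)"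
proof -
  have [measurable]: "f \<in> borel_measurable borel" using f by auto
  have m: "(\<lambda>z. \<integral>\<^sup>+ w. ennreal (cmod (f (w, snd z))) * ennreal (cmod (cauchy_kernel (fst z) w)) \<partial>lborel) \<in> borel_measurable borel"
    by measurable
  have "(\<integral>\<^sup>+ z. \<integral>\<^sup>+ w. ennreal (cmod (f (w, snd z))) * ennreal (cmod (cauchy_kernel (fst z) w)) \<partial>lborel \<partial>lborel)
      \<le> ennreal kernel_mass * (\<integral>\<^sup>+ z. ennreal (cmod (f z)) \<partial>lborel)"
    by (rule nn_integral_kernel1) measurable
  also have "\<dots> < \<infinity>" using f by (auto simp: integrable_iff_bounded ennreal_mult_less_top)
  finally have "AE z in lborel. (\<integral>\<^sup>+ w. ennreal (cmod (f (w, snd z))) * ennreal (cmod (cauchy_kernel (fst z) w)) \<partial>lborel) \<noteq> \<infinity>"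
    using m by (intro nn_integral_PInf_AE) auto
  then show ?thesis
    by eventually_elim (auto intro!: integrableI_bounded simp: norm_mult ennreal_mult' less_top)
qed

lemma AE_integrable_kernel2:
  fixes f :: "complex \<times> complex \<Rightarrow> complex"
  assumes f: "integrable lborel f"
  shows "AE z in lborel. integrable lborel (\<lambda>w. f (fst z, w) * cauchy_kernel (snd z) w)"
  using AE_swap_args[OF AE_integrable_kernel1[OF integrable_swap_args[OF f]]] by (simp add: swap_args_def case_prod_beta')

lemma AE_integrable_kernel12:
  fixes f :: "complex \<times> complex \<Rightarrow> complex"
  assumes f: "integrable lborel f"
  shows "AE z in lborel. integrable lborel (\<lambda>\<zeta>. f \<zeta> * cauchy_kernel (fst z) (fst \<zeta>) * cauchy_kernel (snd z) (snd \<zeta>))"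
proof -
  have [measurable]: "f \<in> borel_measurable borel" using f by auto
  \<comment> \<open>\<open>F\<close> and \<open>G\<close> apply the two partial transforms with
    absolute values inside, so \<open>G z\<close> is the absolute double integral; its total is at
    most \<open>kernel_mass\<close> squared times the L^1 norm of f.\<close>
  define F where "F z = (\<integral>\<^sup>+ w. ennreal (cmod (f (fst z, w))) * ennreal (cmod (cauchy_kernel (snd z) w)) \<partial>lborel)" for z
  have F[measurable]: "F \<in> borel_measurable borel"
    unfolding F_def by measurable
  define G where "G z = (\<integral>\<^sup>+ w. F (w, snd z) * ennreal (cmod (cauchy_kernel (fst z) w)) \<partial>lborel)" for z
  have G[measurable]: "G \<in> borel_measurable borel"
    unfolding G_def by measurable
  have "(\<integral>\<^sup>+ z. G z \<partial>lborel) \<le> ennreal kernel_mass * (\<integral>\<^sup>+ z. F z \<partial>lborel)"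
    unfolding G_def by (rule nn_integral_kernel1) measurable
  also have "\<dots> \<le> ennreal kernel_mass * (ennreal kernel_mass * (\<integral>\<^sup>+ z. ennreal (cmod (f z)) \<partial>lborel))"
    unfolding F_def by (intro mult_left_mono nn_integral_kernel2) auto
  also have "\<dots> < \<infinity>" using f by (auto simp: integrable_iff_bounded ennreal_mult_less_top)
  finally have "AE z in lborel. G z \<noteq> \<infinity>"
    by (intro nn_integral_PInf_AE) auto
  then show ?thesis
  proof eventually_elim
    case (elim z)
    have m: "(\<lambda>\<zeta>. f \<zeta> * cauchy_kernel (fst z) (fst \<zeta>) * cauchy_kernel (snd z) (snd \<zeta>)) \<in> borel_measurable borel"
      by measurable
    have "(\<integral>\<^sup>+ \<zeta>. ennreal (cmod (f \<zeta> * cauchy_kernel (fst z) (fst \<zeta>) * cauchy_kernel (snd z) (snd \<zeta>))) \<partial>lborel)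
      = (\<integral>\<^sup>+ x. \<integral>\<^sup>+ w. ennreal (cmod (f (x, w))) * ennreal (cmod (cauchy_kernel (snd z) w)) * ennreal (cmod (cauchy_kernel (fst z) x)) \<partial>lborel \<partial>lborel)"
      using m by (subst nn_integral_pair(1)) (auto simp: norm_mult ennreal_mult' mult_ac)
    also have "\<dots> = G z"
      unfolding G_def F_def by (simp add: nn_integral_multc)
    finally show ?case using elim m by (intro integrableI_bounded) (auto simp: less_top)
  qed
qed

text \<open>Fubini's theorem at a point of absolute convergence. On integrable functions the partial
  transforms therefore commute almost everywhere.\<close>

lemma cauchy_cauchy_eq:
  fixes f :: "complex \<times> complex \<Rightarrow> complex"
  assumes "integrable lborel (\<lambda>\<zeta>. f \<zeta> * cauchy_kernel (fst z) (fst \<zeta>) * cauchy_kernel (snd z) (snd \<zeta>))"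
  shows "cauchy1 (cauchy2 f) z = (LINT \<zeta>|lborel. f \<zeta> * cauchy_kernel (fst z) (fst \<zeta>) * cauchy_kernel (snd z) (snd \<zeta>))"
    "cauchy2 (cauchy1 f) z = (LINT \<zeta>|lborel. f \<zeta> * cauchy_kernel (fst z) (fst \<zeta>) * cauchy_kernel (snd z) (snd \<zeta>))"
proof -
  obtain x y where z: "z = (x, y)" by force
  have "(LINT \<zeta>|lborel. f \<zeta> * cauchy_kernel (fst z) (fst \<zeta>) * cauchy_kernel (snd z) (snd \<zeta>))
    = (LINT u|lborel. LINT v|lborel. (f (u, v) * cauchy_kernel y v) * cauchy_kernel x u)"
    using integral_pair(1)[OF assms] by (simp add: z mult_ac)
  also have "\<dots> = (LINT u|lborel. (LINT v|lborel. f (u, v) * cauchy_kernel y v) * cauchy_kernel x u)"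
    by (simp only: integral_mult_left_zero)
  finally show "cauchy1 (cauchy2 f) z = (LINT \<zeta>|lborel. f \<zeta> * cauchy_kernel (fst z) (fst \<zeta>) * cauchy_kernel (snd z) (snd \<zeta>))"
    by (simp add: z cauchy1_def cauchy2_def cauchy_def)
  have "(LINT \<zeta>|lborel. f \<zeta> * cauchy_kernel (fst z) (fst \<zeta>) * cauchy_kernel (snd z) (snd \<zeta>))
    = (LINT v|lborel. LINT u|lborel. (f (u, v) * cauchy_kernel x u) * cauchy_kernel y v)"
    using integral_pair(2)[OF assms] by (simp add: z mult_ac)
  also have "\<dots> = (LINT v|lborel. (LINT u|lborel. f (u, v) * cauchy_kernel x u) * cauchy_kernel y v)"
    by (simp only: integral_mult_left_zero)
  finally show "cauchy2 (cauchy1 f) z = (LINT \<zeta>|lborel. f \<zeta> * cauchy_kernel (fst z) (fst \<zeta>) * cauchy_kernel (snd z) (snd \<zeta>))"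
    by (simp add: z cauchy1_def cauchy2_def cauchy_def)
qed

section \<open>Weak derivatives of the partial transforms\<close>

lemma integrable_mult_bounded:
  fixes f c :: "'a \<Rightarrow> complex"
  assumes "integrable M f" "c \<in> borel_measurable M" "\<And>z. cmod (c z) \<le> B"
  shows "integrable M (\<lambda>z. f z * c z)"
proof (rule Bochner_Integration.integrable_bound)
  show "integrable M (\<lambda>z. B *\<^sub>R f z)" using assms by simp
  have "\<bar>B\<bar> \<ge> cmod (c z)" for z using assms(3)[of z] by linarith
  then show "AE z in M. norm (f z * c z) \<le> norm (B *\<^sub>R f z)"
    by (intro AE_I2) (auto simp: norm_mult mult.commute[of "\<bar>B\<bar>"] intro!: mult_left_mono)
qed (use assms in auto)

lemma cauchy_dbar':
  assumes a: "a \<in> test_on U" "U \<subseteq> unit_disc"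
  shows "cauchy (dbar a) w = a w"
proof (cases "w \<in> unit_disc")
  case False
  then show ?thesis using test_on_props(4)[OF a False] by (simp add: cauchy_def cauchy_kernel_def)
qed (rule cauchy_dbar[OF a])

text \<open>For almost every y the transform is moved onto the slice of \<open>d\<close>, where it
  undoes \<open>dbar\<close>. The data are bounds, measurability and slices over a set
  \<open>U\<close>, so that swapped test functions fit as well.\<close>

lemma integral_cauchy1_dbar:
  fixes f \<Phi> d :: "complex \<times> complex \<Rightarrow> complex"
  assumes f: "integrable lborel f" and U: "U \<subseteq> unit_disc"
    and \<Phi>: "\<Phi> \<in> borel_measurable borel" "\<And>z. cmod (\<Phi> z) \<le> B" "\<And>y. (\<lambda>x. \<Phi> (x, y)) \<in> test_on U"
    and d: "d \<in> borel_measurable borel" "\<And>z. cmod (d z) \<le> B'" "\<And>x y. d (x, y) = dbar (\<lambda>x. \<Phi> (x, y)) x"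
  shows "(LINT z|lborel. cauchy1 f z * d z) = - (LINT z|lborel. f z * \<Phi> z)"
proof -
  have [measurable]: "f \<in> borel_measurable borel" "\<Phi> \<in> borel_measurable borel" "d \<in> borel_measurable borel"
    using f \<Phi> d by auto
  have "(LINT z|lborel. cauchy1 f z * d z) = (LINT y|lborel. LINT x|lborel. cauchy (\<lambda>w. f (w, y)) x * d (x, y))"
    using integral_pair(2)[OF integrable_mult_bounded[OF integrable_cauchy1[OF f] _ d(2)]] d(1)
    by (simp add: cauchy1_def)
  also have "\<dots> = (LINT y|lborel. - (LINT x|lborel. f (x, y) * \<Phi> (x, y)))"
  proof (rule integral_cong_AE)
    show "AE y in lborel. (LINT x|lborel. cauchy (\<lambda>w. f (w, y)) x * d (x, y)) = - (LINT x|lborel. f (x, y) * \<Phi> (x, y))"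
      using integral_pair(4)[OF f]
    proof eventually_elim
      case (elim y)
      have "(LINT x|lborel. cauchy (\<lambda>w. f (w, y)) x * d (x, y)) = - (LINT x|lborel. f (x, y) * cauchy (\<lambda>x. d (x, y)) x)"
        using d(2) by (intro integral_cauchy_mult[OF elim]) auto
      also have "cauchy (\<lambda>x. d (x, y)) = (\<lambda>x. \<Phi> (x, y))"
        using cauchy_dbar'[OF \<Phi>(3) U] by (simp add: d(3) fun_eq_iff)
      finally show ?case .
    qed
  next
    show "(\<lambda>y. LINT x|lborel. cauchy (\<lambda>w. f (w, y)) x * d (x, y)) \<in> borel_measurable lborel"
      unfolding cauchy_def by measurable
  qed measurable
  also have "\<dots> = - (LINT z|lborel. f z * \<Phi> z)"
    using integral_pair(2)[OF integrable_mult_bounded[OF f _ \<Phi>(2)]] \<Phi>(1) by simp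
  finally show ?thesis .
qed

text \<open>The pole y is fixed while \<zeta> runs over both variables: the integrability needed to
  use a weak equation on all of C^2 for a single y.\<close>

lemma AE_integrable_cauchy_kernel_slice:
  fixes f :: "complex \<times> complex \<Rightarrow> complex"
  assumes f: "integrable lborel f"
  shows "AE y in lborel. integrable lborel (\<lambda>\<zeta>. f \<zeta> * cauchy_kernel y (snd \<zeta>))"
proof -
  have [measurable]: "f \<in> borel_measurable borel" using f by auto
  have "(\<integral>\<^sup>+ y. \<integral>\<^sup>+ \<zeta>. ennreal (cmod (f \<zeta>)) * ennreal (cmod (cauchy_kernel y (snd \<zeta>))) \<partial>lborel \<partial>lborel)
    = (\<integral>\<^sup>+ \<zeta>. \<integral>\<^sup>+ y. ennreal (cmod (f \<zeta>)) * ennreal (cmod (cauchy_kernel y (snd \<zeta>))) \<partial>lborel \<partial>lborel)"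
    by (rule lborel_pair.Fubini') measurable
  also have "\<dots> = (\<integral>\<^sup>+ \<zeta>. ennreal (cmod (f \<zeta>)) * (\<integral>\<^sup>+ y. ennreal (cmod (cauchy_kernel (snd \<zeta>) y)) \<partial>lborel) \<partial>lborel)"
    by (simp add: nn_integral_cmult norm_cauchy_kernel_swap[of "snd _"])
  also have "\<dots> \<le> (\<integral>\<^sup>+ \<zeta>. ennreal (cmod (f \<zeta>)) * ennreal kernel_mass \<partial>lborel)"
    by (intro nn_integral_mono mult_left_mono kernel_mass(2)) auto
  also have "\<dots> < \<infinity>"
    using f by (auto simp: nn_integral_multc integrable_iff_bounded ennreal_mult_less_top)
  finally have "AE y in lborel. (\<integral>\<^sup>+ \<zeta>. ennreal (cmod (f \<zeta>)) * ennreal (cmod (cauchy_kernel y (snd \<zeta>))) \<partial>lborel) \<noteq> \<infinity>"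
    by (intro nn_integral_PInf_AE) auto
  then show ?thesis
    by eventually_elim (auto intro!: integrableI_bounded simp: norm_mult ennreal_mult' less_top)
qed

text \<open>Fubini's theorem with the pole y outermost. For fixed y, f is paired with a function of
  the first variable times a kernel in the second, the form to which a weak equation applies in the
  limit.\<close>

lemma integral_cauchy2_mult:
  fixes f c :: "complex \<times> complex \<Rightarrow> complex"
  assumes f: "integrable lborel f" and c: "c \<in> borel_measurable borel" "\<And>z. cmod (c z) \<le> B"
  shows "(LINT z|lborel. cauchy2 f z * c z) = (LINT y|lborel. LINT \<zeta>|lborel. f \<zeta> * cauchy_kernel y (snd \<zeta>) * c (fst \<zeta>, y))"
proof -
  have [measurable]: "f \<in> borel_measurable borel" "c \<in> borel_measurable borel"
    using f c by auto
  have "(LINT z|lborel. cauchy2 f z * c z) = (LINT y|lborel. LINT x|lborel. cauchy (\<lambda>w. f (x, w)) y * c (x, y))"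
    using integral_pair(2)[OF integrable_mult_bounded[OF integrable_cauchy2[OF f] _ c(2)]] c(1)
    by (simp add: cauchy2_def)
  also have "\<dots> = (LINT y|lborel. LINT \<zeta>|lborel. f \<zeta> * cauchy_kernel y (snd \<zeta>) * c (fst \<zeta>, y))"
  proof (rule integral_cong_AE)
    show "(\<lambda>y. LINT x|lborel. cauchy (\<lambda>w. f (x, w)) y * c (x, y)) \<in> borel_measurable lborel"
      unfolding cauchy_def by measurable
    show "(\<lambda>y. LINT \<zeta>|lborel. f \<zeta> * cauchy_kernel y (snd \<zeta>) * c (fst \<zeta>, y)) \<in> borel_measurable lborel"
      by measurable
    show "AE y in lborel. (LINT x|lborel. cauchy (\<lambda>w. f (x, w)) y * c (x, y)) = (LINT \<zeta>|lborel. f \<zeta> * cauchy_kernel y (snd \<zeta>) * c (fst \<zeta>, y))"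
      using AE_integrable_cauchy_kernel_slice[OF f]
    proof eventually_elim
      case (elim y)
      have "integrable lborel (\<lambda>\<zeta>. f \<zeta> * cauchy_kernel y (snd \<zeta>) * c (fst \<zeta>, y))"
        using c(2) by (intro integrable_mult_bounded[OF elim, of _ B]) auto
      from integral_pair(1)[OF this] show ?case
        by (simp add: cauchy_def)
    qed
  qed
  finally show ?thesis .
qed

text \<open>Almost every pole y is treated separately: the slice of \<Phi> at height y is the first
  factor of the test function, and the second factor approximates the kernel with pole y. As f and g
  vanish off \<open>V\<close>, only points where the cutoffs tend to 1 matter.\<close>

lemma integral_cauchy2_dbar:
  fixes f g \<Phi> d :: "complex \<times> complex \<Rightarrow> complex"
  assumes f: "integrable lborel f" "\<And>x y. y \<notin> V \<Longrightarrow> f (x, y) = 0"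
    and g: "integrable lborel g" "\<And>x y. y \<notin> V \<Longrightarrow> g (x, y) = 0"
    and V: "V \<subseteq> unit_disc" "has_cutoffs V"
    and weak: "\<And>a b. a \<in> test_on U \<Longrightarrow> b \<in> test_on V \<Longrightarrow>
      (LINT z|lborel. f z * (dbar a (fst z) * b (snd z))) = - (LINT z|lborel. g z * (a (fst z) * b (snd z)))"
    and \<Phi>: "\<Phi> \<in> borel_measurable borel" "\<And>z. cmod (\<Phi> z) \<le> B" "\<And>y. (\<lambda>x. \<Phi> (x, y)) \<in> test_on U"
    and d: "d \<in> borel_measurable borel" "\<And>z. cmod (d z) \<le> B'" "\<And>x y. d (x, y) = dbar (\<lambda>x. \<Phi> (x, y)) x"
  shows "(LINT z|lborel. cauchy2 f z * d z) = - (LINT z|lborel. cauchy2 g z * \<Phi> z)"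
proof -
  have [measurable]: "f \<in> borel_measurable borel" "g \<in> borel_measurable borel"
    "\<Phi> \<in> borel_measurable borel" "d \<in> borel_measurable borel"
    using f g \<Phi> d by auto
  obtain c where c: "\<And>n. c n \<in> test_on V" "\<And>n z. cmod (c n z) \<le> 1" "\<And>z. z \<in> V \<Longrightarrow> (\<lambda>n. c n z) \<longlonglongrightarrow> 1"
    using V(2) unfolding has_cutoffs_def by metis
  \<comment> \<open>The factor -1/pi is the normalisation of \<open>cauchy_kernel\<close>;
    \<open>Suc n\<close> keeps the smoothing parameter positive.\<close>
  define b where "b y n w = c n w * (- 1 / pi * reg_kernel (1 / real (Suc n)) y w)" for y n w
  have b_test: "b y n \<in> test_on V" for y n
    unfolding b_def by (intro test_on_mult c Ck_mult Ck_const Ck_reg_kernel) simp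
  have [measurable]: "b y n \<in> borel_measurable borel" for y n
    using test_on_props(1)[OF b_test V(1), of 0] by (auto intro: borel_measurable_continuous_onI)
  \<comment> \<open>Cutoff and smoothing can only lower the modulus, so the kernel itself is the
    majorant.\<close>
  have b_le: "cmod (b y n w) \<le> cmod (cauchy_kernel y w)" if "w \<in> V" "y \<in> unit_disc" for y n w
  proof -
    have "cmod (b y n w) \<le> 1 * (1 / pi * (1 / cmod (w - y)))"
      unfolding b_def norm_mult by (intro mult_mono c norm_reg_kernel_le) (auto simp: norm_divide)
    also have "\<dots> = cmod (cauchy_kernel y w)"
      using that V(1) by (auto simp: cauchy_kernel_def norm_divide norm_mult)
    finally show ?thesis .
  qed
  have b_lim: "(\<lambda>n. b y n w) \<longlonglongrightarrow> cauchy_kernel y w" if "w \<in> V" "y \<in> unit_disc" for y w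
  proof -
    have "(\<lambda>n. 1 / real (Suc n)) \<longlonglongrightarrow> 0" by real_asymp
    then have "(\<lambda>n. b y n w) \<longlonglongrightarrow> 1 * (- 1 / pi * (1 / (w - y)))"
      unfolding b_def by (intro tendsto_mult c(3) that tendsto_const reg_kernel_tendsto)
    then show ?thesis using that V(1) by (auto simp: cauchy_kernel_def)
  qed
  \<comment> \<open>General \<open>h\<close> and \<open>k\<close>, since the limit is taken for f
    with a slice of \<open>d\<close> and for g with a slice of \<Phi>.\<close>
  have lim: "(\<lambda>n. LINT \<zeta>|lborel. h \<zeta> * (k (fst \<zeta>) * b y n (snd \<zeta>))) \<longlonglongrightarrow> (LINT \<zeta>|lborel. h \<zeta> * cauchy_kernel y (snd \<zeta>) * k (fst \<zeta>))"
    if h: "integrable lborel (\<lambda>\<zeta>. h \<zeta> * cauchy_kernel y (snd \<zeta>))" "\<And>x y. y \<notin> V \<Longrightarrow> h (x, y) = 0"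
      and hm[measurable]: "h \<in> borel_measurable borel" and y: "y \<in> unit_disc"
      and k: "k \<in> borel_measurable borel" "\<And>x. cmod (k x) \<le> B0" for h y B0 and k :: "complex \<Rightarrow> complex"
  proof (rule integral_dominated_convergence)
    note k(1)[measurable]
    show "(\<lambda>\<zeta>. h \<zeta> * (k (fst \<zeta>) * b y n (snd \<zeta>))) \<in> borel_measurable lborel" for n
      by measurable
    show "(\<lambda>\<zeta>. h \<zeta> * cauchy_kernel y (snd \<zeta>) * k (fst \<zeta>)) \<in> borel_measurable lborel"
      by measurable
    show "integrable lborel (\<lambda>\<zeta>. B0 * cmod (h \<zeta> * cauchy_kernel y (snd \<zeta>)))"
      using h(1) by (intro integrable_mult_right integrable_norm)
    show "AE \<zeta> in lborel. (\<lambda>n. h \<zeta> * (k (fst \<zeta>) * b y n (snd \<zeta>))) \<longlonglongrightarrow> h \<zeta> * cauchy_kernel y (snd \<zeta>) * k (fst \<zeta>)"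
    proof (rule AE_I2)
      fix \<zeta> :: "complex \<times> complex"
      show "(\<lambda>n. h \<zeta> * (k (fst \<zeta>) * b y n (snd \<zeta>))) \<longlonglongrightarrow> h \<zeta> * cauchy_kernel y (snd \<zeta>) * k (fst \<zeta>)"
      proof (cases "snd \<zeta> \<in> V")
        case True
        have "(\<lambda>n. h \<zeta> * (k (fst \<zeta>) * b y n (snd \<zeta>))) \<longlonglongrightarrow> h \<zeta> * (k (fst \<zeta>) * cauchy_kernel y (snd \<zeta>))"
          by (intro tendsto_intros b_lim True y)
        then show ?thesis by (simp add: mult_ac)
      qed (use h(2)[of "snd \<zeta>" "fst \<zeta>"] in simp)
    qed
    show "AE \<zeta> in lborel. cmod (h \<zeta> * (k (fst \<zeta>) * b y n (snd \<zeta>))) \<le> B0 * cmod (h \<zeta> * cauchy_kernel y (snd \<zeta>))" for n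
    proof (rule AE_I2)
      fix \<zeta> :: "complex \<times> complex"
      show "cmod (h \<zeta> * (k (fst \<zeta>) * b y n (snd \<zeta>))) \<le> B0 * cmod (h \<zeta> * cauchy_kernel y (snd \<zeta>))"
      proof (cases "snd \<zeta> \<in> V")
        case True
        have "B0 \<ge> 0" using k(2) norm_ge_zero order.trans by blast
        then have "cmod (k (fst \<zeta>)) * cmod (b y n (snd \<zeta>)) \<le> B0 * cmod (cauchy_kernel y (snd \<zeta>))"
          by (intro mult_mono k b_le True y) auto
        from mult_left_mono[OF this norm_ge_zero[of "h \<zeta>"]] show ?thesis
          by (simp add: norm_mult mult_ac)
      qed (use h(2)[of "snd \<zeta>" "fst \<zeta>"] in simp)
    qed
  qed
  have slice: "(LINT \<zeta>|lborel. f \<zeta> * cauchy_kernel y (snd \<zeta>) * d (fst \<zeta>, y)) = - (LINT \<zeta>|lborel. g \<zeta> * cauchy_kernel y (snd \<zeta>) * \<Phi> (fst \<zeta>, y))"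
    if fy: "integrable lborel (\<lambda>\<zeta>. f \<zeta> * cauchy_kernel y (snd \<zeta>))" and gy: "integrable lborel (\<lambda>\<zeta>. g \<zeta> * cauchy_kernel y (snd \<zeta>))" for y
  proof (cases "y \<in> unit_disc")
    case True
    \<comment> \<open>Here y is a mere parameter: it selects the slice of \<Phi> and the pole of
      \<open>b\<close>, while the weak equation integrates over \<zeta>.\<close>
    have "(LINT \<zeta>|lborel. f \<zeta> * (d (fst \<zeta>, y) * b y n (snd \<zeta>))) = - (LINT \<zeta>|lborel. g \<zeta> * (\<Phi> (fst \<zeta>, y) * b y n (snd \<zeta>)))" for n
      using weak[OF \<Phi>(3)[of y] b_test[of y n]] by (simp add: d(3))
    with tendsto_minus[OF lim[OF gy g(2) _ True, of "\<lambda>x. \<Phi> (x, y)" B]] \<Phi>(2)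
    have "(\<lambda>n. LINT \<zeta>|lborel. f \<zeta> * (d (fst \<zeta>, y) * b y n (snd \<zeta>))) \<longlonglongrightarrow> - (LINT \<zeta>|lborel. g \<zeta> * cauchy_kernel y (snd \<zeta>) * \<Phi> (fst \<zeta>, y))"
      by simp
    moreover have "(\<lambda>n. LINT \<zeta>|lborel. f \<zeta> * (d (fst \<zeta>, y) * b y n (snd \<zeta>))) \<longlonglongrightarrow> (LINT \<zeta>|lborel. f \<zeta> * cauchy_kernel y (snd \<zeta>) * d (fst \<zeta>, y))"
      using lim[OF fy f(2) _ True, of "\<lambda>x. d (x, y)" B'] d(2) by simp
    ultimately show ?thesis by (rule LIMSEQ_unique[rotated])
  qed (simp add: cauchy_kernel_def)
  have "(LINT z|lborel. cauchy2 f z * d z) = (LINT y|lborel. LINT \<zeta>|lborel. f \<zeta> * cauchy_kernel y (snd \<zeta>) * d (fst \<zeta>, y))"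
    by (rule integral_cauchy2_mult[OF f(1) d(1,2)])
  also have "\<dots> = (LINT y|lborel. - (LINT \<zeta>|lborel. g \<zeta> * cauchy_kernel y (snd \<zeta>) * \<Phi> (fst \<zeta>, y)))"
  proof (rule integral_cong_AE)
    show "(\<lambda>y. LINT \<zeta>|lborel. f \<zeta> * cauchy_kernel y (snd \<zeta>) * d (fst \<zeta>, y)) \<in> borel_measurable lborel"
      by measurable
    show "(\<lambda>y. - (LINT \<zeta>|lborel. g \<zeta> * cauchy_kernel y (snd \<zeta>) * \<Phi> (fst \<zeta>, y))) \<in> borel_measurable lborel"
      by measurable
    show "AE y in lborel. (LINT \<zeta>|lborel. f \<zeta> * cauchy_kernel y (snd \<zeta>) * d (fst \<zeta>, y)) = - (LINT \<zeta>|lborel. g \<zeta> * cauchy_kernel y (snd \<zeta>) * \<Phi> (fst \<zeta>, y))"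
      using AE_integrable_cauchy_kernel_slice[OF f(1)] AE_integrable_cauchy_kernel_slice[OF g(1)]
      by eventually_elim (rule slice)
  qed
  also have "\<dots> = - (LINT z|lborel. cauchy2 g z * \<Phi> z)"
    using integral_cauchy2_mult[OF g(1) \<Phi>(1,2)] by simp
  finally show ?thesis .
qed

section \<open>Borel representatives\<close>

lemma Omega_borel [measurable]: "Omega \<in> sets borel"
proof -
  have "Omega \<in> sets (borel \<Otimes>\<^sub>M borel)" unfolding Omega_def by measurable
  then show ?thesis unfolding borel_prod .
qed

lemma AE_lebesgue_on_iff:
  assumes "S \<in> sets borel"
  shows "(AE x in lebesgue_on S. P x) \<longleftrightarrow> (AE x in lborel. x \<in> S \<longrightarrow> P x)"
  using assms by (subst AE_restrict_space_iff) (auto simp: AE_completion_iff)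

text \<open>The bridge from restricted Lebesgue measure to \<open>lborel\<close>, where Tonelli's
  and Fubini's theorems are available: extend by zero from a Borel set and change the function on a
  null set.\<close>

lemma lebesgue_on_borel_representative:
  fixes h H :: "'a::euclidean_space \<Rightarrow> 'b::euclidean_space"
  assumes S: "S \<in> sets borel" and H: "H \<in> borel_measurable borel" "\<And>x. x \<notin> S \<Longrightarrow> H x = 0"
    and ae: "AE x in lborel. x \<in> S \<longrightarrow> h x = H x"
  shows "h \<in> borel_measurable (lebesgue_on S)"
    "integrable (lebesgue_on S) h \<longleftrightarrow> integrable lborel H"
    "(LINT x|lebesgue_on S. h x) = (LINT x|lborel. H x)"
proof -
  let ?h = "\<lambda>x. if x \<in> S then h x else 0"
  have SL: "S \<in> sets lebesgue" using S by simp
  have HL: "H \<in> borel_measurable lebesgue" using H by (simp add: measurable_completion)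
  have eq: "AE x in lebesgue. H x = ?h x"
    using ae H(2) by (intro AE_completion) (auto elim!: eventually_mono)
  have hL: "?h \<in> borel_measurable lebesgue" by (rule borel_measurable_AE[OF HL eq])
  then show "h \<in> borel_measurable (lebesgue_on S)" using SL by (simp add: borel_measurable_if)
  have ind: "(\<lambda>x. indicator S x *\<^sub>R h x) = ?h" by (auto simp: indicator_def)
  have "integrable (lebesgue_on S) h \<longleftrightarrow> integrable lebesgue ?h"
    using SL by (simp add: integrable_restrict_space ind)
  also have "\<dots> \<longleftrightarrow> integrable lebesgue H"
    using hL HL eq by (intro integrable_cong_AE) (auto elim!: eventually_mono)
  also have "\<dots> \<longleftrightarrow> integrable lborel H" using H(1) by (simp add: integrable_completion)
  finally show "integrable (lebesgue_on S) h \<longleftrightarrow> integrable lborel H" .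
  have "(LINT x|lebesgue_on S. h x) = (LINT x|lebesgue. ?h x)"
    using SL by (simp add: integral_restrict_space ind)
  also have "\<dots> = (LINT x|lebesgue. H x)"
    using hL HL eq by (intro integral_cong_AE) (auto elim!: eventually_mono)
  also have "\<dots> = (LINT x|lborel. H x)" using H(1) by (simp add: integral_completion)
  finally show "(LINT x|lebesgue_on S. h x) = (LINT x|lborel. H x)" .
qed

definition borel_repr :: "(complex \<times> complex \<Rightarrow> complex) \<Rightarrow> (complex \<times> complex \<Rightarrow> complex) \<Rightarrow> bool" where
  "borel_repr f F \<longleftrightarrow> F \<in> borel_measurable borel \<and> (\<forall>z. z \<notin> Omega \<longrightarrow> F z = 0) \<and>
     (AE z in lborel. z \<in> Omega \<longrightarrow> f z = F z)"

lemma ex_borel_repr: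
  assumes f: "f \<in> borel_measurable (lebesgue_on Omega)"
  shows "\<exists>F. borel_repr f F"
proof -
  let ?f = "\<lambda>z. if z \<in> Omega then f z else 0"
  have "?f \<in> borel_measurable lebesgue" using f by (simp add: borel_measurable_if)
  then have "(\<lambda>z. Re (?f z)) \<in> borel_measurable lebesgue" "(\<lambda>z. Im (?f z)) \<in> borel_measurable lebesgue"
    by (auto intro: measurable_compose borel_measurable_Re borel_measurable_Im simp del: Re_complex_of_real)
  then obtain R I where R: "R \<in> borel_measurable lborel" "AE z in lborel. Re (?f z) = R z"
    and I: "I \<in> borel_measurable lborel" "AE z in lborel. Im (?f z) = I z"
    by (blast dest: completion_ex_borel_measurable_real)
  note [measurable] = R(1) I(1)
  let ?F = "\<lambda>z. if z \<in> Omega then of_real (R z) + \<i> * of_real (I z) else 0"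
  have "?F \<in> borel_measurable borel" by measurable
  moreover have "AE z in lborel. z \<in> Omega \<longrightarrow> f z = ?F z"
    using R(2) I(2) by eventually_elim (auto simp: complex_eq_iff)
  ultimately show ?thesis unfolding borel_repr_def by (intro exI[of _ ?F]) auto
qed

lemma borel_repr_measurable: "borel_repr f F \<Longrightarrow> F \<in> borel_measurable borel"
  and borel_repr_zero: "borel_repr f F \<Longrightarrow> z \<notin> Omega \<Longrightarrow> F z = 0"
  and borel_repr_AE: "borel_repr f F \<Longrightarrow> AE z in lborel. z \<in> Omega \<longrightarrow> f z = F z"
  unfolding borel_repr_def by blast+

lemma borel_repr_cong:
  assumes "AE z in lebesgue_on Omega. f' z = f z" "borel_repr f F"
  shows "borel_repr f' F"
proof -
  have "AE z in lborel. z \<in> Omega \<longrightarrow> f' z = f z" using assms(1) by (simp add: AE_lebesgue_on_iff)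
  with borel_repr_AE[OF assms(2)] have "AE z in lborel. z \<in> Omega \<longrightarrow> f' z = F z"
    by eventually_elim auto
  then show ?thesis using assms(2) by (simp add: borel_repr_def)
qed

lemma distr_of_borel_repr:
  assumes f: "borel_repr f F" and \<psi>: "\<psi> \<in> borel_measurable borel"
  shows "distr_of f \<psi> = (LINT z|lborel. F z * \<psi> z)"
  unfolding distr_of_def
proof (rule lebesgue_on_borel_representative(3))
  show "AE z in lborel. z \<in> Omega \<longrightarrow> f z * \<psi> z = F z * \<psi> z"
    using borel_repr_AE[OF f] by eventually_elim auto
  show "(\<lambda>z. F z * \<psi> z) \<in> borel_measurable borel"
    using borel_repr_measurable[OF f] \<psi> by simp
qed (auto simp: borel_repr_zero[OF f])

lemma Lp_borel_repr:
  assumes f: "borel_repr f F"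
  shows "f \<in> Lp p \<longleftrightarrow> integrable lborel (\<lambda>z. cmod (F z) powr p)"
    "Lp_norm p f = (LINT z|lborel. cmod (F z) powr p) powr (1 / p)"
proof -
  have 1: "(\<lambda>z. cmod (F z) powr p) \<in> borel_measurable borel" using borel_repr_measurable[OF f] by simp
  have 2: "AE z in lborel. z \<in> Omega \<longrightarrow> cmod (f z) powr p = cmod (F z) powr p"
    using borel_repr_AE[OF f] by eventually_elim auto
  have 3: "cmod (F z) powr p = 0" if "z \<notin> Omega" for z using borel_repr_zero[OF f that] by simp
  show "Lp_norm p f = (LINT z|lborel. cmod (F z) powr p) powr (1 / p)"
    unfolding Lp_norm_def using lebesgue_on_borel_representative(3)[OF Omega_borel 1 3 2] by simp
  have "f \<in> borel_measurable (lebesgue_on Omega)"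
    by (rule lebesgue_on_borel_representative(1)[OF Omega_borel borel_repr_measurable[OF f] borel_repr_zero[OF f] borel_repr_AE[OF f]])
  then show "f \<in> Lp p \<longleftrightarrow> integrable lborel (\<lambda>z. cmod (F z) powr p)"
    unfolding Lp_def using lebesgue_on_borel_representative(2)[OF Omega_borel 1 3 2] by simp
qed

lemma Omega_subset: "Omega \<subseteq> unit_disc \<times> unit_disc"
  by (auto simp: Omega_def unit_disc_def punctured_disc_def)

lemma emeasure_Omega_finite: "emeasure lborel Omega < \<infinity>"
proof (rule emeasure_bounded_finite)
  have "bounded (unit_disc \<times> unit_disc)"
    unfolding unit_disc_def by (intro bounded_Times boundedI[where B=1]) auto
  then show "bounded Omega" using Omega_subset bounded_subset by blast
qed

text \<open>\<open>Omega\<close> has finite measure, so t \<le> 1 + t^p turns p-integrability into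
  integrability.\<close>

lemma integrable_borel_repr:
  assumes f: "borel_repr f F" and Lp: "f \<in> Lp p" and p: "p \<ge> 1"
  shows "integrable lborel F"
proof (rule Bochner_Integration.integrable_bound)
  show "integrable lborel (\<lambda>z. indicator Omega z + cmod (F z) powr p)"
    using Lp emeasure_Omega_finite by (intro Bochner_Integration.integrable_add) (auto simp: Lp_borel_repr[OF f])
  show "F \<in> borel_measurable lborel" using borel_repr_measurable[OF f] by simp
  have "t \<le> 1 + t powr p" if "t \<ge> 0" for t :: real
  proof (cases "t \<le> 1")
    case False
    then have "t powr 1 \<le> t powr p" using p by (intro powr_mono) auto
    then show ?thesis using False by simp
  qed (simp add: add_increasing2)
  then show "AE z in lborel. norm (F z) \<le> norm (indicator Omega z + cmod (F z) powr p)"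
    using borel_repr_zero[OF f] by (intro AE_I2) (auto simp: indicator_def)
qed

text \<open>Being represented by a function depends on the coefficients only through integrals,
  which see only the Borel representatives. The two choices are thus made from the same predicate,
  and the results are equal as functions, not just almost everywhere.\<close>

lemma scrD_cong:
  assumes "borel_repr f1 F1" "borel_repr f2 F2" "borel_repr f1' F1" "borel_repr f2' F2"
  shows "scrD f1' f2' = scrD f1 f2"
proof -
  have m: "dbar1 \<phi> \<in> borel_measurable borel" "dbar2 \<phi> \<in> borel_measurable borel" if "\<phi> \<in> test_functions" for \<phi>
  proof -
    have "Ck 1 \<phi>" using that by (simp add: test_functions_def del: Ck.simps)
    then have "continuous_on UNIV (dbar1 \<phi>)" "continuous_on UNIV (dbar2 \<phi>)"
      unfolding dbar1_def[abs_def] dbar2_def[abs_def] by (auto intro!: continuous_intros)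
    then show "dbar1 \<phi> \<in> borel_measurable borel" "dbar2 \<phi> \<in> borel_measurable borel"
      by (auto intro: borel_measurable_continuous_onI)
  qed
  have "scrD_distr f1' f2' \<phi> = scrD_distr f1 f2 \<phi>" if "\<phi> \<in> test_functions" for \<phi>
    unfolding scrD_distr_def distr_dbar1_def distr_dbar2_def
    using m[OF that] by (simp add: assms[THEN distr_of_borel_repr])
  then have "represents_scrD f1' f2' = represents_scrD f1 f2"
    unfolding represents_scrD_def distr_eq_def by auto
  then show ?thesis by (simp add: scrD_def)
qed

text \<open>The constants of \<open>T_op\<close> are absorbed into \<open>cauchy_kernel\<close>;
  only the sign of the double transform remains.\<close>

definition T_borel_repr ::
  "(complex \<times> complex \<Rightarrow> complex) \<Rightarrow> (complex \<times> complex \<Rightarrow> complex) \<Rightarrow>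
   (complex \<times> complex \<Rightarrow> complex) \<Rightarrow> complex \<times> complex \<Rightarrow> complex" where
  "T_borel_repr F1 F2 G z = cauchy2 F2 z + cauchy1 F1 z - cauchy1 (cauchy2 G) z"

section \<open>Almost everywhere equality along slices\<close>

lemma AE_fst_snd:
  assumes "AE x in (lborel :: complex measure). P x"
  shows "AE z in (lborel :: (complex \<times> complex) measure). P (fst z)"
    "AE z in (lborel :: (complex \<times> complex) measure). P (snd z)"
proof -
  obtain N where "N \<in> null_sets lborel" "{x \<in> space lborel. \<not> P x} \<subseteq> N"
    using assms unfolding eventually_ae_filter by blast
  then have N: "N \<in> sets lborel" "emeasure lborel N = 0" "\<And>x. \<not> P x \<Longrightarrow> x \<in> N" by auto
  have "N \<times> UNIV \<in> null_sets (lborel \<Otimes>\<^sub>M lborel :: (complex \<times> complex) measure)"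
    using N by (auto simp: null_sets_def lborel.emeasure_pair_measure_Times)
  then have "N \<times> UNIV \<in> null_sets (lborel :: (complex \<times> complex) measure)" by (simp add: lborel_prod)
  then show 1: "AE z in (lborel :: (complex \<times> complex) measure). P (fst z)"
    by (rule AE_I') (use N(3) in auto)
  show "AE z in (lborel :: (complex \<times> complex) measure). P (snd z)"
    using AE_swap_args[OF 1] by (simp add: swap_args_def case_prod_beta')
qed

lemma AE_slices:
  assumes "AE z in (lborel :: (complex \<times> complex) measure). P z"
  shows "AE x in lborel. AE y in lborel. P (x, y)" "AE y in lborel. AE x in lborel. P (x, y)"
proof -
  have *: "AE x in lborel. AE y in lborel. P (x, y)" if "AE z in (lborel :: (complex \<times> complex) measure). P z" for P
    using that unfolding lborel_prod[symmetric] by (rule lborel_pair.AE_pair)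
  show "AE x in lborel. AE y in lborel. P (x, y)" by (rule *[OF assms])
  show "AE y in lborel. AE x in lborel. P (x, y)" using *[OF AE_swap_args[OF assms]] by simp
qed

text \<open>The single integrals run along slices, which are null sets in C^2. Equality with the
  representatives has to be passed to almost every slice before those integrals can be
  compared.\<close>

lemma T_op_AE:
  assumes f1: "borel_repr f1 F1" "integrable lborel F1" and f2: "borel_repr f2 F2" "integrable lborel F2"
    and g: "borel_repr (scrD f1 f2) G" "integrable lborel G"
  shows "AE z in lborel. z \<in> Omega \<longrightarrow> T_op f1 f2 z = T_borel_repr F1 F2 G z \<and>
      integrable (lebesgue_on punctured_disc) (\<lambda>\<zeta>2. f2 (fst z, \<zeta>2) / (\<zeta>2 - snd z)) \<and>
      integrable (lebesgue_on unit_disc) (\<lambda>\<zeta>1. f1 (\<zeta>1, snd z) / (\<zeta>1 - fst z)) \<and>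
      integrable (lebesgue_on Omega)
        (\<lambda>(\<zeta>1, \<zeta>2). scrD f1 f2 (\<zeta>1, \<zeta>2) / ((\<zeta>1 - fst z) * (\<zeta>2 - snd z)))"
  using AE_fst_snd(1)[OF AE_slices(1)[OF borel_repr_AE[OF f2(1)]]]
    AE_fst_snd(2)[OF AE_slices(2)[OF borel_repr_AE[OF f1(1)]]]
    AE_integrable_kernel1[OF f1(2)] AE_integrable_kernel2[OF f2(2)] AE_integrable_kernel12[OF g(2)]
proof eventually_elim
  case (elim z)
  obtain x y where z: "z = (x, y)" by force
  note [measurable] = borel_repr_measurable[OF f1(1)] borel_repr_measurable[OF f2(1)] borel_repr_measurable[OF g(1)]
  let ?h2 = "\<lambda>w. F2 (x, w) / (w - y)" and ?h1 = "\<lambda>w. F1 (w, y) / (w - x)"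
  let ?h = "\<lambda>\<zeta>. G \<zeta> / ((fst \<zeta> - x) * (snd \<zeta> - y))"
  show ?case
  proof
    assume "z \<in> Omega"
    then have xy: "x \<in> unit_disc" "y \<in> punctured_disc" "y \<in> unit_disc"
      using Omega_subset by (auto simp: z Omega_def)
    \<comment> \<open>The truncation is invisible because \<open>F2\<close> vanishes off the
      disc.\<close>
    have e2: "?h2 = (\<lambda>w. - pi * (F2 (x, w) * cauchy_kernel y w))"
    proof
      fix w show "?h2 w = - pi * (F2 (x, w) * cauchy_kernel y w)"
        using xy borel_repr_zero[OF f2(1), of "(x, w)"] Omega_subset
        by (cases "w \<in> unit_disc") (auto simp: cauchy_kernel_def Omega_def unit_disc_def punctured_disc_def)
    qed
    have e1: "?h1 = (\<lambda>w. - pi * (F1 (w, y) * cauchy_kernel x w))"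
    proof
      fix w show "?h1 w = - pi * (F1 (w, y) * cauchy_kernel x w)"
        using xy borel_repr_zero[OF f1(1), of "(w, y)"]
        by (cases "w \<in> unit_disc") (auto simp: cauchy_kernel_def Omega_def)
    qed
    have e: "?h = (\<lambda>\<zeta>. pi\<^sup>2 * (G \<zeta> * cauchy_kernel x (fst \<zeta>) * cauchy_kernel y (snd \<zeta>)))"
    proof
      fix \<zeta> show "?h \<zeta> = pi\<^sup>2 * (G \<zeta> * cauchy_kernel x (fst \<zeta>) * cauchy_kernel y (snd \<zeta>))"
        using xy borel_repr_zero[OF g(1), of \<zeta>] Omega_subset
        by (cases "\<zeta> \<in> Omega") (auto simp: cauchy_kernel_def power2_eq_square)
    qed
    have z2: "?h2 w = 0" if "w \<notin> punctured_disc" for w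
      using that borel_repr_zero[OF f2(1), of "(x, w)"] by (simp add: Omega_def)
    have a2: "AE w in lborel. w \<in> punctured_disc \<longrightarrow> f2 (x, w) / (w - y) = ?h2 w"
      using elim(1) xy by (auto simp: z Omega_def elim!: eventually_mono)
    have m2: "?h2 \<in> borel_measurable borel" by measurable
    note r2 = lebesgue_on_borel_representative[OF punctured_disc_borel m2 z2 a2]
    have i2: "integrable lborel ?h2" unfolding e2 using elim(4) by (intro integrable_mult_right) (simp add: z)
    have z1: "?h1 w = 0" if "w \<notin> unit_disc" for w
      using that borel_repr_zero[OF f1(1), of "(w, y)"] by (simp add: Omega_def)
    have a1: "AE w in lborel. w \<in> unit_disc \<longrightarrow> f1 (w, y) / (w - x) = ?h1 w"
      using elim(2) xy by (auto simp: z Omega_def elim!: eventually_mono)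
    have m1: "?h1 \<in> borel_measurable borel" by measurable
    note r1 = lebesgue_on_borel_representative[OF unit_disc_borel m1 z1 a1]
    have i1: "integrable lborel ?h1" unfolding e1 using elim(3) by (intro integrable_mult_right) (simp add: z)
    have z0: "?h \<zeta> = 0" if "\<zeta> \<notin> Omega" for \<zeta>
      using that borel_repr_zero[OF g(1)] by simp
    have a0: "AE \<zeta> in lborel. \<zeta> \<in> Omega \<longrightarrow> (case \<zeta> of (\<zeta>1, \<zeta>2) \<Rightarrow> scrD f1 f2 (\<zeta>1, \<zeta>2) / ((\<zeta>1 - x) * (\<zeta>2 - y))) = ?h \<zeta>"
      using borel_repr_AE[OF g(1)] by eventually_elim auto
    have m0: "?h \<in> borel_measurable borel" by measurable
    note r0 = lebesgue_on_borel_representative[OF Omega_borel m0 z0 a0]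
    have i0: "integrable lborel ?h" unfolding e using elim(5) by (intro integrable_mult_right) (simp add: z)
    \<comment> \<open>Each single kernel contributes a factor -pi. In the double integral two of
      them multiply to pi^2, so the minus sign of its prefactor survives.\<close>
    have "T_op f1 f2 z = (- 1) / (2 * pi * \<i>) * (2 * \<i> * (- pi * cauchy2 F2 z))
      + (- 1) / (2 * pi * \<i>) * (2 * \<i> * (- pi * cauchy1 F1 z))
      + (- 1) / (2 * pi * \<i>)\<^sup>2 * ((2 * \<i>)\<^sup>2 * (pi\<^sup>2 * cauchy1 (cauchy2 G) z))"
    proof -
      have "(LINT w|lborel. ?h2 w) = - pi * cauchy2 F2 z" "(LINT w|lborel. ?h1 w) = - pi * cauchy1 F1 z"
        unfolding e1 e2 by (simp_all only: integral_mult_right_zero z cauchy1_def cauchy2_def cauchy_def case_prod_conv)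
      moreover have "(LINT \<zeta>|lborel. ?h \<zeta>) = pi\<^sup>2 * cauchy1 (cauchy2 G) z"
        unfolding e using cauchy_cauchy_eq(1)[OF elim(5)] by (simp only: integral_mult_right_zero z fst_conv snd_conv)
      moreover have "(LINT w|lebesgue_on punctured_disc. f2 (x, w) / (w - y)) = (LINT w|lborel. ?h2 w)"
        "(LINT w|lebesgue_on unit_disc. f1 (w, y) / (w - x)) = (LINT w|lborel. ?h1 w)"
        "(LINT (\<zeta>1, \<zeta>2)|lebesgue_on Omega. scrD f1 f2 (\<zeta>1, \<zeta>2) / ((\<zeta>1 - x) * (\<zeta>2 - y))) = (LINT \<zeta>|lborel. ?h \<zeta>)"
        by (rule r2(3) r1(3) r0(3); assumption)+
      ultimately show ?thesis
        unfolding T_op_def z case_prod_conv by (simp only: z)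
    qed
    also have "\<dots> = T_borel_repr F1 F2 G z"
      by (simp add: T_borel_repr_def power2_eq_square)
    finally show "T_op f1 f2 z = T_borel_repr F1 F2 G z \<and>
      integrable (lebesgue_on punctured_disc) (\<lambda>\<zeta>2. f2 (fst z, \<zeta>2) / (\<zeta>2 - snd z)) \<and>
      integrable (lebesgue_on unit_disc) (\<lambda>\<zeta>1. f1 (\<zeta>1, snd z) / (\<zeta>1 - fst z)) \<and>
      integrable (lebesgue_on Omega)
        (\<lambda>(\<zeta>1, \<zeta>2). scrD f1 f2 (\<zeta>1, \<zeta>2) / ((\<zeta>1 - fst z) * (\<zeta>2 - snd z)))"
      using r0(2) r1(2) r2(2) i0 i1 i2 by (simp add: z)
  qed
qed

section \<open>The weak solution and its norm\<close>

lemma frechet_derivative_slice: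
  fixes \<phi> :: "complex \<times> complex \<Rightarrow> complex"
  assumes "\<phi> differentiable (at (x, y))"
  shows "frechet_derivative (\<lambda>x. \<phi> (x, y)) (at x) v = frechet_derivative \<phi> (at (x, y)) (v, 0)"
    "frechet_derivative (\<lambda>y. \<phi> (x, y)) (at y) v = frechet_derivative \<phi> (at (x, y)) (0, v)"
proof -
  note D = assms[unfolded frechet_derivative_works]
  have "((\<lambda>x. (x, y)) has_derivative (\<lambda>v. (v, 0))) (at x)"
    by (auto intro!: derivative_eq_intros)
  from frechet_derivative_at[OF diff_chain_at[OF this D]]
  show "frechet_derivative (\<lambda>x. \<phi> (x, y)) (at x) v = frechet_derivative \<phi> (at (x, y)) (v, 0)"
    by (simp add: o_def fun_eq_iff)
  have "((\<lambda>y. (x, y)) has_derivative (\<lambda>v. (0, v))) (at y)"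
    by (auto intro!: derivative_eq_intros)
  from frechet_derivative_at[OF diff_chain_at[OF this D]]
  show "frechet_derivative (\<lambda>y. \<phi> (x, y)) (at y) v = frechet_derivative \<phi> (at (x, y)) (0, v)"
    by (simp add: o_def fun_eq_iff)
qed

lemma test_functions_props:
  assumes "\<phi> \<in> test_functions"
  shows "\<phi> \<in> borel_measurable borel" "dbar1 \<phi> \<in> borel_measurable borel" "dbar2 \<phi> \<in> borel_measurable borel"
    "\<exists>B. (\<forall>z. cmod (\<phi> z) \<le> B) \<and> (\<forall>z. cmod (dbar1 \<phi> z) \<le> B) \<and> (\<forall>z. cmod (dbar2 \<phi> z) \<le> B)"
    "z \<notin> Omega \<Longrightarrow> \<phi> z = 0" "z \<notin> Omega \<Longrightarrow> dbar1 \<phi> z = 0" "z \<notin> Omega \<Longrightarrow> dbar2 \<phi> z = 0"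
    "dbar1 \<phi> (x, y) = dbar (\<lambda>x. \<phi> (x, y)) x" "dbar2 \<phi> (x, y) = dbar (\<lambda>y. \<phi> (x, y)) y"
proof -
  let ?K = "closure {z. \<phi> z \<noteq> 0}"
  have K: "compact ?K" "?K \<subseteq> Omega" and s: "\<And>k. Ck k \<phi>" using assms by (auto simp: test_functions_def)
  have c: "continuous_on UNIV \<phi>" "continuous_on UNIV (dbar1 \<phi>)" "continuous_on UNIV (dbar2 \<phi>)"
    using s[of 0] s[of "Suc 0"] unfolding dbar1_def[abs_def] dbar2_def[abs_def] by (auto intro!: continuous_intros)
  then show "\<phi> \<in> borel_measurable borel" "dbar1 \<phi> \<in> borel_measurable borel" "dbar2 \<phi> \<in> borel_measurable borel"
    by (auto intro: borel_measurable_continuous_onI)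
  have z0: "\<phi> z = 0" if "z \<notin> ?K" for z using that closure_subset[of "{z. \<phi> z \<noteq> 0}"] by auto
  have fd: "frechet_derivative \<phi> (at z) v = 0" if "z \<notin> ?K" for z v
    using frechet_derivative_support[of ?K \<phi> z v] z0 compact_imp_closed[OF K(1)] that by blast
  have z1: "dbar1 \<phi> z = 0" "dbar2 \<phi> z = 0" if "z \<notin> ?K" for z
    using fd[OF that] by (simp_all add: dbar1_def dbar2_def)
  show "z \<notin> Omega \<Longrightarrow> \<phi> z = 0" "z \<notin> Omega \<Longrightarrow> dbar1 \<phi> z = 0" "z \<notin> Omega \<Longrightarrow> dbar2 \<phi> z = 0"
    using K(2) z0 z1 by blast+
  obtain B0 where "\<And>z. cmod (\<phi> z) \<le> B0" using continuous_support_bounded[OF c(1) K(1) z0] by auto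
  moreover obtain B1 where "\<And>z. cmod (dbar1 \<phi> z) \<le> B1" using continuous_support_bounded[OF c(2) K(1) z1(1)] by auto
  moreover obtain B2 where "\<And>z. cmod (dbar2 \<phi> z) \<le> B2" using continuous_support_bounded[OF c(3) K(1) z1(2)] by auto
  ultimately show "\<exists>B. (\<forall>z. cmod (\<phi> z) \<le> B) \<and> (\<forall>z. cmod (dbar1 \<phi> z) \<le> B) \<and> (\<forall>z. cmod (dbar2 \<phi> z) \<le> B)"
    by (intro exI[of _ "max B0 (max B1 B2)"]) (auto simp: le_max_iff_disj)
  have "\<phi> differentiable (at (x, y))" using s[of "Suc 0"] by simp
  then show "dbar1 \<phi> (x, y) = dbar (\<lambda>x. \<phi> (x, y)) x" "dbar2 \<phi> (x, y) = dbar (\<lambda>y. \<phi> (x, y)) y"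
    by (simp_all add: dbar1_def dbar2_def dbar_def frechet_derivative_slice)
qed

lemma dbar_cmult:
  assumes "a differentiable (at x)"
  shows "dbar (\<lambda>x. a x * c) x = dbar a x * c" "dbar (\<lambda>x. c * a x) x = c * dbar a x"
proof -
  have "dbar (\<lambda>x. c) x = 0" by (simp add: dbar_def)
  then show "dbar (\<lambda>x. a x * c) x = dbar a x * c" "dbar (\<lambda>x. c * a x) x = c * dbar a x"
    using dbar_mult[of a x "\<lambda>x. c"] dbar_mult[of "\<lambda>x. c" x a] assms by simp_all
qed

lemma test_on_differentiable: "a \<in> test_on U \<Longrightarrow> a differentiable (at x)"
  unfolding test_on_def by (metis (no_types, lifting) Ck.simps(2) mem_Collect_eq)

lemma dbar_tensor:
  assumes a: "a \<in> test_on unit_disc" and b: "b \<in> test_on punctured_disc"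
  shows "dbar1 (\<lambda>(x, y). a x * b y) z = dbar a (fst z) * b (snd z)"
    "dbar2 (\<lambda>(x, y). a x * b y) z = a (fst z) * dbar b (snd z)"
  using test_functions_props(8,9)[OF test_on_tensor[OF a b], of "fst z" "snd z"]
    dbar_cmult[OF test_on_differentiable[OF a]] dbar_cmult[OF test_on_differentiable[OF b]]
  by simp_all

lemma punctured_subset: "punctured_disc \<subseteq> unit_disc"
  by (auto simp: punctured_disc_def unit_disc_def)

text \<open>Each derivative undoes the transform in its own variable and turns the other coefficient
  into \<open>G\<close>. The transform of \<open>G\<close> so produced cancels against the double
  term.\<close>

lemma T_borel_repr_dbar:
  assumes F1: "integrable lborel F1" "\<And>z. z \<notin> Omega \<Longrightarrow> F1 z = 0"
    and F2: "integrable lborel F2" "\<And>z. z \<notin> Omega \<Longrightarrow> F2 z = 0"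
    and G: "integrable lborel G" "\<And>z. z \<notin> Omega \<Longrightarrow> G z = 0"
    and weak1: "\<And>\<phi>. \<phi> \<in> test_functions \<Longrightarrow> (LINT z|lborel. F2 z * dbar1 \<phi> z) = - (LINT z|lborel. G z * \<phi> z)"
    and weak2: "\<And>\<phi>. \<phi> \<in> test_functions \<Longrightarrow> (LINT z|lborel. F1 z * dbar2 \<phi> z) = - (LINT z|lborel. G z * \<phi> z)"
    and \<phi>: "\<phi> \<in> test_functions"
  shows "(LINT z|lborel. T_borel_repr F1 F2 G z * dbar1 \<phi> z) = - (LINT z|lborel. F1 z * \<phi> z)"
    "(LINT z|lborel. T_borel_repr F1 F2 G z * dbar2 \<phi> z) = - (LINT z|lborel. F2 z * \<phi> z)"
proof -
  note p = test_functions_props[OF \<phi>]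
  note [measurable] = p(1,2,3)
  have Fm[measurable]: "F1 \<in> borel_measurable borel" "F2 \<in> borel_measurable borel" "G \<in> borel_measurable borel"
    using F1(1) F2(1) G(1) by auto
  obtain B where B: "\<And>z. cmod (\<phi> z) \<le> B" "\<And>z. cmod (dbar1 \<phi> z) \<le> B" "\<And>z. cmod (dbar2 \<phi> z) \<le> B"
    using p(4) by auto
  have swb: "cmod (swap_args h z) \<le> B" if "\<And>z. cmod (h z) \<le> B" for h :: "complex \<times> complex \<Rightarrow> complex" and z
    using that by (simp add: swap_args_def case_prod_beta')
  have split: "(LINT z|lborel. T_borel_repr F1 F2 G z * d z)
      = (LINT z|lborel. cauchy2 F2 z * d z) + (LINT z|lborel. cauchy1 F1 z * d z) - (LINT z|lborel. cauchy1 (cauchy2 G) z * d z)"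
    if "d \<in> borel_measurable borel" "\<And>z. cmod (d z) \<le> B" for d
  proof -
    have "integrable lborel (\<lambda>z. cauchy2 F2 z * d z)" "integrable lborel (\<lambda>z. cauchy1 F1 z * d z)"
      "integrable lborel (\<lambda>z. cauchy1 (cauchy2 G) z * d z)"
      using that F1 F2 G by (auto intro!: integrable_mult_bounded[where B=B] integrable_cauchy1 integrable_cauchy2)
    then show ?thesis by (simp add: T_borel_repr_def ring_distribs)
  qed
  show "(LINT z|lborel. T_borel_repr F1 F2 G z * dbar1 \<phi> z) = - (LINT z|lborel. F1 z * \<phi> z)"
  proof -
    \<comment> \<open>To be used for \<open>F1\<close> and for \<open>cauchy2 G\<close>; the second
      instance cancels the contribution of \<open>F2\<close>.\<close>
    have "(LINT z|lborel. cauchy1 H z * dbar1 \<phi> z) = - (LINT z|lborel. H z * \<phi> z)" if "integrable lborel H" for H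
      by (rule integral_cauchy1_dbar[OF that order_refl p(1) B(1) test_functions_slice1[OF \<phi>] p(2) B(2) p(8)])
    moreover have "(LINT z|lborel. cauchy2 F2 z * dbar1 \<phi> z) = - (LINT z|lborel. cauchy2 G z * \<phi> z)"
    proof (rule integral_cauchy2_dbar[OF F2(1) _ G(1) _ punctured_subset has_cutoffs_punctured_disc _ p(1) B(1) test_functions_slice1[OF \<phi>] p(2) B(2) p(8)])
      show "F2 (x, y) = 0" "G (x, y) = 0" if "y \<notin> punctured_disc" for x y
        using that F2(2) G(2) by (auto simp: Omega_def)
      show "(LINT z|lborel. F2 z * (dbar a (fst z) * b (snd z))) = - (LINT z|lborel. G z * (a (fst z) * b (snd z)))"
        if ab: "a \<in> test_on unit_disc" "b \<in> test_on punctured_disc" for a b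
        using weak1[OF test_on_tensor[OF ab]] unfolding dbar_tensor[OF ab] by (simp add: case_prod_beta')
    qed
    ultimately show ?thesis
      using split[OF p(2) B(2)] F1(1) integrable_cauchy2[OF G(1)] by simp
  qed
  show "(LINT z|lborel. T_borel_repr F1 F2 G z * dbar2 \<phi> z) = - (LINT z|lborel. F2 z * \<phi> z)"
  proof -
    have swi: "(LINT z|lborel. h z * k z) = (LINT z|lborel. swap_args h z * swap_args k z)"
      if "h \<in> borel_measurable borel" "k \<in> borel_measurable borel" for h k :: "complex \<times> complex \<Rightarrow> complex"
      using integral_swap_args[of "\<lambda>z. h z * k z"] that by (simp add: swap_args_def case_prod_beta')
    have sl: "(\<lambda>x. swap_args \<phi> (x, y)) \<in> test_on punctured_disc" for y
      using test_functions_slice2[OF \<phi>] by simp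
    have d: "swap_args (dbar2 \<phi>) (x, y) = dbar (\<lambda>x. swap_args \<phi> (x, y)) x" for x y
      using p(9) by simp
    have cauchy2: "(LINT z|lborel. cauchy2 H z * dbar2 \<phi> z) = - (LINT z|lborel. H z * \<phi> z)" if H: "integrable lborel H" for H
    proof -
      have [measurable]: "H \<in> borel_measurable borel" using H by auto
      have "(LINT z|lborel. cauchy2 H z * dbar2 \<phi> z) = (LINT z|lborel. cauchy1 (swap_args H) z * swap_args (dbar2 \<phi>) z)"
        by (subst swi) (auto simp: cauchy2_eq_swap_args)
      also have "\<dots> = - (LINT z|lborel. swap_args H z * swap_args \<phi> z)"
        using p(1,3) by (intro integral_cauchy1_dbar[OF integrable_swap_args[OF H] punctured_subset _ swb[OF B(1)] sl _ swb[OF B(3)] d] swap_args_measurable)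
      also have "\<dots> = - (LINT z|lborel. H z * \<phi> z)"
        using p(1) by (subst (2) swi) auto
      finally show ?thesis .
    qed
    \<comment> \<open>After the swap the unit disc carries kernel and cutoffs, and the punctured
      disc the differentiated variable.\<close>
    have "(LINT z|lborel. cauchy1 F1 z * dbar2 \<phi> z) = (LINT z|lborel. cauchy2 (swap_args F1) z * swap_args (dbar2 \<phi>) z)"
      by (subst swi) (auto simp: cauchy2_eq_swap_args)
    also have "\<dots> = - (LINT z|lborel. cauchy2 (swap_args G) z * swap_args \<phi> z)"
    proof (rule integral_cauchy2_dbar[OF integrable_swap_args[OF F1(1)] _ integrable_swap_args[OF G(1)] _ order_refl has_cutoffs_unit_disc _ _ swb[OF B(1)] sl _ swb[OF B(3)] d])
      show "swap_args F1 (x, y) = 0" "swap_args G (x, y) = 0" if "y \<notin> unit_disc" for x y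
        using that F1(2) G(2) by (auto simp: Omega_def)
      show "swap_args \<phi> \<in> borel_measurable borel" "swap_args (dbar2 \<phi>) \<in> borel_measurable borel"
        using p(1,3) by measurable
      show "(LINT z|lborel. swap_args F1 z * (dbar a (fst z) * b (snd z))) = - (LINT z|lborel. swap_args G z * (a (fst z) * b (snd z)))"
        if ab: "a \<in> test_on punctured_disc" "b \<in> test_on unit_disc" for a b
      proof -
        let ?\<psi> = "\<lambda>(x, y). b x * a y"
        have t: "?\<psi> \<in> test_functions" by (rule test_on_tensor[OF ab(2,1)])
        note q = test_functions_props[OF t]
        have "(LINT z|lborel. swap_args F1 z * swap_args (dbar2 ?\<psi>) z) = - (LINT z|lborel. swap_args G z * swap_args ?\<psi> z)"
          using weak2[OF t] swi[OF Fm(1) q(3)] swi[OF Fm(3) q(1)] by simp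
        moreover have "swap_args (dbar2 ?\<psi>) = (\<lambda>z. dbar a (fst z) * b (snd z))" "swap_args ?\<psi> = (\<lambda>z. a (fst z) * b (snd z))"
          using dbar_tensor(2)[OF ab(2,1)] by (auto simp: swap_args_def fun_eq_iff)
        ultimately show ?thesis by simp
      qed
    qed
    also have "\<dots> = - (LINT z|lborel. cauchy1 G z * \<phi> z)"
      using p(1) by (subst (2) swi) (auto simp: cauchy2_eq_swap_args)
    finally have cauchy1: "(LINT z|lborel. cauchy1 F1 z * dbar2 \<phi> z) = - (LINT z|lborel. cauchy1 G z * \<phi> z)" .
    \<comment> \<open>The derivative in the second variable undoes an outermost
      \<open>cauchy2\<close>, so the order of the transforms is exchanged first.\<close>
    have "(LINT z|lborel. cauchy1 (cauchy2 G) z * dbar2 \<phi> z) = (LINT z|lborel. cauchy2 (cauchy1 G) z * dbar2 \<phi> z)"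
    proof (rule integral_cong_AE)
      show "AE z in lborel. cauchy1 (cauchy2 G) z * dbar2 \<phi> z = cauchy2 (cauchy1 G) z * dbar2 \<phi> z"
        using AE_integrable_kernel12[OF G(1)] by eventually_elim (simp add: cauchy_cauchy_eq)
    qed measurable
    also have "\<dots> = - (LINT z|lborel. cauchy1 G z * \<phi> z)" by (rule cauchy2[OF integrable_cauchy1[OF G(1)]])
    finally show ?thesis
      using split[OF p(3) B(3)] cauchy1 cauchy2[OF F2(1)] by simp
  qed
qed

text \<open>Comparison with the largest summand works for every exponent p \<ge> 0, so the bound can
  be used with p and again with 1/p.\<close>

lemma powr_sum3_le:
  fixes a b c p :: real
  assumes "a \<ge> 0" "b \<ge> 0" "c \<ge> 0" "p \<ge> 0"
  shows "(a + b + c) powr p \<le> 3 powr p * (a powr p + b powr p + c powr p)"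
proof -
  define m where "m = max a (max b c)"
  have "(a + b + c) powr p \<le> (3 * m) powr p"
    using assms by (intro powr_mono2) (auto simp: m_def)
  also have "\<dots> = 3 powr p * m powr p" using assms by (simp add: powr_mult m_def)
  also have "m powr p \<le> a powr p + b powr p + c powr p"
    by (auto simp: m_def max_def)
  finally show ?thesis by (simp add: mult_left_mono)
qed

text \<open>The factor 9 is 3 times 3: one from the p-th power of a sum of three terms, after taking
  the root, the other bounding \<open>3 powr (1 / p)\<close>, which comes from the root of a sum of
  three integrals.\<close>

lemma T_borel_repr_Lp:
  assumes p: "p \<ge> 1"
    and [measurable]: "F1 \<in> borel_measurable borel" "F2 \<in> borel_measurable borel" "G \<in> borel_measurable borel"
    and int: "integrable lborel (\<lambda>z. cmod (F1 z) powr p)" "integrable lborel (\<lambda>z. cmod (F2 z) powr p)"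
      "integrable lborel (\<lambda>z. cmod (G z) powr p)"
  defines "N F \<equiv> (LINT z|lborel. cmod (F z) powr p) powr (1 / p)"
  shows "integrable lborel (\<lambda>z. cmod (T_borel_repr F1 F2 G z) powr p)"
    "N (T_borel_repr F1 F2 G) \<le> 9 * (kernel_mass + kernel_mass\<^sup>2) * (N F1 + N F2 + N G)"
proof -
  \<comment> \<open>\<open>L\<close> dominates both the norm bound \<open>kernel_mass\<close> of a
    single transform and the bound \<open>kernel_mass\<close> squared of the double one.\<close>
  define L where "L = kernel_mass + kernel_mass\<^sup>2"
  note km = kernel_mass(1)
  have L: "L > 0" "kernel_mass \<le> L" "kernel_mass\<^sup>2 \<le> L" using km by (auto simp: L_def add_pos_pos)
  define I where "I F = (LINT z|lborel. cmod (F z) powr p)" for F :: "complex \<times> complex \<Rightarrow> complex"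
  have I0: "I F \<ge> 0" for F by (simp add: I_def)
  let ?X = "\<lambda>F. \<integral>\<^sup>+ z. ennreal (cmod (F z) powr p) \<partial>(lborel :: (complex \<times> complex) measure)"
  have X: "?X F = ennreal (I F)" if "integrable lborel (\<lambda>z. cmod (F z) powr p)" for F :: "complex \<times> complex \<Rightarrow> complex"
    unfolding I_def using that by (intro nn_integral_eq_integral) auto
  have kL: "ennreal (kernel_mass powr p) \<le> ennreal (L powr p)" "ennreal (kernel_mass powr p) * ennreal (kernel_mass powr p) \<le> ennreal (L powr p)"
  proof -
    show "ennreal (kernel_mass powr p) \<le> ennreal (L powr p)"
      using L km p by (intro ennreal_leI powr_mono2) auto
    have "kernel_mass powr p * kernel_mass powr p = (kernel_mass\<^sup>2) powr p"
      using km by (simp add: powr_mult power2_eq_square)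
    also have "\<dots> \<le> L powr p" using L p by (intro powr_mono2) auto
    finally show "ennreal (kernel_mass powr p) * ennreal (kernel_mass powr p) \<le> ennreal (L powr p)"
      by (simp add: ennreal_mult'[symmetric] ennreal_leI)
  qed
  have "?X (T_borel_repr F1 F2 G) \<le> (\<integral>\<^sup>+ z. ennreal (3 powr p) *
     (ennreal (cmod (cauchy2 F2 z) powr p) + ennreal (cmod (cauchy1 F1 z) powr p) + ennreal (cmod (cauchy1 (cauchy2 G) z) powr p)) \<partial>lborel)"
  proof (rule nn_integral_mono)
    fix z
    have "cmod (T_borel_repr F1 F2 G z) \<le> cmod (cauchy2 F2 z) + cmod (cauchy1 F1 z) + cmod (cauchy1 (cauchy2 G) z)"
      unfolding T_borel_repr_def by (rule order.trans[OF norm_triangle_ineq4]) (simp add: norm_triangle_ineq)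
    then have "cmod (T_borel_repr F1 F2 G z) powr p \<le> (cmod (cauchy2 F2 z) + cmod (cauchy1 F1 z) + cmod (cauchy1 (cauchy2 G) z)) powr p"
      using p by (intro powr_mono2) auto
    also have "\<dots> \<le> 3 powr p * (cmod (cauchy2 F2 z) powr p + cmod (cauchy1 F1 z) powr p + cmod (cauchy1 (cauchy2 G) z) powr p)"
      using p by (intro powr_sum3_le) auto
    finally show "ennreal (cmod (T_borel_repr F1 F2 G z) powr p) \<le> ennreal (3 powr p) *
     (ennreal (cmod (cauchy2 F2 z) powr p) + ennreal (cmod (cauchy1 F1 z) powr p) + ennreal (cmod (cauchy1 (cauchy2 G) z) powr p))"
      by (simp add: ennreal_plus[symmetric] ennreal_mult'[symmetric] ennreal_leI del: ennreal_plus)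
  qed
  also have "\<dots> = ennreal (3 powr p) * (?X (cauchy2 F2) + ?X (cauchy1 F1) + ?X (cauchy1 (cauchy2 G)))"
    by (simp add: nn_integral_cmult nn_integral_add)
  also have "\<dots> \<le> ennreal (3 powr p) * (ennreal (L powr p) * ?X F2 + ennreal (L powr p) * ?X F1 + ennreal (L powr p) * ?X G)"
  proof (intro mult_left_mono add_mono)
    show "?X (cauchy2 F2) \<le> ennreal (L powr p) * ?X F2"
      using order.trans[OF nn_integral_cauchy2_powr[of F2 p] mult_right_mono[OF kL(1)]] p by simp
    show "?X (cauchy1 F1) \<le> ennreal (L powr p) * ?X F1"
      using order.trans[OF nn_integral_cauchy1_powr[of F1 p] mult_right_mono[OF kL(1)]] p by simp
    have "?X (cauchy1 (cauchy2 G)) \<le> ennreal (kernel_mass powr p) * ?X (cauchy2 G)"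
      using p by (intro nn_integral_cauchy1_powr) measurable
    also have "\<dots> \<le> ennreal (kernel_mass powr p) * (ennreal (kernel_mass powr p) * ?X G)"
      using p by (intro mult_left_mono nn_integral_cauchy2_powr) auto
    also have "\<dots> \<le> ennreal (L powr p) * ?X G"
      unfolding mult.assoc[symmetric] by (rule mult_right_mono[OF kL(2)]) simp
    finally show "?X (cauchy1 (cauchy2 G)) \<le> ennreal (L powr p) * ?X G" .
  qed simp
  also have "\<dots> = ennreal ((3 * L) powr p * (I F1 + I F2 + I G))"
    unfolding X[OF int(1)] X[OF int(2)] X[OF int(3)]
    using I0 L p by (simp add: ennreal_plus[symmetric] ennreal_mult'[symmetric] powr_mult algebra_simps del: ennreal_plus)
  finally have main: "?X (T_borel_repr F1 F2 G) \<le> ennreal ((3 * L) powr p * (I F1 + I F2 + I G))" .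
  have Tm: "T_borel_repr F1 F2 G \<in> borel_measurable borel" unfolding T_borel_repr_def[abs_def] by measurable
  show i: "integrable lborel (\<lambda>z. cmod (T_borel_repr F1 F2 G z) powr p)"
    using Tm le_less_trans[OF main] by (intro integrableI_bounded) auto
  have "ennreal (I (T_borel_repr F1 F2 G)) \<le> ennreal ((3 * L) powr p * (I F1 + I F2 + I G))"
    using main X[OF i] by simp
  then have "I (T_borel_repr F1 F2 G) \<le> (3 * L) powr p * (I F1 + I F2 + I G)"
    using I0 by (subst (asm) ennreal_le_iff) (auto intro!: mult_nonneg_nonneg add_nonneg_nonneg)
  then have "I (T_borel_repr F1 F2 G) powr (1 / p) \<le> ((3 * L) powr p * (I F1 + I F2 + I G)) powr (1 / p)"
    using I0 p by (intro powr_mono2) auto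
  also have "\<dots> = 3 * L * (I F1 + I F2 + I G) powr (1 / p)"
    using I0 L p by (simp add: powr_mult powr_powr)
  also have "\<dots> \<le> 3 * L * (3 powr (1 / p) * (I F1 powr (1 / p) + I F2 powr (1 / p) + I G powr (1 / p)))"
    using I0 L p by (intro mult_left_mono powr_sum3_le) auto
  also have "\<dots> \<le> 3 * L * (3 * (I F1 powr (1 / p) + I F2 powr (1 / p) + I G powr (1 / p)))"
  proof -
    have "3 powr (1 / p) \<le> 3 powr (1::real)" using p by (intro powr_mono) auto
    then show ?thesis using L by (intro mult_left_mono mult_right_mono) auto
  qed
  finally show "N (T_borel_repr F1 F2 G) \<le> 9 * (kernel_mass + kernel_mass\<^sup>2) * (N F1 + N F2 + N G)"
    by (simp add: N_def I_def L_def algebra_simps)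
qed

theorem corollary3p5:
  fixes p :: real
  assumes "1 \<le> p"
  shows "\<exists>C>0. \<forall>f1 f2 :: complex \<times> complex \<Rightarrow> complex.
    weakly_dbar_closed f1 f2 \<and> in_B p f1 f2 \<longrightarrow>
      T_well_defined f1 f2 \<and>
      weak_dbar_solution (T_op f1 f2) f1 f2 \<and>
      T_op f1 f2 \<in> Lp p \<and>
      Lp_norm p (T_op f1 f2) \<le> C * B_norm p f1 f2"
proof (rule exI[of _ "9 * (kernel_mass + kernel_mass\<^sup>2)"], intro conjI allI impI)
  \<comment> \<open>The witness depends on the kernel mass alone, hence neither on the form nor on
    p.\<close>
  show "0 < 9 * (kernel_mass + kernel_mass\<^sup>2)"
    using kernel_mass(1) by (simp add: add_pos_pos)
  fix f1 f2 :: "complex \<times> complex \<Rightarrow> complex"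
  assume "weakly_dbar_closed f1 f2 \<and> in_B p f1 f2"
  then have closed: "distr_eq (distr_dbar2 (distr_of f1)) (distr_dbar1 (distr_of f2))"
    and Lp: "f1 \<in> Lp p" "f2 \<in> Lp p" "scrD f1 f2 \<in> Lp p" and ex: "\<exists>g. represents_scrD f1 f2 g"
    by (auto simp: weakly_dbar_closed_def in_B_def)
  have g: "represents_scrD f1 f2 (scrD f1 f2)"
    unfolding scrD_def using ex by (rule someI_ex)
  have ex_F: "\<exists>F. borel_repr f F" if "f \<in> Lp p" for f
    using that by (intro ex_borel_repr) (simp add: Lp_def)
  obtain F1 F2 G where R: "borel_repr f1 F1" "borel_repr f2 F2" "borel_repr (scrD f1 f2) G"
    using Lp[THEN ex_F] by blast
  note m[measurable] = R[THEN borel_repr_measurable]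
  have int: "integrable lborel F1" "integrable lborel F2" "integrable lborel G"
    using R Lp \<open>1 \<le> p\<close> by (auto intro: integrable_borel_repr)
  let ?U = "T_borel_repr F1 F2 G"
  note T = T_op_AE[OF R(1) int(1) R(2) int(2) R(3) int(3)]
  have Um[measurable]: "?U \<in> borel_measurable borel" unfolding T_borel_repr_def[abs_def] by measurable
  have Ui: "integrable lborel ?U"
    unfolding T_borel_repr_def[abs_def]
    by (intro Bochner_Integration.integrable_add Bochner_Integration.integrable_diff integrable_cauchy1 integrable_cauchy2 int)
  \<comment> \<open>A representative must vanish off \<open>Omega\<close>, whereas \<open>?U\<close>
    may be nonzero where the second coordinate is 0.\<close>
  define V where "V z = (if z \<in> Omega then ?U z else 0)" for z
  have RT: "borel_repr (T_op f1 f2) V"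
    unfolding borel_repr_def
  proof (intro conjI allI impI)
    show "V \<in> borel_measurable borel" unfolding V_def[abs_def] by measurable
    show "AE z in lborel. z \<in> Omega \<longrightarrow> T_op f1 f2 z = V z"
      using T by eventually_elim (auto simp: V_def)
  qed (simp add: V_def)
  \<comment> \<open>By closedness the two mixed derivatives agree, and \<open>G\<close> represents
    their mean, so it represents each of them.\<close>
  have weak: "(LINT z|lborel. F2 z * dbar1 \<phi> z) = - (LINT z|lborel. G z * \<phi> z)"
    "(LINT z|lborel. F1 z * dbar2 \<phi> z) = - (LINT z|lborel. G z * \<phi> z)" if t: "\<phi> \<in> test_functions" for \<phi>
  proof -
    note q = test_functions_props(1-3)[OF t]
    have "(LINT z|lborel. F1 z * dbar2 \<phi> z) = (LINT z|lborel. F2 z * dbar1 \<phi> z)"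
      using closed t unfolding distr_eq_def distr_dbar1_def distr_dbar2_def
      by (auto simp: distr_of_borel_repr[OF R(1)] distr_of_borel_repr[OF R(2)] q)
    moreover have "- (LINT z|lborel. F1 z * dbar2 \<phi> z) - (LINT z|lborel. F2 z * dbar1 \<phi> z) = 2 * (LINT z|lborel. G z * \<phi> z)"
      using g t unfolding represents_scrD_def distr_eq_def scrD_distr_def distr_dbar1_def distr_dbar2_def
      by (auto simp: distr_of_borel_repr[OF R(1)] distr_of_borel_repr[OF R(2)] distr_of_borel_repr[OF R(3)] q field_simps)
    ultimately show "(LINT z|lborel. F2 z * dbar1 \<phi> z) = - (LINT z|lborel. G z * \<phi> z)"
      "(LINT z|lborel. F1 z * dbar2 \<phi> z) = - (LINT z|lborel. G z * \<phi> z)"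
      by (simp_all add: algebra_simps minus_equation_iff)
  qed
  show "T_well_defined f1 f2"
    unfolding T_well_defined_def
  proof (intro conjI allI impI)
    show "AE (z1, z2) in lebesgue_on Omega.
        integrable (lebesgue_on punctured_disc) (\<lambda>\<zeta>2. f2 (z1, \<zeta>2) / (\<zeta>2 - z2)) \<and>
        integrable (lebesgue_on unit_disc) (\<lambda>\<zeta>1. f1 (\<zeta>1, z2) / (\<zeta>1 - z1)) \<and>
        integrable (lebesgue_on Omega)
          (\<lambda>(\<zeta>1, \<zeta>2). scrD f1 f2 (\<zeta>1, \<zeta>2) / ((\<zeta>1 - z1) * (\<zeta>2 - z2)))"
      unfolding AE_lebesgue_on_iff[OF Omega_borel] using T by eventually_elim auto
    fix f1' f2'
    assume "AE z in lebesgue_on Omega. f1' z = f1 z \<and> f2' z = f2 z"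
    then have "AE z in lebesgue_on Omega. f1' z = f1 z" "AE z in lebesgue_on Omega. f2' z = f2 z"
      by (auto elim: eventually_mono)
    then have R': "borel_repr f1' F1" "borel_repr f2' F2"
      using R borel_repr_cong by blast+
    \<comment> \<open>With the same \<open>G\<close> for both forms, both values of
      \<open>T_op\<close> agree almost everywhere with the same function \<open>?U\<close>.\<close>
    have "borel_repr (scrD f1' f2') G" unfolding scrD_cong[OF R(1,2) R'] by (rule R(3))
    from T_op_AE[OF R'(1) int(1) R'(2) int(2) this int(3)] T
    show "AE z in lebesgue_on Omega. T_op f1' f2' z = T_op f1 f2 z"
      unfolding AE_lebesgue_on_iff[OF Omega_borel] by eventually_elim auto
  qed
  show "weak_dbar_solution (T_op f1 f2) f1 f2"
    unfolding weak_dbar_solution_def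
  proof (intro conjI)
    show "loc_integrable (T_op f1 f2)"
      unfolding loc_integrable_def
    proof (intro allI impI)
      fix K assume K: "compact K \<and> K \<subseteq> Omega"
      then have Kb[measurable]: "K \<in> sets borel" by (simp add: compact_imp_closed borel_closed)
      have "integrable lborel (\<lambda>z. indicator K z *\<^sub>R ?U z)"
        using Ui by (rule integrable_mult_indicator[rotated]) simp
      moreover have "AE z in lborel. z \<in> K \<longrightarrow> T_op f1 f2 z = indicator K z *\<^sub>R ?U z"
        using T by eventually_elim (use K in auto)
      ultimately show "integrable (lebesgue_on K) (T_op f1 f2)"
        by (subst lebesgue_on_borel_representative(2)[OF Kb, where H="\<lambda>z. indicator K z *\<^sub>R ?U z"]) auto
    qed
    \<comment> \<open>Against functions vanishing off \<open>Omega\<close> the truncated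
      \<open>V\<close> may be replaced by \<open>?U\<close>.\<close>
    have dU: "distr_of (T_op f1 f2) \<psi> = (LINT z|lborel. ?U z * \<psi> z)"
      if "\<psi> \<in> borel_measurable borel" "\<And>z. z \<notin> Omega \<Longrightarrow> \<psi> z = 0" for \<psi>
      unfolding distr_of_borel_repr[OF RT that(1)]
      by (rule Bochner_Integration.integral_cong) (auto simp: V_def that(2))
    note Td = T_borel_repr_dbar[OF int(1) borel_repr_zero[OF R(1)] int(2) borel_repr_zero[OF R(2)] int(3) borel_repr_zero[OF R(3)] weak]
    show "distr_eq (distr_dbar1 (distr_of (T_op f1 f2))) (distr_of f1)"
      unfolding distr_eq_def distr_dbar1_def
    proof
      fix \<phi> assume t: "\<phi> \<in> test_functions"
      show "- distr_of (T_op f1 f2) (dbar1 \<phi>) = distr_of f1 \<phi>"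
        using Td(1)[OF _ _ _ _ _ t] test_functions_props(1,2,6)[OF t] by (simp add: dU distr_of_borel_repr[OF R(1)])
    qed
    show "distr_eq (distr_dbar2 (distr_of (T_op f1 f2))) (distr_of f2)"
      unfolding distr_eq_def distr_dbar2_def
    proof
      fix \<phi> assume t: "\<phi> \<in> test_functions"
      show "- distr_of (T_op f1 f2) (dbar2 \<phi>) = distr_of f2 \<phi>"
        using Td(2)[OF _ _ _ _ _ t] test_functions_props(1,3,7)[OF t] by (simp add: dU distr_of_borel_repr[OF R(2)])
    qed
  qed
  have iL: "integrable lborel (\<lambda>z. cmod (F1 z) powr p)" "integrable lborel (\<lambda>z. cmod (F2 z) powr p)"
    "integrable lborel (\<lambda>z. cmod (G z) powr p)"
    using Lp Lp_borel_repr(1)[OF R(1)] Lp_borel_repr(1)[OF R(2)] Lp_borel_repr(1)[OF R(3)] by auto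
  note TL = T_borel_repr_Lp[OF \<open>1 \<le> p\<close> m iL]
  have VU: "cmod (V z) powr p \<le> cmod (?U z) powr p" for z by (simp add: V_def)
  have iV: "integrable lborel (\<lambda>z. cmod (V z) powr p)"
    by (rule Bochner_Integration.integrable_bound[OF TL(1)]) (use VU borel_repr_measurable[OF RT] in auto)
  then show "T_op f1 f2 \<in> Lp p" by (simp add: Lp_borel_repr(1)[OF RT])
  have "Lp_norm p (T_op f1 f2) \<le> (LINT z|lborel. cmod (?U z) powr p) powr (1 / p)"
    unfolding Lp_borel_repr(2)[OF RT] using integral_mono[OF iV TL(1) VU] \<open>1 \<le> p\<close>
    by (intro powr_mono2) auto
  also have "\<dots> \<le> 9 * (kernel_mass + kernel_mass\<^sup>2) * B_norm p f1 f2"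
    using TL(2) unfolding B_norm_def Lp_borel_repr(2)[OF R(1)] Lp_borel_repr(2)[OF R(2)] Lp_borel_repr(2)[OF R(3)] .
  finally show "Lp_norm p (T_op f1 f2) \<le> 9 * (kernel_mass + kernel_mass\<^sup>2) * B_norm p f1 f2" .
qed

end
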